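(* Let $k\ge 1$ and let $\Lambda\subset\mathbb{Z}_+^k$ be a finite set. For $\vec N=(N_1,\dots,N_k)\in\mathbb{N}^k$ and $\xi=(\xi_{\mathfrak m})_{\mathfrak m\in\Lambda}\in\mathbb{R}^{|\Lambda|}$ put $$H^{\Lambda}_{\vec N}(\xi):=\sum_{\substack{t=(t_1,\dots,t_k)\in\mathbb{Z}^k\\ 1\le|t_\nu|\le N_\nu\ (1\le\nu\le k)}}\frac{e^{2\pi i\sum_{\mathfrak m\in\Lambda}\xi_{\mathfrak m}t^{\mathfrak m}}}{t_1\cdots t_k}.$$ (i) If $\Lambda$ contains no odd subset, then $\sup_{\vec N\in\mathbb{N}^k,\ \xi\in\mathbb{R}^{|\Lambda|}}|H^\Lambda_{\vec N}(\xi)|=0$. (ii) Suppose that $\Lambda$ contains an odd subset. Then there exists a constant $C_\Lambda>0$ such that $$\sup_{\vec N\in\mathbb{N}^k,\ \xi\in\mathbb{R}^{|\Lambda|}}|H^\Lambda_{\vec N}(\xi)|\le C_\Lambda$$ if and only if every $\mathfrak m=(m_1,\dots,m_k)\in\Lambda$ has at most one odd component. Combining (i) and (ii): $H^\Lambda_{\vec N}(\xi)$ is bounded uniformly in $\vec N\in\mathbb{N}^k$ and $\xi\in\mathbb{R}^{|\Lambda|}$ if and only if either $\Lambda$ contains no odd subset, or for every odd subset $\Omega$ of $\Lambda$ the set of residue vectors $\{[\mathfrak m]_2:\mathfrak m\in\Omega\}$ is equal to $\{\mathbf e_1,\dots,\mathbf e_k\}$ or to $\{\mathbf e_1,\dots,\mathbf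 e_k,\mathbf 0\}$.
   Context: $\mathbb{Z}_+=\mathbb{N}\cup\{0\}$ denotes the non-negative integers, and $\mathbb N$ the positive integers. For $\mathfrak m=(m_1,\dots,m_k)\in\mathbb{Z}_+^k$, $t^{\mathfrak m}=t_1^{m_1}\cdots t_k^{m_k}$. A (finite) subset $\Omega\subset\mathbb{Z}^k$ is called odd if every component of the vector $\sum_{\mathfrak m\in\Omega}\mathfrak m$ is an odd integer, and even if at least one component of this vector is even. $[\mathfrak m]_2=([m_1]_2,\dots,[m_k]_2)$, where $[a]_2\in\{0,1\}$ is the remainder of $a$ modulo $2$. $\mathbf e_1,\dots,\mathbf e_k$ are the standard unit vectors of $\mathbb{Z}^k$ and $\mathbf 0$ is the zero vector. *)

theory Defs
  imports "HOL-Analysis.Analysis"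
begin

text \<open>
  The dimension \<open>k \<ge> 1\<close> is \<open>CARD('k)\<close> for an arbitrary finite index type \<open>'k\<close>.
  Exponent vectors are elements of \<open>nat ^ 'k\<close>.
\<close>

definition monomial :: "int ^ 'k \<Rightarrow> nat ^ 'k::finite \<Rightarrow> int" where
  "monomial t m = (\<Prod>\<nu>\<in>UNIV. (t $ \<nu>) ^ (m $ \<nu>))"

definition summation_box :: "nat ^ 'k::finite \<Rightarrow> (int ^ 'k) set" where
  "summation_box N = {t. \<forall>\<nu>. 1 \<le> \<bar>t $ \<nu>\<bar> \<and> \<bar>t $ \<nu>\<bar> \<le> int (N $ \<nu>)}"

lemma finite_summation_box: "finite (summation_box N)"
proof (rule finite_subset)
  let ?P = "Pi UNIV (\<lambda>\<nu>. {- int (N $ \<nu>)..int (N $ \<nu>)})"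
  show "summation_box N \<subseteq> vec_lambda ` ?P"
  proof
    fix t assume "t \<in> summation_box N"
    then have "- int (N $ \<nu>) \<le> t $ \<nu> \<and> t $ \<nu> \<le> int (N $ \<nu>)" for \<nu>
      by (simp add: summation_box_def) (metis abs_le_D1 abs_le_D2 minus_le_iff)
    then have "(\<lambda>\<nu>. t $ \<nu>) \<in> ?P" by auto
    then show "t \<in> vec_lambda ` ?P" by (metis image_eqI vec_nth_inverse)
  qed
  have "finite (PiE UNIV (\<lambda>\<nu>. {- int (N $ \<nu>)..int (N $ \<nu>)}))"
    by (rule finite_PiE) auto
  then show "finite (vec_lambda ` ?P)" by (simp add: PiE_def)
qed

text \<open>
  The coefficient family is a function on all exponent vectors; only its values on
  \<open>\<Lambda>\<close> enter the sum, so that the supremum over all such functions is the supremum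
  over \<open>\<real>\<^sup>\<Lambda>\<close>.
\<close>

definition hilbert_sum ::
    "(nat ^ 'k::finite) set \<Rightarrow> nat ^ 'k \<Rightarrow> (nat ^ 'k \<Rightarrow> real) \<Rightarrow> complex" where
  "hilbert_sum \<Lambda> N \<xi> =
    (\<Sum>t\<in>summation_box N.
      exp (2 * of_real pi * \<i> * of_real (\<Sum>m\<in>\<Lambda>. \<xi> m * of_int (monomial t m)))
        / of_int (\<Prod>\<nu>\<in>UNIV. t $ \<nu>))"

definition positive_vectors :: "(nat ^ 'k::finite) set" where
  "positive_vectors = {N. \<forall>\<nu>. 1 \<le> N $ \<nu>}"

text \<open>Taken in the extended reals, since it may be infinite.\<close>

definition hilbert_sup :: "(nat ^ 'k::finite) set \<Rightarrow> ereal" where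
  "hilbert_sup \<Lambda> = (SUP (N, \<xi>) \<in> positive_vectors \<times> UNIV. ereal (norm (hilbert_sum \<Lambda> N \<xi>)))"

definition odd_set :: "('a::semiring_parity ^ 'k::finite) set \<Rightarrow> bool" where
  "odd_set \<Omega> \<longleftrightarrow> finite \<Omega> \<and> (\<forall>\<nu>. odd ((\<Sum>m\<in>\<Omega>. m) $ \<nu>))"

definition residue2 :: "nat ^ 'k::finite \<Rightarrow> nat ^ 'k" where
  "residue2 m = (\<chi> \<nu>. m $ \<nu> mod 2)"

definition unit_vectors :: "(nat ^ 'k::finite) set" where
  "unit_vectors = range (\<lambda>\<nu>. axis \<nu> 1)"

end

theory Submission
  imports Defs
begin

text \<open>
  Expanding the exponential into products of sines and cosines and flipping the signs of the
  \<open>t\<^sub>\<nu>\<close> one at a time kills every term except those whose sines run over an odd subset. This gives (i).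

  For the upper bound the sum is cut into dyadic pieces \<open>j\<close>. If the piece \<open>j\<close> is at least \<open>1 / X\<close> and all
  its sides are large, a quantitative converse of Weyl's theorem makes the coefficients nearly rational
  on its scale; as the piece is odd in \<open>t\<^sub>\<nu>\<close> unless an exponent with odd \<open>\<nu>\<close>-th component matters, for each
  \<open>\<nu>\<close> some such exponent \<open>n\<close> has a coefficient whose distance to a fraction is \<open>2\<close> to the power
  \<open>- n \<bullet> j\<close>, up to powers of \<open>X\<close>. So \<open>n \<bullet> j\<close> lies in a window of length \<open>O(log X)\<close> that does not
  depend on \<open>j\<close>. When every exponent has at most one odd component, the matrix of these exponents is the
  identity modulo 2, hence invertible, and only \<open>O((log X)\<^sup>k)\<close> large pieces remain. Pieces with a short
  side are handled by induction on the number of variables: a very short variable is summed trivially,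
  and for one of moderate length the windows of its slices agree outside a small set of exceptional values.

  For the lower bound some minimal odd subset contains an exponent \<open>m\<close> with odd components at \<open>a \<noteq> b\<close>. All
  other phases are set to \<open>1 / 4\<close>, where the sine becomes a quartic character. Averaging over the phase of
  \<open>m\<close> replaces its sine by a sign at logarithmic cost, while the resulting sum of positive terms grows
  like \<open>log\<^sup>2\<close>, since it runs over the two variables \<open>t\<^sub>a\<close> and \<open>t\<^sub>b\<close>.
\<close>

subsection \<open>Approximation by fractions with small denominators\<close>

text \<open>Each analytic step loses a power of a parameter X \<ge> 2 and absorbs its numerical
  constants into such powers, so the statements have the form: there is an exponent C, independent
  of the coefficients, valid for all X. Such a loss only multiplies the length of a window of scales
  by a constant, because scales are counted logarithmically. It then suffices that the pieces of
  size about 1 / X number at most a small power of X, for the sum over dyadic X converges.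

  The obstacle is a piece with a short side, where Weyl's theorem says nothing. Trivial summation
  over a variable of length n costs about n ^ 2 families of lower-dimensional pieces. This is
  affordable only if n is below a power of Z that is fixed before X = Z ^ K is chosen, whereas the
  converse of Weyl's theorem needs sides above a power of X itself. The gap between the two
  thresholds is what forces \<open>common_scale\<close>: most slices of such a variable must share
  their windows, or the count would again pay for the full length of the variable.\<close>

definition appr :: "real \<Rightarrow> real \<Rightarrow> real \<Rightarrow> bool" where
  "appr x Y \<epsilon> \<longleftrightarrow> (\<exists>q a. 1 \<le> q \<and> real q \<le> Y \<and> \<bar>x - of_int a / real q\<bar> \<le> \<epsilon>)"

lemma apprI: "1 \<le> q \<Longrightarrow> real q \<le> Y \<Longrightarrow> \<bar>x - of_int a / real q\<bar> \<le> \<epsilon> \<Longrightarrow> appr x Y \<epsilon>"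
  unfolding appr_def by blast

lemma apprE:
  assumes "appr x Y \<epsilon>"
  obtains q a where "1 \<le> q" "real q \<le> Y" "\<bar>x - of_int a / real q\<bar> \<le> \<epsilon>"
  using assms unfolding appr_def by blast

lemma appr_mono: "appr x Y \<epsilon> \<Longrightarrow> Y \<le> Y' \<Longrightarrow> \<epsilon> \<le> \<epsilon>' \<Longrightarrow> appr x Y' \<epsilon>'"
  unfolding appr_def by (meson order_trans)

lemma appr_one: "1 \<le> Y \<Longrightarrow> 1 \<le> \<epsilon> \<Longrightarrow> appr x Y \<epsilon>"
  by (rule apprI[of 1 _ _ "\<lfloor>x\<rfloor>"]) (simp_all, linarith)

lemma appr_zero: "1 \<le> Y \<Longrightarrow> 0 \<le> \<epsilon> \<Longrightarrow> appr 0 Y \<epsilon>"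
  by (rule apprI[of 1 _ _ 0]) simp_all

text \<open>The common fraction is not reduced: \<open>appr\<close> bounds some denominator, not the
  least one. Multiplying denominators is affordable as long as the number of summands is
  bounded.\<close>

lemma appr_add:
  assumes "appr x Y \<epsilon>" "appr x' Y' \<epsilon>'"
  shows "appr (x + x') (Y * Y') (\<epsilon> + \<epsilon>')"
proof -
  obtain q a where q: "1 \<le> q" "real q \<le> Y" "\<bar>x - of_int a / real q\<bar> \<le> \<epsilon>"
    using assms(1) by (rule apprE)
  obtain q' a' where q': "1 \<le> q'" "real q' \<le> Y'" "\<bar>x' - of_int a' / real q'\<bar> \<le> \<epsilon>'"
    using assms(2) by (rule apprE)
  have eq: "of_int (a * int q' + a' * int q) / real (q * q') = of_int a / real q + of_int a' / real q'"
    using q(1) q'(1) by (simp add: field_simps)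
  show ?thesis
  proof (rule apprI[of "q * q'" _ _ "a * int q' + a' * int q"])
    show "1 \<le> q * q'" using q(1) q'(1) by (simp add: Suc_le_eq)
    show "real (q * q') \<le> Y * Y'" using q q' by (simp add: mult_mono)
    show "\<bar>x + x' - of_int (a * int q' + a' * int q) / real (q * q')\<bar> \<le> \<epsilon> + \<epsilon>'"
      unfolding eq using q(3) q'(3) by linarith
  qed
qed

lemma appr_mult_int:
  assumes "appr x Y \<epsilon>"
  shows "appr (of_int b * x) Y (\<bar>of_int b\<bar> * \<epsilon>)"
proof -
  obtain q a where q: "1 \<le> q" "real q \<le> Y" "\<bar>x - of_int a / real q\<bar> \<le> \<epsilon>"
    using assms by (rule apprE)
  have "\<bar>of_int b * x - of_int (b * a) / real q\<bar> = \<bar>of_int b\<bar> * \<bar>x - of_int a / real q\<bar>"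
    by (simp add: abs_mult[symmetric] algebra_simps)
  also have "\<dots> \<le> \<bar>of_int b\<bar> * \<epsilon>" using q(3) by (simp add: mult_left_mono)
  finally show ?thesis using q by (intro apprI[of q _ _ "b * a"])
qed

lemma appr_uminus: "appr x Y \<epsilon> \<Longrightarrow> appr (- x) Y \<epsilon>"
  using appr_mult_int[of x Y \<epsilon> "-1"] by simp

lemma appr_diff: "appr x Y \<epsilon> \<Longrightarrow> appr x' Y' \<epsilon>' \<Longrightarrow> appr (x - x') (Y * Y') (\<epsilon> + \<epsilon>')"
  using appr_add[of x Y \<epsilon> "- x'" Y' \<epsilon>'] appr_uminus by simp

text \<open>The gain of a factor \<open>l\<close> in the error is given up; \<open>l\<close> will be
  a degree or a small denominator.\<close>

lemma appr_divide:
  assumes "appr (real l * x) Y \<epsilon>" "1 \<le> l"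
  shows "appr x (real l * Y) \<epsilon>"
proof -
  obtain q a where q: "1 \<le> q" "real q \<le> Y" "\<bar>real l * x - of_int a / real q\<bar> \<le> \<epsilon>"
    using assms(1) by (rule apprE)
  have "real l * \<bar>x - of_int a / real (l * q)\<bar> = \<bar>real l * x - of_int a / real q\<bar>"
    using assms(2) q(1) by (simp add: abs_mult_pos' field_simps)
  moreover have "1 * \<bar>x - of_int a / real (l * q)\<bar> \<le> real l * \<bar>x - of_int a / real (l * q)\<bar>"
    using assms(2) by (intro mult_right_mono) auto
  ultimately have "\<bar>x - of_int a / real (l * q)\<bar> \<le> \<epsilon>" using q(3) by (simp only: mult_1)
  then show ?thesis using q assms(2)
    by (intro apprI[of "l * q" _ _ a]) (auto simp: Suc_le_eq mult_left_mono)
qed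

lemma appr_sum:
  assumes "finite A" "\<And>i. i \<in> A \<Longrightarrow> appr (x i) Y (\<epsilon> i)" "1 \<le> Y"
  shows "appr (sum x A) (Y ^ card A) (sum \<epsilon> A)"
  using assms
proof (induction A rule: finite_induct)
  case empty
  then show ?case by (simp add: appr_zero)
next
  case (insert i A)
  then show ?case using appr_add[of "x i" Y "\<epsilon> i" "sum x A" "Y ^ card A" "sum \<epsilon> A"] by simp
qed

lemma fraction_separation:
  assumes "1 \<le> q" "1 \<le> q'" "of_int a / real q \<noteq> of_int a' / real q'"
  shows "1 \<le> real q * real q' * \<bar>of_int a / real q - of_int a' / real q'\<bar>"
proof -
  have "real q * real q' * (of_int a / real q - of_int a' / real q') = of_int (a * int q' - a' * int q)"
    using assms by (simp add: field_simps)
  then have eq: "real q * real q' * \<bar>of_int a / real q - of_int a' / real q'\<bar> = \<bar>of_int (a * int q' - a' * int q)\<bar>"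
    by (metis abs_mult abs_of_nat of_nat_mult)
  have "a * int q' - a' * int q \<noteq> 0"
  proof
    assume "a * int q' - a' * int q = 0"
    then have "real_of_int a * real q' = of_int a' * real q"
      by (metis eq_iff_diff_eq_0 of_int_mult of_int_of_nat_eq)
    then show False using assms by (simp add: frac_eq_eq)
  qed
  then show ?thesis unfolding eq by linarith
qed

lemma two_power_le: "X \<ge> (2::real) \<Longrightarrow> (2::real) ^ n \<le> X ^ n"
  by (simp add: power_mono)

text \<open>A constant n costs at most n powers of X. In this way numerical constants disappear from
  the estimates.\<close>

lemma const_le_power:
  assumes "X \<ge> (2::real)"
  shows "real n \<le> X ^ n"
proof -
  have "real n \<le> 2 ^ n" using less_exp[of n] by (metis less_imp_le of_nat_le_iff of_nat_numeral of_nat_power)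
  then show ?thesis using two_power_le[OF assms, of n] by linarith
qed

text \<open>Each value is at most \<open>\<tau>\<close> plus M times the indicator of being at least
  \<open>\<tau>\<close>. This turns a large sum into many large terms; it is applied to norms of
  sums and to cardinalities of fibres alike.\<close>

lemma popular:
  fixes f :: "'b \<Rightarrow> real" and M \<tau> :: real
  assumes "finite A" "\<And>a. a \<in> A \<Longrightarrow> f a \<le> M" "0 \<le> \<tau>" "0 \<le> M"
  shows "sum f A - \<tau> * card A \<le> M * card {a\<in>A. \<tau> \<le> f a}"
proof -
  let ?G = "{a\<in>A. \<tau> \<le> f a}"
  have "sum f A \<le> (\<Sum>a\<in>A. \<tau> + M * of_bool (\<tau> \<le> f a))"
    using assms by (intro sum_mono) (auto simp: of_bool_def intro: add_increasing)
  also have "\<dots> = \<tau> * card A + M * card ?G"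
    using assms(1) by (simp add: sum.distrib sum_distrib_left[symmetric] Int_def)
  finally show ?thesis by simp
qed

text \<open>By the pigeonhole principle many of the multiples h * \<alpha> are close to fractions
  with one denominator q. A Dirichlet approximation of q * \<alpha> with denominator r up to 2 * N
  must then have small r, since otherwise too few h could bring h * q * \<alpha> near an integer.
  Finally a single large h yields the gain of the factor N in the error.\<close>

lemma linear_approximation:
  assumes X: "X \<ge> 2" and N: "N \<ge> 1" and eps: "0 \<le> \<epsilon>" "18 * X ^ 3 * \<epsilon> < 1"
    and H: "H \<subseteq> {1..N}" "real N / X \<le> card H"
    and ap: "\<And>h. h \<in> H \<Longrightarrow> appr (real h * \<alpha>) X \<epsilon>"
  shows "appr \<alpha> (3 * X ^ 3) (X ^ 3 * \<epsilon> / N)"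
proof -
  have finH: "finite H" using H(1) finite_subset by blast
  have "\<forall>h. \<exists>q. h \<in> H \<longrightarrow> 1 \<le> q \<and> real q \<le> X \<and> (\<exists>a::int. \<bar>real h * \<alpha> - of_int a / real q\<bar> \<le> \<epsilon>)"
    using ap unfolding appr_def by meson
  then obtain Q where Q: "\<And>h. h \<in> H \<Longrightarrow> 1 \<le> Q h \<and> real (Q h) \<le> X \<and> (\<exists>a::int. \<bar>real h * \<alpha> - of_int a / real (Q h)\<bar> \<le> \<epsilon>)"
    by metis
  define T where "T = {1..nat \<lfloor>X\<rfloor>}"
  have T: "finite T" "T \<noteq> {}" "real (card T) \<le> X" using X by (auto simp: T_def le_nat_floor)
  have QT: "Q \<in> H \<rightarrow> T" using Q by (auto simp: T_def le_nat_floor)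
  have "\<exists>q\<in>T. card H \<le> card (Q -` {q} \<inter> H) * card T"
    using pigeonhole_card[OF QT finH T(1,2)] by blast
  then obtain q where q: "q \<in> T" "card H \<le> card (Q -` {q} \<inter> H) * card T" by blast
  define H' where "H' = Q -` {q} \<inter> H"
  have H': "finite H'" "H' \<subseteq> {1..N}" using finH H(1) by (auto simp: H'_def)
  have q1: "1 \<le> q" "real q \<le> X" using q(1) using q(1) X by (auto simp: T_def le_nat_iff le_floor_iff)
  have "real N / X \<le> real (card H') * real (card T)"
    using H(2) q(2) unfolding H'_def by (metis of_nat_le_iff of_nat_mult order_trans)
  also have "\<dots> \<le> real (card H') * X" using T by (intro mult_left_mono) auto
  finally have cH': "real N / X\<^sup>2 \<le> card H'" using X by (simp add: field_simps power2_eq_square)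
  define \<beta> where "\<beta> = real q * \<alpha>"
  define e where "e = X * \<epsilon>"
  have near: "\<exists>z::int. \<bar>real h * \<beta> - of_int z\<bar> \<le> e" if h: "h \<in> H'" for h
  proof -
    obtain z :: int where z: "\<bar>real h * \<alpha> - of_int z / real q\<bar> \<le> \<epsilon>" using Q[of h] h by (auto simp: H'_def)
    have "\<bar>real h * \<beta> - of_int z\<bar> = real q * \<bar>real h * \<alpha> - of_int z / real q\<bar>"
      using q1 by (simp add: \<beta>_def abs_mult_pos' algebra_simps)
    also have "\<dots> \<le> X * \<epsilon>" using z q1 by (intro mult_mono) auto
    finally show ?thesis by (auto simp: e_def)
  qed
  then obtain Z :: "nat \<Rightarrow> int" where Z: "\<And>h. h \<in> H' \<Longrightarrow> \<bar>real h * \<beta> - of_int (Z h)\<bar> \<le> e" by metis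
  \<comment> \<open>The bound 2 * N makes the Dirichlet error at most 1 / 2 after multiplication by
    h \<le> N.\<close>
  obtain a k where ak: "coprime a k" "0 < k" "k \<le> int (2 * N)" "\<bar>of_int k * \<beta> - of_int a\<bar> < 1 / real (2 * N)"
    using Dirichlet_approx_coprime[of "2 * N" \<beta>] N by auto
  define r where "r = nat k"
  have r: "0 < r" "r \<le> 2 * N" "k = int r" using ak by (auto simp: r_def)
  have e0: "0 \<le> e" using eps X by (simp add: e_def)
  \<comment> \<open>The integer h * a - r * Z h is at most r * e + 1 / 2 in absolute value, hence at
    most the floor of this.\<close>
  define w where "w = \<lfloor>r * e + 1 / 2\<rfloor>"
  have bnd: "\<bar>int h * a - int r * Z h\<bar> \<le> w" if h: "h \<in> H'" for h
  proof -
    have hN: "real h \<le> N" using h H' by auto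
    have "real_of_int (int h * a - int r * Z h) = real r * (real h * \<beta> - of_int (Z h)) - real h * (of_int k * \<beta> - of_int a)"
      by (simp add: r(3) algebra_simps)
    then have "\<bar>real_of_int (int h * a - int r * Z h)\<bar> \<le> real r * \<bar>real h * \<beta> - of_int (Z h)\<bar> + real h * \<bar>of_int k * \<beta> - of_int a\<bar>"
      by (metis abs_mult abs_of_nat abs_triangle_ineq4)
    also have "\<dots> \<le> real r * e + real N * (1 / real (2 * N))"
      using Z[OF h] hN ak(4) by (intro add_mono mult_mono) auto
    also have "\<dots> = r * e + 1 / 2" using N by simp
    finally show ?thesis unfolding w_def by linarith
  qed
  have w0: "0 \<le> w" using e0 by (simp add: w_def)
  have cH'pos: "0 < real (card H')" using cH' N X by (smt (verit) divide_pos_pos of_nat_le_iff of_nat_1 zero_less_power)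
  \<comment> \<open>Since a is invertible modulo r, the second component determines h mod r, and h
    div r supplies the rest.\<close>
  have inj: "inj_on (\<lambda>h. (h div r, int h * a - int r * Z h)) H'"
  proof (rule inj_onI)
    fix h h' assume hh: "h \<in> H'" "h' \<in> H'"
      and eq: "(h div r, int h * a - int r * Z h) = (h' div r, int h' * a - int r * Z h')"
    have "(int h - int h') * a = int r * (Z h - Z h')" using eq by (simp add: algebra_simps)
    then have "int r dvd (int h - int h')" using ak(1) r(3) coprime_dvd_mult_left_iff
      by (metis coprime_commute dvd_triv_left)
    then have "h mod r = h' mod r" by (metis mod_eq_dvd_iff of_nat_eq_iff zmod_int)
    then show "h = h'" using eq by (metis div_mult_mod_eq prod.inject)
  qed
  have "card H' \<le> card ({0..N div r} \<times> {-w..w})"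
  proof (rule card_inj_on_le[OF inj])
    have "- w \<le> int h * a - int r * Z h \<and> int h * a - int r * Z h \<le> w" if "h \<in> H'" for h
      using bnd[OF that] by linarith
    then show "(\<lambda>h. (h div r, int h * a - int r * Z h)) ` H' \<subseteq> {0..N div r} \<times> {-w..w}"
      using H' by (auto simp: div_le_mono)
  qed simp
  also have "\<dots> = (N div r + 1) * nat (2 * w + 1)" by (simp add: card_cartesian_product)
  finally have "real (card H') \<le> real ((N div r + 1) * nat (2 * w + 1))" by (rule of_nat_mono)
  also have "\<dots> \<le> (N / r + 1) * (2 * w + 1)"
  proof -
    have "real ((N div r + 1) * nat (2 * w + 1)) = (real (N div r) + 1) * (2 * w + 1)"
      using w0 by (simp add: algebra_simps)
    also have "\<dots> \<le> (N / r + 1) * (2 * w + 1)"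
      using w0 of_nat_div_le_of_nat[of N r, where 'a=real] by (intro mult_right_mono) auto
    finally show ?thesis .
  qed
  also have "\<dots> \<le> (3 * N / r) * (2 * w + 1)"
    using r N w0 by (intro mult_right_mono) (auto simp: field_simps)
  finally have cnt: "real (card H') \<le> (3 * N / r) * (2 * w + 1)" .
  \<comment> \<open>Were w \<ge> 1, then r * e \<ge> 1 / 2 and 2 * w + 1 \<le> 6 * r * e, so r
    cancels in the count. This is the origin of the 18 in the assumption.\<close>
  have w_zero: "w = 0"
  proof (rule ccontr)
    assume "w \<noteq> 0"
    then have "1 \<le> w" using w0 by linarith
    then have re: "1 / 2 \<le> r * e" and "2 * real_of_int w + 1 \<le> 2 * (r * e) + 2" unfolding w_def by linarith+
    then have "2 * real_of_int w + 1 \<le> 6 * (r * e)" by linarith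
    then have "(3 * N / r) * (2 * w + 1) \<le> (3 * N / r) * (6 * (r * e))" by (intro mult_left_mono) auto
    also have "\<dots> = 18 * N * e" using r by simp
    finally have "real N / X\<^sup>2 \<le> 18 * N * e" using cnt cH' by linarith
    then have "1 \<le> 18 * X ^ 3 * \<epsilon>" using N X by (simp add: e_def field_simps power2_eq_square power3_eq_cube)
    then show False using eps by simp
  qed
  have rX: "real r \<le> 3 * X\<^sup>2"
  proof -
    have "real N / X\<^sup>2 \<le> 3 * N / r" using cnt cH' w_zero by simp
    then show ?thesis using N X r by (simp add: field_simps)
  qed
  \<comment> \<open>With w = 0 the relation h * a = r * Z h is exact on all of \<open>H'\<close>,
    and dividing by the largest h, which is at least N / X ^ 2, gives the best error.\<close>
  define h where "h = Max H'"
  have Hne: "H' \<noteq> {}" using cH'pos by auto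
  have hH: "h \<in> H'" using Hne H' by (simp add: h_def)
  have "H' \<subseteq> {1..h}" using H' by (auto simp: h_def)
  then have "card H' \<le> h" using card_mono[of "{1..h}" H'] by simp
  then have hN: "real N / X\<^sup>2 \<le> h" using cH' by linarith
  have "int h * a = int r * Z h" using bnd[OF hH] w_zero by simp
  then have Zh: "real_of_int (Z h) = real h * (of_int a / real r)" using r(1)
    by (simp add: field_simps) (metis of_int_mult of_int_of_nat_eq)
  have "real h * \<bar>\<beta> - of_int a / real r\<bar> \<le> e"
  proof -
    have "real h * \<bar>\<beta> - of_int a / real r\<bar> = \<bar>real h * (\<beta> - of_int a / real r)\<bar>" by (simp add: abs_mult)
    then show ?thesis using Z[OF hH] unfolding Zh right_diff_distrib by simp
  qed
  then have "real N / X\<^sup>2 * \<bar>\<beta> - of_int a / real r\<bar> \<le> e"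
    using hN by (meson abs_ge_zero mult_right_mono order_trans)
  then have "\<bar>\<beta> - of_int a / real r\<bar> \<le> X ^ 3 * \<epsilon> / N"
    using N X by (simp add: e_def field_simps power2_eq_square power3_eq_cube)
  then have "appr \<beta> (3 * X\<^sup>2) (X ^ 3 * \<epsilon> / N)" using r rX by (intro apprI[of r]) auto
  then have "appr \<alpha> (real q * (3 * X\<^sup>2)) (X ^ 3 * \<epsilon> / N)" unfolding \<beta>_def using q1 by (intro appr_divide) auto
  moreover have "real q * (3 * X\<^sup>2) \<le> 3 * X ^ 3" using q1 X by (simp add: power3_eq_cube power2_eq_square mult_right_mono)
  ultimately show ?thesis by (blast intro: appr_mono)
qed

subsection \<open>Polynomials that are nearly rational at many integers\<close>

definition polyval :: "nat \<Rightarrow> (nat \<Rightarrow> real) \<Rightarrow> int \<Rightarrow> real" where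
  "polyval d c t = (\<Sum>l\<le>d. c l * of_int t ^ l)"

text \<open>The coefficient of t ^ i in the forward difference P (t + h) - P t. The term l = i
  cancels, so the degree drops by one.\<close>

definition diff_coeff :: "nat \<Rightarrow> (nat \<Rightarrow> real) \<Rightarrow> nat \<Rightarrow> nat \<Rightarrow> real" where
  "diff_coeff d c h i = (\<Sum>l\<in>{i<..d}. real ((l choose i) * h ^ (l - i)) * c l)"

lemma polyval_diff:
  "polyval (Suc d) c (t + int h) - polyval (Suc d) c t = polyval d (diff_coeff (Suc d) c h) t"
proof -
  have "polyval (Suc d) c (t + int h) - polyval (Suc d) c t
      = (\<Sum>l\<le>Suc d. c l * ((of_int t + real h) ^ l - of_int t ^ l))"
    by (simp add: polyval_def sum_subtractf right_diff_distrib del: sum.atMost_Suc)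
  also have "\<dots> = (\<Sum>l\<le>Suc d. \<Sum>i<l. c l * (real (l choose i) * of_int t ^ i * real h ^ (l - i)))"
  proof (rule sum.cong[OF refl])
    fix l
    have "(of_int t + real h) ^ l = (\<Sum>i<l. real (l choose i) * of_int t ^ i * real h ^ (l - i)) + of_int t ^ l"
      unfolding binomial_ring by (cases l) (simp_all add: lessThan_Suc_atMost)
    then show "c l * ((of_int t + real h) ^ l - of_int t ^ l)
        = (\<Sum>i<l. c l * (real (l choose i) * of_int t ^ i * real h ^ (l - i)))"
      by (simp add: sum_distrib_left)
  qed
  also have "\<dots> = (\<Sum>(l,i)\<in>(SIGMA l:{..Suc d}. {..<l}). c l * (real (l choose i) * of_int t ^ i * real h ^ (l - i)))"
    by (intro sum.Sigma) auto
  also have "\<dots> = (\<Sum>(i,l)\<in>(SIGMA i:{..d}. {i<..Suc d}). c l * (real (l choose i) * of_int t ^ i * real h ^ (l - i)))"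
    by (rule sum.reindex_bij_witness[of _ "\<lambda>(i,l). (l,i)" "\<lambda>(i,l). (l,i)"]) auto
  also have "\<dots> = (\<Sum>i\<le>d. \<Sum>l\<in>{i<..Suc d}. c l * (real (l choose i) * of_int t ^ i * real h ^ (l - i)))"
    by (intro sum.Sigma[symmetric]) auto
  also have "\<dots> = polyval d (diff_coeff (Suc d) c h) t"
    by (simp add: polyval_def diff_coeff_def sum_distrib_right sum_distrib_left algebra_simps)
  finally show ?thesis .
qed

lemma absorb_const:
  assumes "X \<ge> (2::real)" "a \<le> 2 ^ k" "0 \<le> b"
  shows "a * b \<le> X ^ k * b"
proof -
  have "a \<le> X ^ k" using assms two_power_le[of X k] by linarith
  then show ?thesis using assms by (intro mult_right_mono)
qed

text \<open>The coefficient of degree l - 1 of the difference with step h is h * l * c l plus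
  multiples of higher coefficients. Descending from the top degree, these are already known, so h *
  l * c l is nearly rational for many h and \<open>linear_approximation\<close> applies. The
  induction variable k counts the top coefficients obtained; \<open>i0\<close> is 0 when the
  constant terms of the differences are controlled and 1 when they are not, as for exponential
  sums.\<close>

lemma top_down_approximation:
  "\<exists>C. \<forall>X N \<epsilon> c H. X \<ge> 2 \<and> N \<ge> 1 \<and> \<epsilon> \<ge> 0 \<and> \<epsilon> * X ^ C \<le> real N ^ i0 \<and> H \<subseteq> {1..N} \<and> real N / X \<le> card H
      \<and> (\<forall>h\<in>H. \<forall>i. i0 \<le> i \<and> i < d \<longrightarrow> appr (diff_coeff d c h i) X (\<epsilon> / real N ^ i))
    \<longrightarrow> (\<forall>l. i0 < l \<and> l \<le> d \<and> d < l + k \<longrightarrow> appr (c l) (X ^ C) (X ^ C * \<epsilon> / real N ^ l))"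
proof (induction k)
  case 0
  then show ?case by auto
next
  case (Suc k)
  obtain C where IH: "\<And>X N \<epsilon> c H l. X \<ge> 2 \<Longrightarrow> N \<ge> 1 \<Longrightarrow> \<epsilon> \<ge> 0 \<Longrightarrow> \<epsilon> * X ^ C \<le> real N ^ i0 \<Longrightarrow> H \<subseteq> {1..N}
      \<Longrightarrow> real N / X \<le> card H \<Longrightarrow> (\<forall>h\<in>H. \<forall>i. i0 \<le> i \<and> i < d \<longrightarrow> appr (diff_coeff d c h i) X (\<epsilon> / real N ^ i))
      \<Longrightarrow> i0 < l \<Longrightarrow> l \<le> d \<Longrightarrow> d < l + k \<Longrightarrow> appr (c l) (X ^ C) (X ^ C * \<epsilon> / real N ^ l)"
    using Suc.IH by meson
  define A where "A = 2 * d + C + C * d + 2"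
  define C' where "C' = 4 * A + d + 5"
  have CC': "C \<le> C'" by (simp add: C'_def A_def)
  show ?case
  proof (intro exI[of _ C'] allI impI, elim conjE)
    fix X :: real and N :: nat and \<epsilon> :: real and c H l
    assume X: "X \<ge> 2" and N: "N \<ge> 1" and eps: "\<epsilon> \<ge> 0" "\<epsilon> * X ^ C' \<le> real N ^ i0"
      and H: "H \<subseteq> {1..N}" "real N / X \<le> card H"
      and ap: "\<forall>h\<in>H. \<forall>i. i0 \<le> i \<and> i < d \<longrightarrow> appr (diff_coeff d c h i) X (\<epsilon> / real N ^ i)"
      and l: "i0 < l" "l \<le> d" "d < l + Suc k"
    have X1: "1 \<le> X" using X by simp
    have pm: "X ^ a \<le> X ^ b" if "a \<le> b" for a b using X1 that by (rule power_increasing[rotated])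
    have epsC: "\<epsilon> * X ^ C \<le> real N ^ i0"
      using eps mult_left_mono[OF pm[OF CC'] eps(1)] by linarith
    note IH' = IH[OF X N eps(1) epsC H ap]
    show "appr (c l) (X ^ C') (X ^ C' * \<epsilon> / real N ^ l)"
    proof (cases "d < l + k")
      case True
      from IH'[OF l(1,2) True] show ?thesis
        by (rule appr_mono) (use pm[OF CC'] eps in \<open>auto intro!: divide_right_mono mult_right_mono\<close>)
    next
      case False
      define i where "i = l - 1"
      have i: "i0 \<le> i" "i < d" "l = Suc i" using l by (auto simp: i_def)
      have higher: "appr (c l') (X ^ C) (X ^ C * \<epsilon> / real N ^ l')" if "l' \<in> {l<..d}" for l'
        using that l False by (intro IH') auto
      \<comment> \<open>\<open>linear_approximation\<close> has one parameter, so Y bounds the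
        denominators, the loss in the error and the inverse density of H at once.\<close>
      define Y where "Y = X ^ A"
      have XY: "X \<le> Y" using pm[of 1 A] by (simp add: Y_def A_def)
      have Y: "2 \<le> Y" using X XY by linarith
      define E where "E = \<epsilon> / real N ^ i"
      have E0: "0 \<le> E" using eps by (simp add: E_def)
      have main: "appr (real h * (real l * c l)) Y (Y * E)" if h: "h \<in> H" for h
      proof -
        have hN: "1 \<le> h" "h \<le> N" using h H by auto
        \<comment> \<open>The lowest term of \<open>diff_coeff\<close> at i = l - 1 has the binomial
          coefficient l and the first power of h.\<close>
        have "{i<..d} = insert l {l<..d}" using i l by auto
        then have split: "real h * (real l * c l) = diff_coeff d c h i - (\<Sum>l'\<in>{l<..d}. real ((l' choose i) * h ^ (l' - i)) * c l')"
          using i by (simp add: diff_coeff_def)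
        have 1: "appr (diff_coeff d c h i) X E" using ap h i by (simp add: E_def)
        have 2: "appr (real ((l' choose i) * h ^ (l' - i)) * c l') (X ^ C) (X ^ (d + C) * E)" if l': "l' \<in> {l<..d}" for l'
        proof -
          have "appr (real_of_int (int ((l' choose i) * h ^ (l' - i))) * c l') (X ^ C)
              (\<bar>real_of_int (int ((l' choose i) * h ^ (l' - i)))\<bar> * (X ^ C * \<epsilon> / real N ^ l'))"
            by (rule appr_mult_int[OF higher[OF l']])
          then have ap': "appr (real ((l' choose i) * h ^ (l' - i)) * c l') (X ^ C)
              (real ((l' choose i) * h ^ (l' - i)) * (X ^ C * \<epsilon> / real N ^ l'))"
            by simp
          have "l' choose i \<le> 2 ^ l'" by (rule binomial_le_pow2)
          then have "real (l' choose i) \<le> 2 ^ l'" by (metis of_nat_le_iff of_nat_numeral of_nat_power)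
          also have "\<dots> \<le> X ^ l'" using X by (rule two_power_le)
          also have "\<dots> \<le> X ^ d" using l' by (intro pm) auto
          finally have b: "real (l' choose i) \<le> X ^ d" .
          have "real h ^ (l' - i) \<le> real N ^ (l' - i)" using hN by (intro power_mono) auto
          then have "real ((l' choose i) * h ^ (l' - i)) * (X ^ C * \<epsilon> / real N ^ l')
              \<le> (X ^ d * real N ^ (l' - i)) * (X ^ C * \<epsilon> / real N ^ l')"
            using b X eps by (auto intro!: divide_right_mono mult_right_mono mult_mono)
          also have "\<dots> = X ^ (d + C) * E"
          proof -
            have "real N ^ l' = real N ^ (l' - i) * real N ^ i" using l' i by (simp add: power_add[symmetric])
            then show ?thesis using N by (simp add: E_def power_add)
          qed
          finally show ?thesis using ap' by (blast intro: appr_mono)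
        qed
        have card: "card {l<..d} \<le> d" by simp
        have "appr (\<Sum>l'\<in>{l<..d}. real ((l' choose i) * h ^ (l' - i)) * c l') ((X ^ C) ^ card {l<..d}) (\<Sum>l'\<in>{l<..d}. X ^ (d + C) * E)"
          using X1 by (intro appr_sum 2) auto
        then have 3: "appr (\<Sum>l'\<in>{l<..d}. real ((l' choose i) * h ^ (l' - i)) * c l') (X ^ (C * d)) (X ^ (2 * d + C) * E)"
        proof (rule appr_mono)
          show "(X ^ C) ^ card {l<..d} \<le> X ^ (C * d)" using card by (auto simp: power_mult[symmetric] intro!: pm)
          have "(\<Sum>l'\<in>{l<..d}. X ^ (d + C) * E) = real (card {l<..d}) * (X ^ (d + C) * E)" by simp
          also have "\<dots> \<le> X ^ d * (X ^ (d + C) * E)"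
          proof (rule mult_right_mono)
            show "real (card {l<..d}) \<le> X ^ d" using card const_le_power[OF X, of d] by linarith
          qed (use E0 X in auto)
          also have "\<dots> = X ^ (2 * d + C) * E" by (simp add: power_add[symmetric] mult.assoc[symmetric] mult_2 add.assoc)
          finally show "(\<Sum>l'\<in>{l<..d}. X ^ (d + C) * E) \<le> X ^ (2 * d + C) * E" .
        qed
        have "appr (real h * (real l * c l)) (X * X ^ (C * d)) (E + X ^ (2 * d + C) * E)"
          unfolding split by (rule appr_diff[OF 1 3])
        then show ?thesis
        proof (rule appr_mono)
          show "X * X ^ (C * d) \<le> Y" unfolding Y_def power_Suc[symmetric] by (intro pm) (simp add: A_def)
          have "1 \<le> X ^ (2 * d + C)" using X1 by (rule one_le_power)
          then have "E + X ^ (2 * d + C) * E \<le> 2 * X ^ (2 * d + C) * E"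
            using E0 mult_right_mono[of 1 "X ^ (2 * d + C)" E] by (simp add: mult.commute)
          also have "\<dots> \<le> X * X ^ (2 * d + C) * E" using X E0 by (intro mult_right_mono) auto
          also have "\<dots> \<le> Y * E" unfolding Y_def power_Suc[symmetric] using E0 by (intro mult_right_mono pm) (simp_all add: A_def)
          finally show "E + X ^ (2 * d + C) * E \<le> Y * E" .
        qed
      qed
      have "appr (real l * c l) (3 * Y ^ 3) (Y ^ 3 * (Y * E) / N)"
      proof (rule linear_approximation[OF Y N _ _ H(1) _ main])
        show "0 \<le> Y * E" using Y E0 by simp
        show "real N / Y \<le> card H" using H(2) XY X N by (smt (verit) divide_left_mono mult_pos_pos of_nat_0_le_iff)
        have "\<epsilon> * X ^ C' \<le> real N ^ i"
          using eps(2) i(1) N by (smt (verit) of_nat_1 of_nat_le_iff power_increasing)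
        then have "X ^ C' * E \<le> 1" using N by (simp add: E_def field_simps)
        moreover have "32 * (Y ^ 4 * E) \<le> X ^ C' * E"
        proof -
          have "32 * (Y ^ 4 * E) \<le> X ^ 5 * (Y ^ 4 * E)" using X E0 Y by (intro absorb_const) auto
          also have "\<dots> = X ^ (4 * A + 5) * E" by (simp add: Y_def power_mult[symmetric] power_add mult.commute[of 4])
          also have "\<dots> \<le> X ^ C' * E" using E0 by (intro mult_right_mono pm) (simp_all add: C'_def)
          finally show ?thesis .
        qed
        moreover have "0 \<le> Y ^ 4 * E" using E0 Y by simp
        ultimately have "18 * (Y ^ 4 * E) < 1" by linarith
        then show "18 * Y ^ 3 * (Y * E) < 1" by (simp add: eval_nat_numeral mult.assoc)
      qed
      then have "appr (c l) (real l * (3 * Y ^ 3)) (Y ^ 3 * (Y * E) / N)" using l by (intro appr_divide) auto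
      then show ?thesis
      proof (rule appr_mono)
        have "real l * (3 * Y ^ 3) \<le> X ^ d * (X ^ 2 * Y ^ 3)"
        proof (rule mult_mono)
          show "real l \<le> X ^ d" using const_le_power[OF X, of d] l by linarith
          show "3 * Y ^ 3 \<le> X ^ 2 * Y ^ 3" using X Y by (intro absorb_const) auto
        qed (use X Y in auto)
        also have "\<dots> = X ^ (d + 2 + 3 * A)" by (simp add: Y_def power_mult[symmetric] power_add mult.commute[of 3] power2_eq_square)
        also have "\<dots> \<le> X ^ C'" by (intro pm) (simp add: C'_def)
        finally show "real l * (3 * Y ^ 3) \<le> X ^ C'" .
        have "Y ^ 3 * (Y * E) / N = X ^ (4 * A) * \<epsilon> / real N ^ l"
          using N by (simp add: E_def i(3) Y_def power_mult[symmetric] mult.commute[of _ A] eval_nat_numeral power_add mult_ac)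
        also have "\<dots> \<le> X ^ C' * \<epsilon> / real N ^ l" using eps by (intro divide_right_mono mult_right_mono pm) (simp_all add: C'_def)
        finally show "Y ^ 3 * (Y * E) / N \<le> X ^ C' * \<epsilon> / real N ^ l" .
      qed
    qed
  qed
qed

text \<open>The strictly increasing pairs in G number at least card G ^ 2 / 4 and are distributed
  over at most 2 * N differences h. The assumption on N gives G at least two elements, so that the
  diagonal does not dominate. The exponent 8 absorbs the constant in 48 * X ^ 2.\<close>

lemma popular_differences:
  assumes X: "X \<ge> (2::real)" and N: "2 * X \<le> real N" and G: "G \<subseteq> {- int N..int N}" "real N / X \<le> card G"
  obtains H where "H \<subseteq> {1..2 * N}" "real (2 * N) / X ^ 8 \<le> card H"
    "\<forall>h\<in>H. real N / X ^ 8 \<le> card {t\<in>G. t + int h \<in> G}"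
proof -
  have finG: "finite G" using G(1) finite_subset by blast
  define m where "m = card G"
  define P where "P h = {t\<in>G. t + int h \<in> G}" for h
  have m2: "2 \<le> m"
  proof -
    have "2 \<le> real N / X" using N X by (simp add: field_simps)
    then show ?thesis using G(2) unfolding m_def by linarith
  qed
  define L where "L = {(t,t')\<in>G \<times> G. t < t'}"
  define L' where "L' = {(t,t')\<in>G \<times> G. t' < t}"
  have "bij_betw prod.swap L L'" by (rule bij_betwI[where g=prod.swap]) (auto simp: L_def L'_def)
  then have LL': "card L = card L'" by (rule bij_betw_same_card)
  have finL: "finite L" "finite L'" using finG by (auto simp: L_def L'_def intro: finite_subset[of _ "G \<times> G"])
  have "G \<times> G = (L \<union> L') \<union> (\<lambda>t. (t,t)) ` G" by (auto simp: L_def L'_def)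
  moreover have "card ((L \<union> L') \<union> (\<lambda>t. (t,t)) ` G) = card (L \<union> L') + card ((\<lambda>t. (t,t)) ` G)"
    using finL finG by (intro card_Un_disjoint) (auto simp: L_def L'_def)
  moreover have "card (L \<union> L') = card L + card L'"
    using finL by (intro card_Un_disjoint) (auto simp: L_def L'_def)
  moreover have "card ((\<lambda>t. (t,t)) ` G) = m" unfolding m_def by (rule card_image) (auto simp: inj_on_def)
  ultimately have mm: "m * m = 2 * card L + m"
    using LL' card_cartesian_product[of G G] unfolding m_def[symmetric] by (metis mult_2)
  have "bij_betw (\<lambda>(h,t). (t, t + int h)) (SIGMA h:{1..2*N}. P h) L"
  proof (rule bij_betwI[where g="\<lambda>(t,t'). (nat (t' - t), t)"], goal_cases)
    case 2
    have "nat (t' - t) \<le> 2 * N" if "t \<in> G" "t' \<in> G" for t t'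
    proof -
      have "- int N \<le> t" "t' \<le> int N" using G(1) that by auto
      then show ?thesis by linarith
    qed
    then show ?case by (auto simp: L_def P_def)
  qed (auto simp: L_def P_def)
  then have "card L = card (SIGMA h:{1..2*N}. P h)" by (metis bij_betw_same_card)
  also have "\<dots> = (\<Sum>h\<in>{1..2*N}. card (P h))" using finG by (intro card_SigmaI) (auto simp: P_def)
  finally have L: "real (card L) = (\<Sum>h\<in>{1..2*N}. real (card (P h)))" by simp
  define \<tau> where "\<tau> = real N / (16 * X\<^sup>2)"
  define H where "H = {h\<in>{1..2*N}. \<tau> \<le> real (card (P h))}"
  have mN: "m \<le> 3 * N"
  proof -
    have "m \<le> card {- int N..int N}" unfolding m_def using G(1) by (intro card_mono) auto
    also have "\<dots> \<le> 3 * N" using N X by simp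
    finally show ?thesis .
  qed
  have "(\<Sum>h\<in>{1..2*N}. real (card (P h))) - \<tau> * card {1..2*N} \<le> real (3 * N) * card H"
    unfolding H_def
  proof (rule popular)
    fix h
    have "card (P h) \<le> m" unfolding m_def using finG by (intro card_mono) (auto simp: P_def)
    then show "real (card (P h)) \<le> real (3 * N)" using mN by linarith
  qed (auto simp: \<tau>_def)
  then have pop: "real (card L) - \<tau> * (2 * N) \<le> 3 * N * card H" using L by simp
  have mX: "real N / X \<le> m" using G(2) by (simp add: m_def)
  have "real m * m \<le> 4 * real (card L)"
  proof -
    have "2 * m \<le> m * m" using m2 by simp
    then have "m * m \<le> 4 * card L" using mm by linarith
    then show ?thesis by (metis of_nat_le_iff of_nat_mult of_nat_numeral)
  qed
  moreover have "(real N / X) * (real N / X) \<le> real m * m" using mX X by (intro mult_mono) auto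
  ultimately have "real N * N / (4 * X\<^sup>2) \<le> real (card L)" by (simp add: power2_eq_square)
  then have "real N * N / (4 * X\<^sup>2) - real N * N / (8 * X\<^sup>2) \<le> 3 * N * card H"
    using pop by (simp add: \<tau>_def)
  then have "real N * (real N / (24 * X\<^sup>2)) \<le> real N * card H"
    using X by (simp add: field_simps)
  then have cH: "real N / (24 * X\<^sup>2) \<le> card H"
    by (rule mult_left_le_imp_le) (use N X in linarith)
  have X8: "48 * X\<^sup>2 \<le> X ^ 8" using absorb_const[OF X, of 48 6 "X\<^sup>2"] X by (simp add: power_add[symmetric])
  have "real (2 * N) / X ^ 8 \<le> real (2 * N) / (48 * X\<^sup>2)" using X8 X by (intro divide_left_mono) auto
  then have 1: "real (2 * N) / X ^ 8 \<le> card H" using cH by simp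
  have "real N / X ^ 8 \<le> \<tau>" unfolding \<tau>_def using X8 X zero_le_power2[of X] by (intro divide_left_mono) (linarith | simp)+
  then have 2: "real N / X ^ 8 \<le> card {t\<in>G. t + int h \<in> G}" if "h \<in> H" for h
    using that by (auto simp: H_def P_def)
  show thesis using 1 2 by (intro that[of H]) (auto simp: H_def)
qed

text \<open>The difference of two nearly rational values is nearly rational, so for each popular h
  the difference polynomial is nearly rational at many points. Induction on the degree gives its
  coefficients, and \<open>top_down_approximation\<close> returns to those of the polynomial itself.
  Only the constant term is invisible to differences.\<close>

lemma rational_polynomial_approximation:
  "\<exists>C. \<forall>X N \<epsilon> G c. X \<ge> 2 \<and> N \<ge> 1 \<and> \<epsilon> \<ge> 0 \<and> G \<subseteq> {- int N..int N} \<and> real N / X \<le> card G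
      \<and> X ^ C \<le> real N \<and> \<epsilon> * X ^ C \<le> 1 \<and> (\<forall>t\<in>G. appr (polyval d c t) X \<epsilon>)
    \<longrightarrow> (\<forall>i\<le>d. appr (c i) (X ^ C) (X ^ C * \<epsilon> / real N ^ i))"
proof (induction d)
  case 0
  show ?case
  proof (intro exI[of _ 1] allI impI, elim conjE)
    fix X :: real and N :: nat and \<epsilon> :: real and G c i
    assume X: "X \<ge> 2" and N: "N \<ge> 1" and eps: "\<epsilon> \<ge> 0" and G: "real N / X \<le> real (card G)"
      and ap: "\<forall>t\<in>G. appr (polyval 0 c t) X \<epsilon>" and i: "i \<le> (0::nat)"
    have "0 < real N / X" using X N by simp
    then obtain t where "t \<in> G" using G by fastforce
    then have "appr (c 0) X \<epsilon>" using ap by (auto simp: polyval_def)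
    then have "appr (c 0) (X ^ 1) (X ^ 1 * \<epsilon> / real N ^ 0)"
      by (rule appr_mono) (use X eps mult_right_mono[of 1 X \<epsilon>] in auto)
    then show "appr (c i) (X ^ 1) (X ^ 1 * \<epsilon> / real N ^ i)" using i by simp
  qed
next
  case (Suc d)
  obtain C where IH: "\<And>X N \<epsilon> G c i. X \<ge> 2 \<Longrightarrow> N \<ge> 1 \<Longrightarrow> \<epsilon> \<ge> 0 \<Longrightarrow> G \<subseteq> {- int N..int N} \<Longrightarrow> real N / X \<le> card G
      \<Longrightarrow> X ^ C \<le> real N \<Longrightarrow> \<epsilon> * X ^ C \<le> 1 \<Longrightarrow> \<forall>t\<in>G. appr (polyval d c t) X \<epsilon> \<Longrightarrow> i \<le> d
      \<Longrightarrow> appr (c i) (X ^ C) (X ^ C * \<epsilon> / real N ^ i)"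
    using Suc.IH by meson
  obtain D where down: "\<And>X N \<epsilon> c H l. X \<ge> 2 \<Longrightarrow> N \<ge> 1 \<Longrightarrow> \<epsilon> \<ge> 0 \<Longrightarrow> \<epsilon> * X ^ D \<le> real N ^ 0 \<Longrightarrow> H \<subseteq> {1..N}
      \<Longrightarrow> real N / X \<le> card H \<Longrightarrow> (\<forall>h\<in>H. \<forall>i. 0 \<le> i \<and> i < Suc d \<longrightarrow> appr (diff_coeff (Suc d) c h i) X (\<epsilon> / real N ^ i))
      \<Longrightarrow> 0 < l \<Longrightarrow> l \<le> Suc d \<Longrightarrow> Suc d < l + Suc d \<Longrightarrow> appr (c l) (X ^ D) (X ^ D * \<epsilon> / real N ^ l)"
    using top_down_approximation[of 0 "Suc d" "Suc d"] by meson
  define A where "A = 8 * C + d + 9"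
  define B where "B = A * D + A"
  define C' where "C' = B * (d + 2) + d + 2 + B"
  show ?case
  proof (intro exI[of _ C'] allI impI, elim conjE)
    fix X :: real and N :: nat and \<epsilon> :: real and G c i
    assume X: "X \<ge> 2" and N: "N \<ge> 1" and eps: "\<epsilon> \<ge> 0" and G: "G \<subseteq> {- int N..int N}" "real N / X \<le> real (card G)"
      and NC: "X ^ C' \<le> real N" and epsC: "\<epsilon> * X ^ C' \<le> 1"
      and ap: "\<forall>t\<in>G. appr (polyval (Suc d) c t) X \<epsilon>" and i: "i \<le> Suc d"
    have X1: "1 \<le> X" using X by simp
    have pm: "X ^ a \<le> X ^ b" if "a \<le> b" for a b using X1 that by (rule power_increasing[rotated])
    have small: "\<epsilon> * X ^ a \<le> 1" if "a \<le> C'" for a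
      using epsC mult_left_mono[OF pm[OF that] eps] by linarith
    have large: "X ^ a \<le> real N" if "a \<le> C'" for a using NC pm[OF that] by linarith
    have "2 * X \<le> X ^ 2" using X by (simp add: power2_eq_square)
    also have "\<dots> \<le> real N" by (rule large) (simp add: C'_def)
    finally have N2X: "2 * X \<le> real N" .
    obtain H where H: "H \<subseteq> {1..2 * N}" "real (2 * N) / X ^ 8 \<le> card H"
      "\<forall>h\<in>H. real N / X ^ 8 \<le> card {t\<in>G. t + int h \<in> G}"
      by (rule popular_differences[OF X N2X G])
    have diff: "appr (diff_coeff (Suc d) c h i) (X ^ A) (X ^ A * \<epsilon> / real (2 * N) ^ i)" if h: "h \<in> H" and i: "i \<le> d" for h i
    proof -
      \<comment> \<open>The error is 2 * \<epsilon> because two values are subtracted; X ^ 8 is the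
        density of the popular differences.\<close>
      have "appr (diff_coeff (Suc d) c h i) ((X ^ 8) ^ C) ((X ^ 8) ^ C * (2 * \<epsilon>) / real N ^ i)"
      proof (rule IH[OF _ N _ _ bspec[OF H(3) h] _ _ _ i])
        show "2 \<le> X ^ 8" using pm[of 1 8] X by simp
        show "{t\<in>G. t + int h \<in> G} \<subseteq> {- int N..int N}" using G by auto
        show "(X ^ 8) ^ C \<le> real N" unfolding power_mult[symmetric]
          by (rule large) (simp add: C'_def B_def A_def)
        have "2 * \<epsilon> * (X ^ 8) ^ C = 2 * (\<epsilon> * X ^ (8 * C))" by (simp add: power_mult)
        also have "\<dots> \<le> X * (\<epsilon> * X ^ (8 * C))" using X eps by (intro mult_right_mono) auto
        also have "\<dots> = \<epsilon> * X ^ (8 * C + 1)" by simp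
        also have "\<dots> \<le> 1" by (rule small) (simp add: C'_def B_def A_def)
        finally show "2 * \<epsilon> * (X ^ 8) ^ C \<le> 1" .
        show "\<forall>t\<in>{t\<in>G. t + int h \<in> G}. appr (polyval d (diff_coeff (Suc d) c h) t) (X ^ 8) (2 * \<epsilon>)"
        proof
          fix t assume "t \<in> {t\<in>G. t + int h \<in> G}"
          then have "appr (polyval (Suc d) c (t + int h)) X \<epsilon>" "appr (polyval (Suc d) c t) X \<epsilon>" using ap by auto
          then have "appr (polyval d (diff_coeff (Suc d) c h) t) (X * X) (\<epsilon> + \<epsilon>)"
            unfolding polyval_diff[symmetric] by (rule appr_diff)
          then show "appr (polyval d (diff_coeff (Suc d) c h) t) (X ^ 8) (2 * \<epsilon>)"
            using pm[of 2 8] by (elim appr_mono) (auto simp: power2_eq_square)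
        qed
      qed (use eps in auto)
      then show ?thesis
      proof (rule appr_mono)
        show "(X ^ 8) ^ C \<le> X ^ A" unfolding power_mult[symmetric] by (intro pm) (simp add: A_def)
        have "(X ^ 8) ^ C * (2 * \<epsilon>) / real N ^ i = 2 ^ (i + 1) * (X ^ (8 * C) * \<epsilon>) / real (2 * N) ^ i"
          unfolding power_mult[symmetric] using N by (simp add: power_mult_distrib field_simps)
        also have "\<dots> \<le> X ^ (d + 1) * (X ^ (8 * C) * \<epsilon>) / real (2 * N) ^ i"
        proof (intro divide_right_mono mult_right_mono)
          have "2 ^ (i + 1) \<le> X ^ (i + 1)" using X by (rule two_power_le)
          also have "\<dots> \<le> X ^ (d + 1)" using i by (intro pm) simp
          finally show "2 ^ (i + 1) \<le> X ^ (d + 1)" .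
        qed (use X eps in auto)
        also have "\<dots> = X ^ (8 * C + d + 1) * \<epsilon> / real (2 * N) ^ i" by (simp add: power_add algebra_simps)
        also have "\<dots> \<le> X ^ A * \<epsilon> / real (2 * N) ^ i"
          using eps by (intro divide_right_mono mult_right_mono pm) (simp_all add: A_def)
        finally show "(X ^ 8) ^ C * (2 * \<epsilon>) / real N ^ i \<le> X ^ A * \<epsilon> / real (2 * N) ^ i" .
      qed
    qed
    have upper: "appr (c l) (X ^ B) (X ^ B * \<epsilon> / real N ^ l)" if l: "0 < l" "l \<le> Suc d" for l
    proof -
      have "appr (c l) ((X ^ A) ^ D) ((X ^ A) ^ D * (X ^ A * \<epsilon>) / real (2 * N) ^ l)"
      proof (rule down[OF _ _ _ _ H(1) _ _ l])
        show "2 \<le> X ^ A" using pm[of 1 A] X by (simp add: A_def)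
        show "1 \<le> 2 * N" using N by simp
        show "0 \<le> X ^ A * \<epsilon>" using X eps by simp
        have "X ^ A * \<epsilon> * (X ^ A) ^ D = \<epsilon> * X ^ B" by (simp add: B_def power_add power_mult algebra_simps)
        also have "\<dots> \<le> 1" by (rule small) (simp add: C'_def)
        finally show "X ^ A * \<epsilon> * (X ^ A) ^ D \<le> real (2 * N) ^ 0" by simp
        have "real (2 * N) / X ^ A \<le> real (2 * N) / X ^ 8"
          using X by (intro divide_left_mono pm) (simp_all add: A_def)
        then show "real (2 * N) / X ^ A \<le> card H" using H(2) by linarith
        show "\<forall>h\<in>H. \<forall>i. 0 \<le> i \<and> i < Suc d \<longrightarrow> appr (diff_coeff (Suc d) c h i) (X ^ A) (X ^ A * \<epsilon> / real (2 * N) ^ i)"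
          using diff by simp
        show "Suc d < l + Suc d" using l by simp
      qed
      then show ?thesis
      proof (rule appr_mono)
        show "(X ^ A) ^ D \<le> X ^ B" unfolding power_mult[symmetric] by (intro pm) (simp add: B_def)
        have "(X ^ A) ^ D * (X ^ A * \<epsilon>) / real (2 * N) ^ l = X ^ B * \<epsilon> / real (2 * N) ^ l"
          by (simp add: B_def power_add power_mult algebra_simps)
        also have "\<dots> \<le> X ^ B * \<epsilon> / real N ^ l"
          using X eps N by (intro divide_left_mono power_mono) auto
        finally show "(X ^ A) ^ D * (X ^ A * \<epsilon>) / real (2 * N) ^ l \<le> X ^ B * \<epsilon> / real N ^ l" .
      qed
    qed
    have BC: "B \<le> C'" by (simp add: C'_def)
    show "appr (c i) (X ^ C') (X ^ C' * \<epsilon> / real N ^ i)"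
    proof (cases "i = 0")
      case False
      then have "appr (c i) (X ^ B) (X ^ B * \<epsilon> / real N ^ i)" using i by (intro upper) auto
      then show ?thesis
        by (rule appr_mono) (use pm[OF BC] eps in \<open>auto intro!: divide_right_mono mult_right_mono\<close>)
    next
      \<comment> \<open>The constant term is what remains of a single nearly rational value once the
        other terms are subtracted.\<close>
      case True
      have "0 < real N / X" using X N by simp
      then obtain t where t: "t \<in> G" using G by fastforce
      have tN: "\<bar>t\<bar> \<le> int N" using t G(1) by (fastforce simp: abs_le_iff)
      have 1: "appr (of_int (t ^ l) * c l) (X ^ B) (X ^ B * \<epsilon>)" if l: "l \<in> {1..Suc d}" for l
      proof (rule appr_mono)
        show "appr (of_int (t ^ l) * c l) (X ^ B) (\<bar>of_int (t ^ l)\<bar> * (X ^ B * \<epsilon> / real N ^ l))"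
          using l by (intro appr_mult_int upper) auto
        have "\<bar>real_of_int t\<bar> \<le> real N" using tN by linarith
        then have "\<bar>real_of_int (t ^ l)\<bar> \<le> real N ^ l" by (simp add: power_abs power_mono)
        then have "\<bar>real_of_int (t ^ l)\<bar> * (X ^ B * \<epsilon> / real N ^ l) \<le> real N ^ l * (X ^ B * \<epsilon> / real N ^ l)"
          using X eps by (intro mult_right_mono) auto
        then show "\<bar>real_of_int (t ^ l)\<bar> * (X ^ B * \<epsilon> / real N ^ l) \<le> X ^ B * \<epsilon>" using N by simp
      qed simp
      have "{..Suc d} = insert 0 {1..Suc d}" by auto
      then have "c 0 = polyval (Suc d) c t - (\<Sum>l\<in>{1..Suc d}. of_int (t ^ l) * c l)"
        by (simp add: polyval_def mult.commute del: sum.atMost_Suc sum.cl_ivl_Suc)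
      moreover have "appr (\<Sum>l\<in>{1..Suc d}. of_int (t ^ l) * c l) ((X ^ B) ^ card {1..Suc d}) (\<Sum>l\<in>{1..Suc d}. X ^ B * \<epsilon>)"
        using X1 by (intro appr_sum 1) auto
      ultimately have "appr (c 0) (X * (X ^ B) ^ Suc d) (\<epsilon> + real (Suc d) * (X ^ B * \<epsilon>))"
        using appr_diff[of "polyval (Suc d) c t" X \<epsilon>] ap t by simp
      then have "appr (c 0) (X ^ C') (X ^ C' * \<epsilon>)"
      proof (rule appr_mono)
        have "X * (X ^ B) ^ Suc d = X ^ (1 + B * Suc d)" by (simp only: power_add power_mult power_one_right)
        also have "\<dots> \<le> X ^ C'" by (intro pm) (simp add: C'_def)
        finally show "X * (X ^ B) ^ Suc d \<le> X ^ C'" .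
        have "\<epsilon> + real (Suc d) * (X ^ B * \<epsilon>) \<le> X ^ B * \<epsilon> + real (Suc d) * (X ^ B * \<epsilon>)"
          using X1 eps mult_right_mono[of 1 "X ^ B" \<epsilon>] by simp
        also have "\<dots> = real (d + 2) * (X ^ B * \<epsilon>)" by (simp add: algebra_simps)
        also have "\<dots> \<le> X ^ (d + 2) * (X ^ B * \<epsilon>)"
          using X eps by (intro mult_right_mono const_le_power) auto
        also have "\<dots> = X ^ (d + 2 + B) * \<epsilon>" by (simp add: power_add)
        also have "\<dots> \<le> X ^ C' * \<epsilon>" using eps by (intro mult_right_mono pm) (simp_all add: C'_def)
        finally show "\<epsilon> + real (Suc d) * (X ^ B * \<epsilon>) \<le> X ^ C' * \<epsilon>" .
      qed
      then show ?thesis using True by simp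
    qed
  qed
qed

subsection \<open>A quantitative converse of Weyl's theorem in one variable\<close>

definition echar :: "real \<Rightarrow> complex" where
  "echar x = cis (2 * pi * x)"

lemma norm_echar [simp]: "norm (echar x) = 1"
  by (simp add: echar_def)

lemma echar_add: "echar (x + y) = echar x * echar y"
  by (simp add: echar_def cis_mult distrib_left)

lemma echar_diff: "echar (x - y) = echar x * cnj (echar y)"
  by (simp add: echar_def cis_mult cis_cnj right_diff_distrib)

lemma echar_int [simp]: "echar (of_int n) = 1"
  by (simp add: echar_def cis_multiple_2pi)

lemma echar_0 [simp]: "echar 0 = 1"
  by (simp add: echar_def)

lemma norm_echar_minus_1: "norm (echar x - 1) = 2 * \<bar>sin (pi * x)\<bar>"
  using dist_exp_i_1[of "2 * pi * x"] by (simp add: echar_def cis_conv_exp dist_norm)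

lemma norm_echar_diff_le: "norm (echar x - echar y) \<le> 2 * pi * \<bar>x - y\<bar>"
proof -
  have "echar x - echar y = echar y * (echar (x - y) - 1)"
    using echar_add[of y "x - y"] by (simp add: algebra_simps)
  then have "norm (echar x - echar y) = 2 * \<bar>sin (pi * (x - y))\<bar>"
    by (simp add: norm_mult norm_echar_minus_1)
  also have "\<dots> \<le> 2 * \<bar>pi * (x - y)\<bar>" using abs_sin_x_le_abs_x[of "pi * (x - y)"] by simp
  finally show ?thesis by (simp add: abs_mult)
qed

text \<open>The constant is 1 instead of the sharp 4, so a crude bound suffices: for |s| \<le> 1.6
  the cubic Taylor estimate gives |sin s| \<ge> |s| / 2.\<close>

lemma norm_echar_minus_1_ge:
  obtains z :: int where "\<bar>x - of_int z\<bar> \<le> norm (echar x - 1)"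
proof -
  define y where "y = x - of_int (round x)"
  have y: "\<bar>y\<bar> \<le> 1 / 2" unfolding y_def using of_int_round_abs_le[of x] by (simp add: abs_minus_commute)
  have ex: "echar x = echar y" using echar_add[of y "of_int (round x)"] by (simp add: y_def)
  define s where "s = pi * y"
  have s: "\<bar>s\<bar> \<le> 1.6"
  proof -
    have "\<bar>s\<bar> \<le> pi * (1 / 2)" using y by (simp add: s_def abs_mult)
    then show ?thesis using pi_approx by simp
  qed
  have "\<bar>sin s - s\<bar> \<le> inverse (fact 3) * \<bar>s\<bar> ^ 3"
    using Maclaurin_sin_bound[of s 3] by (simp add: eval_nat_numeral sin_coeff_def)
  also have "\<dots> = \<bar>s\<bar> * \<bar>s\<bar> * \<bar>s\<bar> / 6" by (simp add: eval_nat_numeral)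
  also have "\<dots> \<le> 1.6 * 1.6 * \<bar>s\<bar> / 6" using s by (intro divide_right_mono mult_right_mono mult_mono) auto
  finally have "\<bar>s\<bar> / 2 \<le> \<bar>sin s\<bar>" by linarith
  moreover have "\<bar>y\<bar> \<le> \<bar>s\<bar>"
  proof -
    have "1 * \<bar>y\<bar> \<le> pi * \<bar>y\<bar>" using pi_gt3 by (intro mult_right_mono) auto
    then show ?thesis by (simp add: s_def abs_mult)
  qed
  ultimately have "\<bar>y\<bar> \<le> norm (echar x - 1)" unfolding ex norm_echar_minus_1 s_def[symmetric] by simp
  then show thesis using that[of "round x"] by (simp add: y_def)
qed

section \<open>Van der Corput differencing and partial summation\<close>

lemma norm_sum_squared:
  fixes z :: "nat \<Rightarrow> complex"
  shows "(norm (\<Sum>i<n. z i))\<^sup>2 = (\<Sum>i<n. (norm (z i))\<^sup>2) + 2 * Re (\<Sum>h\<in>{1..<n}. \<Sum>i<n - h. z (i + h) * cnj (z i))"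
proof (induction n)
  case 0
  then show ?case by simp
next
  case (Suc n)
  have sq: "(norm (A + w))\<^sup>2 = (norm A)\<^sup>2 + (norm w)\<^sup>2 + 2 * Re (w * cnj A)" for A w :: complex
    unfolding cmod_power2 by (simp add: power2_eq_square algebra_simps)
  have "(\<Sum>h\<in>{1..<Suc n}. \<Sum>i<Suc n - h. z (i + h) * cnj (z i))
      = (\<Sum>h\<in>{1..<Suc n}. (\<Sum>i<n - h. z (i + h) * cnj (z i)) + z n * cnj (z (n - h)))"
  proof (rule sum.cong[OF refl])
    fix h assume "h \<in> {1..<Suc n}"
    then have "Suc n - h = Suc (n - h)" "n - h + h = n" by auto
    then show "(\<Sum>i<Suc n - h. z (i + h) * cnj (z i)) = (\<Sum>i<n - h. z (i + h) * cnj (z i)) + z n * cnj (z (n - h))"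
      by simp
  qed
  also have "\<dots> = (\<Sum>h\<in>{1..<Suc n}. \<Sum>i<n - h. z (i + h) * cnj (z i)) + (\<Sum>h\<in>{1..<Suc n}. z n * cnj (z (n - h)))"
    by (rule sum.distrib)
  also have "(\<Sum>h\<in>{1..<Suc n}. \<Sum>i<n - h. z (i + h) * cnj (z i)) = (\<Sum>h\<in>{1..<n}. \<Sum>i<n - h. z (i + h) * cnj (z i))"
    by (rule sum.mono_neutral_right) auto
  also have "(\<Sum>h\<in>{1..<Suc n}. z n * cnj (z (n - h))) = z n * cnj (\<Sum>i<n. z i)"
    unfolding cnj_sum sum_distrib_left
    by (rule sum.reindex_bij_witness[of _ "\<lambda>i. n - i" "\<lambda>h. n - h"]) auto
  finally have step: "(\<Sum>h\<in>{1..<Suc n}. \<Sum>i<Suc n - h. z (i + h) * cnj (z i))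
      = (\<Sum>h\<in>{1..<n}. \<Sum>i<n - h. z (i + h) * cnj (z i)) + z n * cnj (\<Sum>i<n. z i)" .
  show ?case unfolding step unfolding sum.lessThan_Suc sq Suc.IH plus_complex.sel by (simp only: distrib_left add_ac)
qed

text \<open>For a polynomial phase the inner sums are exponential sums whose phases have degree one
  less.\<close>

lemma van_der_corput:
  fixes z :: "nat \<Rightarrow> complex"
  assumes "\<And>i. norm (z i) = 1"
  shows "(norm (\<Sum>i<n. z i))\<^sup>2 \<le> n + 2 * (\<Sum>h\<in>{1..<n}. norm (\<Sum>i<n - h. z (i + h) * cnj (z i)))"
proof -
  have "Re (\<Sum>h\<in>{1..<n}. \<Sum>i<n - h. z (i + h) * cnj (z i)) \<le> norm (\<Sum>h\<in>{1..<n}. \<Sum>i<n - h. z (i + h) * cnj (z i))"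
    by (rule complex_Re_le_cmod)
  also have "\<dots> \<le> (\<Sum>h\<in>{1..<n}. norm (\<Sum>i<n - h. z (i + h) * cnj (z i)))" by (rule norm_sum)
  finally show ?thesis unfolding norm_sum_squared using assms by simp
qed

text \<open>The boundary weight is w n, one step beyond the range of summation, so that n = 0 is not
  a separate case.\<close>

lemma summation_by_parts:
  fixes w f :: "nat \<Rightarrow> complex"
  shows "(\<Sum>i<n. w i * f i) = w n * (\<Sum>i<n. f i) - (\<Sum>i<n. (w (Suc i) - w i) * (\<Sum>j<Suc i. f j))"
  by (induction n) (simp_all add: algebra_simps)

lemma norm_sum_by_parts:
  fixes w f :: "nat \<Rightarrow> complex"
  assumes "norm (w n) \<le> W" "(\<Sum>i<n. norm (w (Suc i) - w i)) \<le> V" "\<And>m. m \<le> n \<Longrightarrow> norm (\<Sum>i<m. f i) \<le> F"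
  shows "norm (\<Sum>i<n. w i * f i) \<le> (W + V) * F"
proof -
  have F0: "0 \<le> F" using assms(3)[of 0] by simp
  have "norm (\<Sum>i<n. w i * f i) \<le> norm (w n * (\<Sum>i<n. f i)) + norm (\<Sum>i<n. (w (Suc i) - w i) * (\<Sum>j<Suc i. f j))"
    by (subst summation_by_parts) (rule norm_triangle_ineq4)
  also have "\<dots> \<le> W * F + (\<Sum>i<n. norm (w (Suc i) - w i) * F)"
  proof (rule add_mono)
    show "norm (w n * (\<Sum>i<n. f i)) \<le> W * F" unfolding norm_mult
      using assms(3)[of n] by (intro mult_mono assms(1) order_trans[OF norm_ge_zero assms(1)]) auto
    show "norm (\<Sum>i<n. (w (Suc i) - w i) * (\<Sum>j<Suc i. f j)) \<le> (\<Sum>i<n. norm (w (Suc i) - w i) * F)"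
      by (intro sum_norm_le) (auto simp: norm_mult simp del: sum.lessThan_Suc intro!: mult_left_mono assms(3))
  qed
  also have "\<dots> \<le> W * F + V * F"
    unfolding sum_distrib_right[symmetric] using assms(2) F0 by (intro add_mono mult_right_mono) auto
  finally show ?thesis by (simp add: algebra_simps)
qed

lemma sum_lessThan_add:
  fixes f :: "nat \<Rightarrow> 'a::comm_monoid_add"
  shows "(\<Sum>i<n + q. f i) = (\<Sum>i<n. f i) + (\<Sum>i<q. f (n + i))"
  by (induction q) (simp_all add: add.assoc)

text \<open>Shifting the range by q multiplies the sum by \<open>echar \<theta>\<close> and changes
  only 2 * q terms. For q = 1 this is the bound for a geometric sum.\<close>

lemma twisted_periodic_sum:
  fixes f :: "nat \<Rightarrow> complex"
  assumes "\<And>i. norm (f i) \<le> 1" "\<And>i. f (i + q) = f i * echar \<theta>"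
  shows "norm (\<Sum>i<n. f i) * norm (echar \<theta> - 1) \<le> 2 * real q"
proof -
  have "(\<Sum>i<n. f i) * echar \<theta> = (\<Sum>i<n. f (q + i))"
    by (simp add: sum_distrib_right assms(2)[symmetric] add.commute)
  moreover have "(\<Sum>i<q. f i) + (\<Sum>i<n. f (q + i)) = (\<Sum>i<n. f i) + (\<Sum>i<q. f (n + i))"
    using sum_lessThan_add[of f n q] sum_lessThan_add[of f q n] by (simp add: add.commute)
  ultimately have "(\<Sum>i<n. f i) * (echar \<theta> - 1) = (\<Sum>i<q. f (n + i)) - (\<Sum>i<q. f i)"
    by (simp add: algebra_simps)
  then have "norm (\<Sum>i<n. f i) * norm (echar \<theta> - 1) = norm ((\<Sum>i<q. f (n + i)) - (\<Sum>i<q. f i))"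
    by (simp only: norm_mult[symmetric])
  also have "\<dots> \<le> norm (\<Sum>i<q. f (n + i)) + norm (\<Sum>i<q. f i)" by (rule norm_triangle_ineq4)
  also have "\<dots> \<le> real q + real q"
    using sum_norm_le[of "{..<q}" "\<lambda>i. f (n + i)" "\<lambda>_. 1"] sum_norm_le[of "{..<q}" f "\<lambda>_. 1"] assms(1)
    by (intro add_mono) auto
  finally show ?thesis by simp
qed

lemma abs_power_diff_le:
  fixes x y :: real
  assumes "\<bar>x\<bar> \<le> R" "\<bar>y\<bar> \<le> R"
  shows "\<bar>x ^ l - y ^ l\<bar> \<le> real l * R ^ (l - 1) * \<bar>x - y\<bar>"
proof (cases l)
  case (Suc m)
  have R: "0 \<le> R" using assms(1) by linarith
  have "x ^ l - y ^ l = (x - y) * (\<Sum>p<Suc m. x ^ p * y ^ (m - p))"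
    unfolding Suc power_diff_sumr2 by (simp add: mult.commute del: sum.lessThan_Suc)
  then have eq: "\<bar>x ^ l - y ^ l\<bar> = \<bar>x - y\<bar> * \<bar>\<Sum>p<Suc m. x ^ p * y ^ (m - p)\<bar>" by (simp only: abs_mult)
  have "\<bar>\<Sum>p<Suc m. x ^ p * y ^ (m - p)\<bar> \<le> (\<Sum>p<Suc m. R ^ m)"
  proof (rule order_trans[OF sum_abs sum_mono])
    fix p assume "p \<in> {..<Suc m}"
    then have "R ^ m = R ^ p * R ^ (m - p)" by (simp add: power_add[symmetric])
    then show "\<bar>x ^ p * y ^ (m - p)\<bar> \<le> R ^ m"
      using assms R by (simp add: abs_mult power_abs mult_mono power_mono)
  qed
  also have "\<dots> = real l * R ^ (l - 1)" using Suc by simp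
  finally have "\<bar>x - y\<bar> * \<bar>\<Sum>p<Suc m. x ^ p * y ^ (m - p)\<bar> \<le> \<bar>x - y\<bar> * (real l * R ^ (l - 1))"
    by (rule mult_left_mono) simp
  then show ?thesis unfolding eq by (simp only: mult.commute)
qed simp

lemma common_denominator:
  assumes "finite L" "\<And>l. l \<in> L \<Longrightarrow> appr (c l) Y (\<epsilon> l)"
  shows "\<exists>q a. 1 \<le> q \<and> real q \<le> Y ^ card L \<and> (\<forall>l\<in>L. \<bar>c l - of_int (a l) / real q\<bar> \<le> \<epsilon> l)"
proof -
  obtain q a where qa: "\<And>l. l \<in> L \<Longrightarrow> 1 \<le> q l \<and> real (q l) \<le> Y \<and> \<bar>c l - of_int (a l) / real (q l)\<bar> \<le> \<epsilon> l"
    using assms(2) unfolding appr_def by metis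
  define Q where "Q = prod q L"
  define b where "b l = a l * int (Q div q l)" for l
  have "1 \<le> Q" unfolding Q_def using qa by (intro prod_ge_1) auto
  moreover have "real Q \<le> Y ^ card L"
  proof -
    have "real Q = (\<Prod>l\<in>L. real (q l))" by (simp add: Q_def)
    also have "\<dots> \<le> (\<Prod>l\<in>L. Y)" using qa by (intro prod_mono) auto
    finally show ?thesis by simp
  qed
  moreover have "\<bar>c l - of_int (b l) / real Q\<bar> \<le> \<epsilon> l" if l: "l \<in> L" for l
  proof -
    have "q l dvd Q" unfolding Q_def using assms(1) l by (rule dvd_prodI)
    then obtain r where r: "Q = q l * r" ..
    have "of_int (b l) / real Q = of_int (a l) / real (q l)"
      using \<open>1 \<le> Q\<close> qa[OF l] by (simp add: b_def r)
    then show ?thesis using qa[OF l] by simp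
  qed
  ultimately show ?thesis by blast
qed

text \<open>Coefficients of size X / N ^ l make the phase vary by O(X / N) per unit step as long as
  |t| = O(N). A factor with such a phase can be removed by partial summation at the cost of a power
  of X.\<close>

lemma power_sum_variation:
  assumes "N \<ge> (1::nat)" "X \<ge> 1" "\<And>l. l \<in> L \<Longrightarrow> \<bar>\<beta> l\<bar> \<le> X / real N ^ l" "L \<subseteq> {1..d}" "\<bar>s\<bar> \<le> 4 * int N" "\<bar>t\<bar> \<le> 4 * int N"
  shows "\<bar>(\<Sum>l\<in>L. \<beta> l * of_int s ^ l) - (\<Sum>l\<in>L. \<beta> l * of_int t ^ l)\<bar> \<le> real d * (real d * 4 ^ d) * X / N * \<bar>real_of_int (s - t)\<bar>"
proof -
  have "\<bar>(\<Sum>l\<in>L. \<beta> l * of_int s ^ l) - (\<Sum>l\<in>L. \<beta> l * of_int t ^ l)\<bar> = \<bar>\<Sum>l\<in>L. \<beta> l * (of_int s ^ l - of_int t ^ l)\<bar>"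
    by (simp add: sum_subtractf right_diff_distrib)
  also have "\<dots> \<le> (\<Sum>l\<in>L. (real d * 4 ^ d) * X / N * \<bar>real_of_int (s - t)\<bar>)"
  proof (rule order_trans[OF sum_abs sum_mono])
    fix l assume l: "l \<in> L"
    then have l1: "1 \<le> l" "l \<le> d" using assms(4) by auto
    have s: "\<bar>real_of_int s\<bar> \<le> real (4 * N)" "\<bar>real_of_int t\<bar> \<le> real (4 * N)" using assms(5,6) by linarith+
    have "\<bar>of_int s ^ l - of_int t ^ l\<bar> \<le> real l * real (4 * N) ^ (l - 1) * \<bar>real_of_int s - of_int t\<bar>"
      by (rule abs_power_diff_le[OF s])
    also have "\<dots> = real l * 4 ^ (l - 1) * real N ^ (l - 1) * \<bar>real_of_int (s - t)\<bar>" by (simp add: power_mult_distrib)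
    also have "\<dots> \<le> real d * 4 ^ d * real N ^ (l - 1) * \<bar>real_of_int (s - t)\<bar>"
      using l1 by (intro mult_right_mono mult_mono power_increasing) auto
    finally have "\<bar>\<beta> l\<bar> * \<bar>of_int s ^ l - of_int t ^ l\<bar> \<le> X / real N ^ l * (real d * 4 ^ d * real N ^ (l - 1) * \<bar>real_of_int (s - t)\<bar>)"
      using assms(2) by (intro mult_mono assms(3)[OF l]) auto
    also have "\<dots> = real d * 4 ^ d * X / N * \<bar>real_of_int (s - t)\<bar>"
    proof -
      have "real N ^ l = real N ^ (l - 1) * real N" using l1 by (metis One_nat_def Suc_pred less_eq_Suc_le power_Suc2)
      then show ?thesis using assms(1) by simp
    qed
    finally show "\<bar>\<beta> l * (of_int s ^ l - of_int t ^ l)\<bar> \<le> real d * 4 ^ d * X / N * \<bar>real_of_int (s - t)\<bar>"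
      by (simp add: abs_mult)
  qed
  also have "\<dots> = real (card L) * ((real d * 4 ^ d) * X / N * \<bar>real_of_int (s - t)\<bar>)" by simp
  also have "\<dots> \<le> real d * ((real d * 4 ^ d) * X / N * \<bar>real_of_int (s - t)\<bar>)"
    using card_mono[OF _ assms(4)] assms(2) by (intro mult_right_mono) auto
  finally show ?thesis by simp
qed

text \<open>
  Van der Corput differencing lowers the degree: the induction hypothesis applies to the differences by
  many \<open>h\<close> and gives the coefficients of degree at least 2. The remaining phase is linear up to
  a periodic factor and a factor of small variation, so it is a geometric sum.
\<close>

lemma weyl_converse:
  "\<exists>C. \<forall>X N c a n. X \<ge> 2 \<and> N \<ge> 1 \<and> \<bar>a\<bar> \<le> 2 * int N \<and> n \<le> N
      \<and> real N / X \<le> norm (\<Sum>i<n. echar (polyval d c (a + int i)))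
    \<longrightarrow> (\<forall>l. 1 \<le> l \<and> l \<le> d \<longrightarrow> appr (c l) (X ^ C) (X ^ C / real N ^ l))"
proof (induction d)
  case 0
  then show ?case by auto
next
  case (Suc d)
  obtain C where IH: "\<And>X N c a n l. X \<ge> 2 \<Longrightarrow> N \<ge> 1 \<Longrightarrow> \<bar>a\<bar> \<le> 2 * int N \<Longrightarrow> n \<le> N
      \<Longrightarrow> real N / X \<le> norm (\<Sum>i<n. echar (polyval d c (a + int i)))
      \<Longrightarrow> 1 \<le> l \<Longrightarrow> l \<le> d \<Longrightarrow> appr (c l) (X ^ C) (X ^ C / real N ^ l)"
    using Suc.IH by meson
  obtain D where down: "\<And>X N \<epsilon> c H l. X \<ge> 2 \<Longrightarrow> N \<ge> 1 \<Longrightarrow> \<epsilon> \<ge> 0 \<Longrightarrow> \<epsilon> * X ^ D \<le> real N ^ 1 \<Longrightarrow> H \<subseteq> {1..N}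
      \<Longrightarrow> real N / X \<le> card H \<Longrightarrow> (\<forall>h\<in>H. \<forall>i. 1 \<le> i \<and> i < Suc d \<longrightarrow> appr (diff_coeff (Suc d) c h i) X (\<epsilon> / real N ^ i))
      \<Longrightarrow> 1 < l \<Longrightarrow> l \<le> Suc d \<Longrightarrow> Suc d < l + Suc d \<Longrightarrow> appr (c l) (X ^ D) (X ^ D * \<epsilon> / real N ^ l)"
    using top_down_approximation[of 1 "Suc d" "Suc d"] by meson
  define A where "A = 5 * C + 5"
  define B where "B = A * D + A"
  define V where "V = 2 * Suc d + 2 * Suc d + B + 4"
  define E where "E = B + 2"
  define C' where "C' = E * Suc d + B * Suc d * 2 + V + 5"
  show ?case
  proof (intro exI[of _ C'] allI impI, elim conjE)
    fix X :: real and N :: nat and c a n l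
    assume X: "X \<ge> 2" and N: "N \<ge> 1" and a: "\<bar>a\<bar> \<le> 2 * int N" and n: "n \<le> N"
      and big: "real N / X \<le> norm (\<Sum>i<n. echar (polyval (Suc d) c (a + int i)))"
      and l: "1 \<le> l" "l \<le> Suc d"
    have X1: "1 \<le> X" using X by simp
    have pm: "X ^ a \<le> X ^ b" if "a \<le> b" for a b using X1 that by (rule power_increasing[rotated])
    show "appr (c l) (X ^ C') (X ^ C' / real N ^ l)"
    proof (cases "X ^ E \<le> real N")
      \<comment> \<open>For N below a power of X the claimed error is at least 1, and every real is
        within 1 of an integer.\<close>
      case False
      have "real N ^ l \<le> (X ^ E) ^ l" using False by (intro power_mono) auto
      also have "\<dots> \<le> X ^ C'" unfolding power_mult[symmetric] using mult_le_mono2[OF l(2), of E]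
        by (intro pm) (simp add: C'_def)
      finally show ?thesis using N X1 by (intro appr_one one_le_power) auto
    next
      case large: True
      have largeE: "X ^ b \<le> real N" if "b \<le> E" for b using large pm[OF that] by linarith
      define z where "z i = echar (polyval (Suc d) c (a + int i))" for i
      define T where "T h = norm (\<Sum>i<n - h. z (i + h) * cnj (z i))" for h
      have T_eq: "T h = norm (\<Sum>i<n - h. echar (polyval d (diff_coeff (Suc d) c h) (a + int i)))" for h
      proof -
        have "z (i + h) * cnj (z i) = echar (polyval d (diff_coeff (Suc d) c h) (a + int i))" for i
          unfolding z_def echar_diff[symmetric] polyval_diff[symmetric] by (simp add: add.assoc)
        then show ?thesis by (simp add: T_def)
      qed
      \<comment> \<open>The correlations sum to at least N ^ 2 / (4 * X ^ 2), and those below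
        \<open>\<tau>\<close> contribute at most half of this.\<close>
      define \<tau> where "\<tau> = real N / (8 * X\<^sup>2)"
      define H where "H = {h\<in>{1..<n}. \<tau> \<le> T h}"
      have HN: "H \<subseteq> {1..N}" using n by (auto simp: H_def)
      have cardH: "real N / (8 * X\<^sup>2) \<le> card H"
      proof -
        have "(real N / X)\<^sup>2 \<le> (norm (\<Sum>i<n. z i))\<^sup>2"
          using big X by (intro power_mono) (auto simp: z_def)
        also have "\<dots> \<le> n + 2 * (\<Sum>h\<in>{1..<n}. T h)"
          unfolding T_def by (rule van_der_corput) (simp add: z_def)
        finally have 1: "(real N / X)\<^sup>2 \<le> N + 2 * (\<Sum>h\<in>{1..<n}. T h)" using n by linarith
        have "2 * X\<^sup>2 \<le> X ^ 3" using X by (simp add: power2_eq_square power3_eq_cube)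
        also have "\<dots> \<le> X ^ E" by (intro pm) (simp add: E_def B_def A_def)
        finally have "2 * X\<^sup>2 \<le> real N" using large by linarith
        then have "real N * (2 * X\<^sup>2) \<le> real N * real N" by (intro mult_left_mono) auto
        then have 2: "real N \<le> (real N / X)\<^sup>2 / 2" using X by (simp add: power_divide field_simps power2_eq_square)
        have pop: "(\<Sum>h\<in>{1..<n}. T h) - \<tau> * card {1..<n} \<le> real N * card H"
          unfolding H_def
        proof (rule popular)
          fix h
          have "T h \<le> (\<Sum>i<n - h. 1)" unfolding T_eq by (intro sum_norm_le) simp
          then show "T h \<le> real N" using n by simp
        qed (auto simp: \<tau>_def)
        have "\<tau> * card {1..<n} \<le> \<tau> * N" using n by (intro mult_left_mono) (auto simp: \<tau>_def)
        then have "(real N / X)\<^sup>2 / 4 - \<tau> * N \<le> real N * card H" using 1 2 pop by linarith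
        then have "real N * (real N / (8 * X\<^sup>2)) \<le> real N * card H"
          by (simp add: \<tau>_def power_divide power2_eq_square)
        then show ?thesis by (rule mult_left_le_imp_le) (use N in simp)
      qed
      have X8: "8 * X\<^sup>2 \<le> X ^ 5" using absorb_const[OF X, of 8 3 "X\<^sup>2"] X by (simp add: power_add[symmetric])
      have "2 * X ^ 2 > 0" using X by simp
      have diff: "appr (diff_coeff (Suc d) c h i) (X ^ A) (X ^ A / real N ^ i)" if h: "h \<in> H" and i: "1 \<le> i" "i \<le> d" for h i
      proof -
        have "appr (diff_coeff (Suc d) c h i) ((X ^ 5) ^ C) ((X ^ 5) ^ C / real N ^ i)"
        proof (rule IH[OF _ N a _ _ i])
          show "2 \<le> X ^ 5" using pm[of 1 5] X by simp
          show "n - h \<le> N" using n by simp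
          have "real N / X ^ 5 \<le> \<tau>" unfolding \<tau>_def using X8 X by (intro divide_left_mono) auto
          then show "real N / X ^ 5 \<le> norm (\<Sum>i<n - h. echar (polyval d (diff_coeff (Suc d) c h) (a + int i)))"
            using h unfolding T_eq[symmetric] by (auto simp: H_def)
        qed
        then show ?thesis unfolding power_mult[symmetric]
          by (rule appr_mono) (auto simp: A_def intro!: pm divide_right_mono)
      qed
      have upper: "appr (c l) (X ^ B) (X ^ B / real N ^ l)" if l: "1 < l" "l \<le> Suc d" for l
      proof -
        have "appr (c l) ((X ^ A) ^ D) ((X ^ A) ^ D * X ^ A / real N ^ l)"
        proof (rule down[OF _ N _ _ HN _ _ l])
          show "2 \<le> X ^ A" using pm[of 1 A] X by (simp add: A_def)
          show "0 \<le> X ^ A" using X by simp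
          have "X ^ A * (X ^ A) ^ D = X ^ B" by (simp add: B_def power_add power_mult)
          also have "\<dots> \<le> N" by (rule largeE) (simp add: E_def)
          finally show "X ^ A * (X ^ A) ^ D \<le> real N ^ 1" by simp
          have "8 * X\<^sup>2 \<le> X ^ A" using X8 pm[of 5 A] by (simp add: A_def)
          then have "real N / X ^ A \<le> real N / (8 * X\<^sup>2)" using X by (intro divide_left_mono) auto
          then show "real N / X ^ A \<le> card H" using cardH by linarith
          show "\<forall>h\<in>H. \<forall>i. 1 \<le> i \<and> i < Suc d \<longrightarrow> appr (diff_coeff (Suc d) c h i) (X ^ A) (X ^ A / real N ^ i)"
            using diff by simp
          show "Suc d < l + Suc d" using l by simp
        qed
        moreover have "(X ^ A) ^ D * X ^ A = X ^ B" by (simp add: B_def power_add power_mult)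
        moreover have "(X ^ A) ^ D \<le> X ^ B" unfolding power_mult[symmetric] by (intro pm) (simp add: B_def)
        ultimately show ?thesis by (auto elim: appr_mono)
      qed
      have BC: "B \<le> C'" by (simp add: C'_def)
      show ?thesis
      proof (cases "l = 1")
        case False
        then have "appr (c l) (X ^ B) (X ^ B / real N ^ l)" using l by (intro upper) auto
        then show ?thesis by (rule appr_mono) (use pm[OF BC] in \<open>auto intro!: divide_right_mono\<close>)
      next
        \<comment> \<open>Degree 1 is out of reach for differencing: h * c 1 occurs only in the
          constant term of the difference polynomial, which does not affect the size of a
          correlation.\<close>
        case True
        define L where "L = {2..Suc d}"
        have "\<exists>q b. 1 \<le> q \<and> real q \<le> (X ^ B) ^ card L \<and> (\<forall>l\<in>L. \<bar>c l - of_int (b l) / real q\<bar> \<le> X ^ B / real N ^ l)"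
          by (rule common_denominator) (auto simp: L_def intro!: upper)
        then obtain q b where q: "1 \<le> q" "real q \<le> (X ^ B) ^ card L"
          and b: "\<And>l. l \<in> L \<Longrightarrow> \<bar>c l - of_int (b l) / real q\<bar> \<le> X ^ B / real N ^ l" by blast
        have qX: "real q \<le> X ^ (B * Suc d)"
        proof -
          have "(X ^ B) ^ card L \<le> X ^ (B * Suc d)" unfolding power_mult[symmetric]
            by (intro pm mult_le_mono2) (simp add: L_def)
          then show ?thesis using q by linarith
        qed
        define \<beta> where "\<beta> l = c l - of_int (b l) / real q" for l
        \<comment> \<open>The coefficients of degree at least 2 are split into fractions over q,
          which go into f, and errors, which go into w.\<close>
        define w where "w i = echar (\<Sum>l\<in>L. \<beta> l * of_int (a + int i) ^ l)" for i
        define f where "f i = echar (c 0 + c 1 * of_int (a + int i) + of_int (\<Sum>l\<in>L. b l * (a + int i) ^ l) / real q)" for i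
        have zwf: "z i = w i * f i" for i
        proof -
          have "{..Suc d} = {0,1} \<union> L" by (auto simp: L_def)
          then have "polyval (Suc d) c t = c 0 + c 1 * of_int t + (\<Sum>l\<in>L. c l * of_int t ^ l)" for t
            unfolding polyval_def by (simp add: L_def del: sum.atMost_Suc sum.cl_ivl_Suc)
          moreover have "(\<Sum>l\<in>L. c l * of_int t ^ l) = (\<Sum>l\<in>L. \<beta> l * of_int t ^ l) + of_int (\<Sum>l\<in>L. b l * t ^ l) / real q" for t
            by (simp add: \<beta>_def left_diff_distrib sum_subtractf sum_divide_distrib)
          ultimately show ?thesis unfolding z_def w_def f_def echar_add[symmetric] by (simp add: algebra_simps)
        qed
        have f_shift: "f (i + q) = f i * echar (c 1 * real q)" for i
        proof -
          have "int q dvd (\<Sum>l\<in>L. b l * (a + int (i + q)) ^ l) - (\<Sum>l\<in>L. b l * (a + int i) ^ l)"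
            unfolding sum_subtractf[symmetric] right_diff_distrib[symmetric]
          proof (intro dvd_sum dvd_mult)
            fix l
            have "(a + int (i + q)) - (a + int i) dvd (a + int (i + q)) ^ l - (a + int i) ^ l"
              unfolding power_diff_sumr2[of "a + int (i + q)"] by (rule dvd_triv_left)
            then show "int q dvd (a + int (i + q)) ^ l - (a + int i) ^ l" by simp
          qed
          then obtain k where "(\<Sum>l\<in>L. b l * (a + int (i + q)) ^ l) = (\<Sum>l\<in>L. b l * (a + int i) ^ l) + int q * k"
            by (metis add.commute diff_add_cancel dvdE)
          then have k: "of_int (\<Sum>l\<in>L. b l * (a + int (i + q)) ^ l) / real q = of_int (\<Sum>l\<in>L. b l * (a + int i) ^ l) / real q + of_int k"
            using q(1) by (simp only: of_int_add of_int_mult of_int_of_nat_eq add_divide_distrib) simp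
          show ?thesis unfolding f_def k echar_add by (simp add: algebra_simps echar_add)
        qed
        have var: "(\<Sum>i<n. norm (w (Suc i) - w i)) \<le> X ^ V"
        proof -
          have "norm (w (Suc i) - w i) \<le> X ^ V / N" if i: "i < n" for i
          proof -
            have "\<bar>(\<Sum>l\<in>L. \<beta> l * of_int (a + int (Suc i)) ^ l) - (\<Sum>l\<in>L. \<beta> l * of_int (a + int i) ^ l)\<bar>
                \<le> real (Suc d) * (real (Suc d) * 4 ^ Suc d) * X ^ B / N * \<bar>real_of_int (a + int (Suc i) - (a + int i))\<bar>"
              using N X1 a n i by (intro power_sum_variation) (auto simp: \<beta>_def L_def intro!: b[unfolded L_def])
            then have "norm (w (Suc i) - w i) \<le> 2 * pi * (real (Suc d) * (real (Suc d) * 4 ^ Suc d) * X ^ B / N)"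
              unfolding w_def using norm_echar_diff_le
              by (intro order_trans[OF norm_echar_diff_le] mult_left_mono) auto
            also have "\<dots> = (2 * pi) * (real (Suc d) * (real (Suc d) * (4 ^ Suc d * X ^ B))) / N" by simp
            also have "\<dots> \<le> X ^ 4 * (X ^ Suc d * (X ^ Suc d * (X ^ (2 * Suc d) * X ^ B))) / N"
            proof (intro divide_right_mono mult_mono const_le_power X)
              have "2 * pi \<le> 2 ^ 4" using pi_less_4 by simp
              then show "2 * pi \<le> X ^ 4" using two_power_le[OF X, of 4] by linarith
              show "4 ^ Suc d \<le> X ^ (2 * Suc d)" using two_power_le[OF X, of "2 * Suc d"] by (simp only: power_mult) simp
            qed (use X in auto)
            also have "\<dots> = X ^ V / N" by (simp add: V_def power_add[symmetric] mult_2 algebra_simps del: power_Suc)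
            finally show ?thesis .
          qed
          then have "(\<Sum>i<n. norm (w (Suc i) - w i)) \<le> (\<Sum>i<n. X ^ V / N)" by (intro sum_mono) auto
          also have "\<dots> = n * (X ^ V / N)" by simp
          also have "\<dots> \<le> N * (X ^ V / N)" using n X by (intro mult_right_mono) auto
          finally show ?thesis using N by simp
        qed
        have "\<exists>m\<le>n. N / X ^ (V + 3) \<le> norm (\<Sum>i<m. f i)"
        proof (rule ccontr)
          assume "\<not> ?thesis"
          then have small: "\<And>m. m \<le> n \<Longrightarrow> norm (\<Sum>i<m. f i) \<le> N / X ^ (V + 3)" by force
          have "norm (\<Sum>i<n. w i * f i) \<le> (1 + X ^ V) * (N / X ^ (V + 3))"
            by (rule norm_sum_by_parts[OF _ var small]) (simp add: w_def)
          also have "\<dots> \<le> X ^ (V + 1) * (N / X ^ (V + 3))"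
          proof (rule mult_right_mono)
            have "1 \<le> X ^ V" using X1 by simp
            then have "1 + X ^ V \<le> 2 * X ^ V" by simp
            also have "\<dots> \<le> X * X ^ V" using X by (intro mult_right_mono) auto
            finally show "1 + X ^ V \<le> X ^ (V + 1)" by simp
          qed (use X in simp)
          also have "\<dots> = N / X\<^sup>2" using X by (simp add: power_add field_simps power2_eq_square power3_eq_cube)
          also have "\<dots> < N / X" using X N by (intro divide_strict_left_mono) (auto simp: power2_eq_square)
          finally show False using big by (simp add: zwf[symmetric] z_def)
        qed
        then obtain m where m: "N / X ^ (V + 3) \<le> norm (\<Sum>i<m. f i)" by blast
        \<comment> \<open>Over q steps the phase of f grows by c 1 * q up to an integer, so a large
          partial sum of f forces c 1 * q to be close to an integer.\<close>
        obtain u :: int where u: "\<bar>c 1 * real q - of_int u\<bar> \<le> norm (echar (c 1 * real q) - 1)"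
          by (rule norm_echar_minus_1_ge)
        have "N / X ^ (V + 3) * norm (echar (c 1 * real q) - 1) \<le> norm (\<Sum>i<m. f i) * norm (echar (c 1 * real q) - 1)"
          using m by (intro mult_right_mono) auto
        also have "\<dots> \<le> 2 * real q" using f_shift by (intro twisted_periodic_sum) (simp_all add: f_def)
        finally have "N / X ^ (V + 3) * \<bar>c 1 * real q - of_int u\<bar> \<le> 2 * real q"
          using u X by (smt (verit) divide_nonneg_nonneg mult_left_mono of_nat_0_le_iff zero_le_power)
        then have "\<bar>c 1 * real q - of_int u\<bar> \<le> 2 * real q * X ^ (V + 3) / N" using N X by (simp add: field_simps)
        then have "real q * \<bar>c 1 - of_int u / real q\<bar> \<le> real q * (2 * X ^ (V + 3) / N)"
        proof -
          have "real q * \<bar>c 1 - of_int u / real q\<bar> = \<bar>real q * (c 1 - of_int u / real q)\<bar>" by (simp add: abs_mult)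
          also have "real q * (c 1 - of_int u / real q) = c 1 * real q - of_int u" using q(1) by (simp add: field_simps)
          finally show "\<bar>c 1 * real q - of_int u\<bar> \<le> 2 * real q * X ^ (V + 3) / N \<Longrightarrow> ?thesis" by (simp add: mult.commute mult.left_commute)
        qed
        then have "\<bar>c 1 - of_int u / real q\<bar> \<le> 2 * X ^ (V + 3) / N"
          by (rule mult_left_le_imp_le) (use q in simp)
        also have "\<dots> \<le> X ^ (V + 4) / N"
        proof (rule divide_right_mono)
          have "2 * X ^ (V + 3) \<le> X * X ^ (V + 3)" using X by (intro mult_right_mono) auto
          then show "2 * X ^ (V + 3) \<le> X ^ (V + 4)" by (simp add: power_add eval_nat_numeral mult_ac)
        qed simp
        finally have "appr (c 1) (X ^ (B * Suc d)) (X ^ (V + 4) / N)" using q(1) qX by (intro apprI[of q]) auto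
        then have "appr (c 1) (X ^ C') (X ^ C' / N)"
          by (rule appr_mono) (auto intro!: pm divide_right_mono simp: C'_def)
        then show ?thesis using True by simp
      qed
    qed
  qed
qed

subsection \<open>Dyadic pieces of the discrete Hilbert transform\<close>

definition dyadic :: "nat \<Rightarrow> nat \<Rightarrow> int set" where
  "dyadic M j = {t. 2 ^ j \<le> \<bar>t\<bar> \<and> \<bar>t\<bar> < 2 ^ (j + 1) \<and> \<bar>t\<bar> \<le> int M}"

text \<open>Truncated subtraction makes the length 0 when the cut-off M lies below 2 ^ j.\<close>

definition dyadic_length :: "nat \<Rightarrow> nat \<Rightarrow> nat" where
  "dyadic_length M j = min (2 ^ (j + 1)) (M + 1) - 2 ^ j"

lemma dyadic_length_le: "dyadic_length M j \<le> 2 ^ j"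
  by (simp add: dyadic_length_def)

lemma sum_dyadic:
  fixes f :: "int \<Rightarrow> 'a::comm_monoid_add"
  shows "sum f (dyadic M j) = (\<Sum>i<dyadic_length M j. f (2 ^ j + int i)) + (\<Sum>i<dyadic_length M j. f (- (2 ^ j + int i)))"
proof -
  let ?n = "dyadic_length M j"
  have less: "int i < int ?n \<longleftrightarrow> 2 ^ j + int i < 2 ^ (j + 1) \<and> 2 ^ j + int i \<le> int M" for i
  proof -
    have "i < ?n \<longleftrightarrow> 2 ^ j + i < 2 ^ (j + 1) \<and> 2 ^ j + i \<le> M" by (auto simp: dyadic_length_def)
    also have "\<dots> \<longleftrightarrow> int (2 ^ j + i) < int (2 ^ (j + 1)) \<and> int (2 ^ j + i) \<le> int M" by (simp only: of_nat_less_iff of_nat_le_iff)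
    finally show ?thesis by simp
  qed
  define P where "P = (\<lambda>i. 2 ^ j + int i) ` {..<?n}"
  define Q where "Q = (\<lambda>i. - (2 ^ j + int i)) ` {..<?n}"
  have pos: "(0::int) < 2 ^ j" by simp
  have "dyadic M j = P \<union> Q"
  proof (intro equalityI subsetI)
    fix t assume t: "t \<in> dyadic M j"
    define i where "i = nat (\<bar>t\<bar> - 2 ^ j)"
    have i: "\<bar>t\<bar> = 2 ^ j + int i" using t by (simp add: i_def dyadic_def)
    have "i < ?n" using less[of i] t unfolding dyadic_def i[symmetric] by simp
    then show "t \<in> P \<union> Q" using i unfolding P_def Q_def
    proof (cases "t \<ge> 0")
      case False
      then have "t = - (2 ^ j + int i)" using i by simp
      then show "t \<in> (\<lambda>i. 2 ^ j + int i) ` {..<?n} \<union> (\<lambda>i. - (2 ^ j + int i)) ` {..<?n}" using \<open>i < ?n\<close> by blast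
    qed auto
  next
    fix t assume "t \<in> P \<union> Q"
    then obtain i where i: "i < ?n" "t = 2 ^ j + int i \<or> t = - (2 ^ j + int i)" by (auto simp: P_def Q_def)
    have "0 < 2 ^ j + int i" using pos by linarith
    then have "\<bar>t\<bar> = 2 ^ j + int i" using i(2) by (metis abs_minus_cancel abs_of_pos)
    then show "t \<in> dyadic M j" using less[of i] i(1) by (simp add: dyadic_def)
  qed
  moreover have "P \<inter> Q = {}"
  proof -
    have "0 < t" if "t \<in> P" for t using that pos by (auto simp: P_def intro: add_pos_nonneg)
    moreover have "t < 0" if tQ: "t \<in> Q" for t
    proof -
      obtain i where "t = - (2 ^ j + int i)" using tQ unfolding Q_def by blast
      then show ?thesis using pos by linarith
    qed
    ultimately show ?thesis by fastforce
  qed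
  ultimately have "sum f (dyadic M j) = sum f P + sum f Q"
    by (simp add: sum.union_disjoint P_def Q_def)
  moreover have "sum f P = (\<Sum>i<?n. f (2 ^ j + int i))" unfolding P_def by (simp add: sum.reindex inj_on_def)
  moreover have "sum f Q = (\<Sum>i<?n. f (- (2 ^ j + int i)))" unfolding Q_def by (simp add: sum.reindex inj_on_def)
  ultimately show ?thesis by simp
qed

lemma finite_dyadic [simp]: "finite (dyadic M j)"
  by (rule finite_subset[of _ "{- int M..int M}"]) (auto simp: dyadic_def)

lemma dyadic_subset: "dyadic M j \<subseteq> {- int (2 ^ (j + 1))..int (2 ^ (j + 1))}"
  by (auto simp: dyadic_def)

lemma card_dyadic: "card (dyadic M j) \<le> 2 * 2 ^ j"
proof -
  have "card (dyadic M j) = 2 * dyadic_length M j" unfolding card_eq_sum sum_dyadic by simp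
  then show ?thesis using dyadic_length_le[of M j] by simp
qed

lemma dyadic_ne_zero: "t \<in> dyadic M j \<Longrightarrow> t \<noteq> 0"
  by (auto simp: dyadic_def)

lemma norm_dyadic_inverse: "t \<in> dyadic M j \<Longrightarrow> 1 / real_of_int \<bar>t\<bar> \<le> 1 / 2 ^ j"
proof -
  assume "t \<in> dyadic M j"
  then have "(2::int) ^ j \<le> \<bar>t\<bar>" by (simp add: dyadic_def)
  then have "real_of_int (2 ^ j) \<le> real_of_int \<bar>t\<bar>" by (rule of_int_le_iff[THEN iffD2])
  then have "2 ^ j \<le> real_of_int \<bar>t\<bar>" "0 < real_of_int \<bar>t\<bar>"
    using less_le_trans[of 0 "2 ^ j" "real_of_int \<bar>t\<bar>"] by simp_all
  then show ?thesis by (intro divide_left_mono) auto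
qed

lemma divide_dyadic_term:
  fixes N i :: nat
  shows "z / complex_of_int (int N + int i) = of_real (1 / real (N + i)) * z"
    "z / complex_of_int (- (int N + int i)) = - (of_real (1 / real (N + i)) * z)"
proof -
  have e: "complex_of_int (int N + int i) = of_real (real (N + i))"
    "complex_of_int (- (int N + int i)) = - of_real (real (N + i))" by simp_all
  show "z / complex_of_int (int N + int i) = of_real (1 / real (N + i)) * z"
    "z / complex_of_int (- (int N + int i)) = - (of_real (1 / real (N + i)) * z)"
    unfolding e of_real_divide divide_minus_right by simp_all
qed

lemma inverse_variation:
  assumes "N \<ge> (1::nat)"
  shows "\<bar>1 / real (N + Suc i) - 1 / real (N + i)\<bar> \<le> 1 / real N / real N"
proof -
  have "1 / real (N + Suc i) - 1 / real (N + i) = - (1 / (real (N + Suc i) * real (N + i)))"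
    using assms by (simp add: field_simps)
  moreover have "1 / (real (N + Suc i) * real (N + i)) \<le> 1 / (real N * real N)"
    using assms by (intro divide_left_mono mult_mono) auto
  ultimately show ?thesis by simp
qed

text \<open>One of the two halves of the piece is large, and partial summation removes the weights 1
  / s from it. Together this costs the passage from X to X ^ 4, hence the constant 4 * C.\<close>

lemma weyl_converse_dyadic:
  "\<exists>C. \<forall>X c M j. X \<ge> 2 \<and> 1 / X \<le> norm (\<Sum>s\<in>dyadic M j. echar (polyval d c s) / of_int s)
    \<longrightarrow> (\<forall>l. 1 \<le> l \<and> l \<le> d \<longrightarrow> appr (c l) (X ^ C) (X ^ C / (2 ^ j) ^ l))"
proof -
  obtain C where W: "\<And>X N c a n l. X \<ge> 2 \<Longrightarrow> N \<ge> 1 \<Longrightarrow> \<bar>a\<bar> \<le> 2 * int N \<Longrightarrow> n \<le> N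
      \<Longrightarrow> real N / X \<le> norm (\<Sum>i<n. echar (polyval d c (a + int i)))
      \<Longrightarrow> 1 \<le> l \<Longrightarrow> l \<le> d \<Longrightarrow> appr (c l) (X ^ C) (X ^ C / real N ^ l)"
    using weyl_converse[of d] by meson
  show ?thesis
  proof (intro exI[of _ "4 * C"] allI impI, elim conjE)
    fix X :: real and c M j l
    assume X: "X \<ge> 2" and big: "1 / X \<le> norm (\<Sum>s\<in>dyadic M j. echar (polyval d c s) / of_int s)"
      and l: "1 \<le> l" "l \<le> d"
    define N where "N = (2::nat) ^ j"
    have N: "1 \<le> N" by (simp add: N_def)
    have intN: "2 ^ j = int N" by (simp add: N_def)
    define n where "n = dyadic_length M j"
    have n: "n \<le> N" unfolding n_def N_def by (rule dyadic_length_le)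
    have half: "\<exists>m\<le>n. N / X ^ 4 \<le> norm (\<Sum>i<m. f i)"
      if large: "1 / (2 * X) \<le> norm (\<Sum>i<n. of_real (1 / real (N + i)) * f i)" for f :: "nat \<Rightarrow> complex"
    proof (rule ccontr)
      assume "\<not> ?thesis"
      then have small: "\<And>m. m \<le> n \<Longrightarrow> norm (\<Sum>i<m. f i) \<le> N / X ^ 4" by force
      have "norm (\<Sum>i<n. of_real (1 / real (N + i)) * f i) \<le> (1 / N + 1 / N) * (N / X ^ 4)"
      proof (rule norm_sum_by_parts[OF _ _ small])
        show "norm (complex_of_real (1 / real (N + n))) \<le> 1 / real N" unfolding norm_of_real
          using N by (simp add: frac_le)
        have "(\<Sum>i<n. norm (complex_of_real (1 / real (N + Suc i)) - complex_of_real (1 / real (N + i)))) \<le> (\<Sum>i<n. 1 / real N / real N)"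
          unfolding of_real_diff[symmetric] norm_of_real by (intro sum_mono inverse_variation[OF N])
        also have "\<dots> = real n * (1 / real N / real N)" by simp
        also have "\<dots> \<le> real N * (1 / real N / real N)" using n by (intro mult_right_mono) auto
        finally show "(\<Sum>i<n. norm (complex_of_real (1 / real (N + Suc i)) - complex_of_real (1 / real (N + i)))) \<le> 1 / real N"
          using N by simp
      qed
      also have "\<dots> = 2 / X ^ 4" using N by simp
      also have "\<dots> < 1 / (2 * X)"
      proof -
        have "2 * (2 * X) < X ^ 4"
        proof -
          have "4 * X < 8 * X" using X by simp
          also have "\<dots> \<le> X ^ 3 * X" by (rule absorb_const[OF X]) (use X in auto)
          also have "\<dots> = X ^ 4" by (simp add: eval_nat_numeral)
          finally show ?thesis by simp
        qed
        then show ?thesis using X by (simp add: divide_simps)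
      qed
      finally show False using large by simp
    qed
    define fp where "fp i = echar (polyval d c (int N + int i))" for i
    define fm where "fm i = echar (polyval d c (- (int N + int i)))" for i
    have "(\<Sum>s\<in>dyadic M j. echar (polyval d c s) / of_int s)
        = (\<Sum>i<n. of_real (1 / real (N + i)) * fp i) - (\<Sum>i<n. of_real (1 / real (N + i)) * fm i)"
      unfolding sum_dyadic n_def[symmetric] intN divide_dyadic_term fp_def fm_def by (simp only: sum_negf) simp
    then have "norm (\<Sum>s\<in>dyadic M j. echar (polyval d c s) / of_int s)
        \<le> norm (\<Sum>i<n. of_real (1 / real (N + i)) * fp i) + norm (\<Sum>i<n. of_real (1 / real (N + i)) * fm i)"
      by (simp only: norm_triangle_ineq4)
    moreover have "1 / X = 2 * (1 / (2 * X))" by simp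
    ultimately have "1 / (2 * X) \<le> norm (\<Sum>i<n. of_real (1 / real (N + i)) * fp i)
      \<or> 1 / (2 * X) \<le> norm (\<Sum>i<n. of_real (1 / real (N + i)) * fm i)" using big by argo
    then have "\<exists>a m. \<bar>a\<bar> \<le> 2 * int N \<and> m \<le> N \<and> N / X ^ 4 \<le> norm (\<Sum>i<m. echar (polyval d c (a + int i)))"
    proof
      assume "1 / (2 * X) \<le> norm (\<Sum>i<n. of_real (1 / real (N + i)) * fp i)"
      from half[OF this] obtain m where "m \<le> n" "N / X ^ 4 \<le> norm (\<Sum>i<m. fp i)" by blast
      then show ?thesis using n by (intro exI[of _ "int N"] exI[of _ m]) (auto simp: fp_def)
    next
      assume "1 / (2 * X) \<le> norm (\<Sum>i<n. of_real (1 / real (N + i)) * fm i)"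
      from half[OF this] obtain m where m: "m \<le> n" "N / X ^ 4 \<le> norm (\<Sum>i<m. fm i)" by blast
      \<comment> \<open>The negative half runs downwards; read backwards it is a sum over an
        increasing range that starts at - (N + m - 1).\<close>
      have "(\<Sum>i<m. fm i) = (\<Sum>i<m. echar (polyval d c (- int (N + m - 1) + int i)))"
      proof (rule sum.reindex_bij_witness[of _ "\<lambda>i. m - Suc i" "\<lambda>i. m - Suc i"], goal_cases)
        case (5 i)
        then have "- int (N + m - 1) + int (m - Suc i) = - (int N + int i)" using N by (simp add: of_nat_diff)
        then show ?case unfolding fm_def by simp
      qed auto
      then show ?thesis using m n N by (intro exI[of _ "- int (N + m - 1)"] exI[of _ m]) (auto simp del: of_nat_diff)
    qed
    then obtain a m where am: "\<bar>a\<bar> \<le> 2 * int N" "m \<le> N" "N / X ^ 4 \<le> norm (\<Sum>i<m. echar (polyval d c (a + int i)))"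
      by blast
    have "2 \<le> X ^ 4" using power_increasing[of 1 4 X] X by simp
    from W[OF this N am l] show "appr (c l) (X ^ (4 * C)) (X ^ (4 * C) / (2 ^ j) ^ l)"
      unfolding power_mult by (simp add: N_def)
  qed
qed

section \<open>Cancellation for phases whose odd coefficients are nearly rational\<close>

lemma periodic_zero_mean_sum:
  fixes G :: "nat \<Rightarrow> complex"
  assumes "\<And>i. norm (G i) \<le> 2" "\<And>i. G (i + q) = G i" "(\<Sum>i<q. G i) = 0" "1 \<le> q"
  shows "norm (\<Sum>i<m. G i) \<le> 2 * real q"
proof (induction m rule: less_induct)
  case (less m)
  show ?case
  proof (cases "m < q")
    case True
    have "norm (\<Sum>i<m. G i) \<le> (\<Sum>i<m. 2)" using assms(1) by (intro sum_norm_le)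
    then show ?thesis using True by simp
  next
    case False
    then have m: "m = q + (m - q)" "m - q < m" using assms(4) by auto
    have "(\<Sum>i<m. G i) = (\<Sum>i<m - q. G i)"
      by (subst m(1), subst sum_lessThan_add) (simp add: assms(2,3) add.commute[of q])
    then show ?thesis using less[OF m(2)] by simp
  qed
qed

lemma complete_residue_sum:
  fixes g :: "int \<Rightarrow> complex"
  assumes "\<And>t. g (t + int q) = g t"
  shows "(\<Sum>i<q. g (b + int i)) = (\<Sum>i<q. g (int i))"
proof -
  have step: "(\<Sum>i<q. g (b + 1 + int i)) = (\<Sum>i<q. g (b + int i))" for b
  proof -
    have "(\<Sum>i<Suc q. g (b + int i)) = g b + (\<Sum>i<q. g (b + 1 + int i))"
      by (subst sum.lessThan_Suc_shift) (simp add: algebra_simps)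
    then show ?thesis using assms[of b] by simp
  qed
  show ?thesis
  proof (induction b rule: int_induct[of _ 0])
    case base
    then show ?case by simp
  next
    case (step1 i)
    then show ?case using step[of i] by simp
  next
    case (step2 i)
    then show ?case using step[of "i - 1"] by simp
  qed
qed

text \<open>
  The odd part of the phase being rational up to \<open>\<delta>\<close>, the summand is a slowly varying odd function
  of \<open>s\<close> times a \<open>q\<close>-periodic one, and the odd part of the latter has mean zero over a period.
\<close>

lemma odd_cancellation_dyadic:
  fixes c :: "nat \<Rightarrow> real" and a :: "nat \<Rightarrow> int"
  assumes q: "1 \<le> q" and Y: "1 \<le> Y" and \<delta>: "0 \<le> \<delta>"
    and ev: "\<And>l. 1 \<le> l \<Longrightarrow> l \<le> d \<Longrightarrow> \<bar>c l - of_int (a l) / real q\<bar> \<le> Y / (2 ^ j) ^ l"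
    and od: "\<And>l. 1 \<le> l \<Longrightarrow> l \<le> d \<Longrightarrow> odd l \<Longrightarrow> \<bar>c l - of_int (a l) / real q\<bar> \<le> \<delta> / (2 ^ j) ^ l"
  shows "norm (\<Sum>s\<in>dyadic M j. echar (polyval d c s) / of_int s)
    \<le> 20 * (real d + 1) ^ 2 * 4 ^ d * (real q * Y / 2 ^ j + \<delta>)"
proof -
  define N where "N = (2::nat) ^ j"
  have N: "1 \<le> N" by (simp add: N_def)
  have intN: "2 ^ j = int N" "(2::real) ^ j = real N" by (simp_all add: N_def)
  define n where "n = dyadic_length M j"
  have n: "n \<le> N" unfolding n_def N_def by (rule dyadic_length_le)
  define \<beta> where "\<beta> l = c l - of_int (a l) / real q" for l
  define Le where "Le = {l\<in>{1..d}. even l}"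
  define Lo where "Lo = {l\<in>{1..d}. odd l}"
  \<comment> \<open>The even errors stay in the slowly varying factor; the odd ones are so small
    that they are dropped at a cost of order \<open>\<delta>\<close>.\<close>
  define E where "E t = (\<Sum>l\<in>Le. \<beta> l * of_int t ^ l)" for t :: int
  define D where "D t = (\<Sum>l\<in>Lo. \<beta> l * of_int t ^ l)" for t :: int
  define R where "R t = (\<Sum>l\<in>{1..d}. a l * t ^ l)" for t :: int
  define g where "g t = echar (of_int (R t) / real q)" for t
  have E_even: "E (- t) = E t" for t unfolding E_def by (rule sum.cong) (auto simp: Le_def)
  have D_odd: "D (- t) = - D t" for t unfolding D_def sum_negf[symmetric] by (rule sum.cong) (auto simp: Lo_def)
  have decomp: "polyval d c t = of_int (R t) / real q + (c 0 + E t) + D t" for t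
  proof -
    have "{..d} = insert 0 {1..d}" by auto
    then have "polyval d c t = c 0 + (\<Sum>l\<in>{1..d}. c l * of_int t ^ l)" by (simp add: polyval_def)
    also have "(\<Sum>l\<in>{1..d}. c l * of_int t ^ l) = of_int (R t) / real q + (\<Sum>l\<in>{1..d}. \<beta> l * of_int t ^ l)"
      by (simp add: R_def \<beta>_def left_diff_distrib sum_subtractf sum_divide_distrib)
    also have "{1..d} = Le \<union> Lo" by (auto simp: Le_def Lo_def)
    also have "(\<Sum>l\<in>Le \<union> Lo. \<beta> l * of_int t ^ l) = E t + D t"
      unfolding E_def D_def by (rule sum.union_disjoint) (auto simp: Le_def Lo_def)
    finally show ?thesis by (simp add: algebra_simps)
  qed
  have D_small: "\<bar>D t\<bar> \<le> real d * 2 ^ d * \<delta>" if t: "\<bar>t\<bar> \<le> 2 * int N" for t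
  proof -
    have "\<bar>D t\<bar> \<le> (\<Sum>l\<in>Lo. 2 ^ d * \<delta>)" unfolding D_def
    proof (rule order_trans[OF sum_abs sum_mono])
      fix l assume "l \<in> Lo"
      then have l: "1 \<le> l" "l \<le> d" "odd l" by (auto simp: Lo_def)
      have "\<bar>real_of_int t\<bar> \<le> 2 * real N" using t by linarith
      then have "\<bar>real_of_int t\<bar> ^ l \<le> (2 * real N) ^ l" by (intro power_mono) auto
      then have "\<bar>\<beta> l\<bar> * \<bar>real_of_int t\<bar> ^ l \<le> \<delta> / real N ^ l * (2 * real N) ^ l"
        using od[OF l] \<delta> unfolding intN by (intro mult_mono) (auto simp: \<beta>_def)
      also have "\<dots> = 2 ^ l * \<delta>" using N by (simp add: power_mult_distrib)
      also have "\<dots> \<le> 2 ^ d * \<delta>" using \<delta> l by (intro mult_right_mono power_increasing) auto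
      finally show "\<bar>\<beta> l * of_int t ^ l\<bar> \<le> 2 ^ d * \<delta>" by (simp add: abs_mult power_abs)
    qed
    also have "\<dots> = real (card Lo) * (2 ^ d * \<delta>)" by simp
    also have "\<dots> \<le> real d * (2 ^ d * \<delta>)"
    proof -
      have "card Lo \<le> card {1..d}" by (intro card_mono) (auto simp: Lo_def)
      then show ?thesis using \<delta> by (intro mult_right_mono) auto
    qed
    finally show ?thesis by simp
  qed
  \<comment> \<open>The weight 1 / s is odd, so pairing s with - s leaves the even factor w times
    the odd part of g.\<close>
  define G where "G i = g (int N + int i) - g (- (int N + int i))" for i
  define w where "w i = echar (c 0 + E (int N + int i)) * of_real (1 / real (N + i))" for i
  define err where "err t = echar (polyval d c t) - echar (of_int (R t) / real q + (c 0 + E t))" for t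
  have err: "norm (err t) \<le> 2 * pi * (real d * 2 ^ d * \<delta>)" if t: "\<bar>t\<bar> \<le> 2 * int N" for t
  proof -
    have "norm (err t) \<le> 2 * pi * \<bar>polyval d c t - (of_int (R t) / real q + (c 0 + E t))\<bar>"
      unfolding err_def by (rule norm_echar_diff_le)
    also have "polyval d c t - (of_int (R t) / real q + (c 0 + E t)) = D t" unfolding decomp by simp
    also have "2 * pi * \<bar>D t\<bar> \<le> 2 * pi * (real d * 2 ^ d * \<delta>)" using D_small[OF t] by (intro mult_left_mono) auto
    finally show ?thesis .
  qed
  have split: "echar (polyval d c t) = echar (c 0 + E t) * g t + err t" for t
    unfolding err_def g_def by (simp add: echar_add mult.commute)
  have "(\<Sum>s\<in>dyadic M j. echar (polyval d c s) / of_int s)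
      = (\<Sum>i<n. w i * G i) + (\<Sum>i<n. (err (int N + int i) - err (- (int N + int i))) * of_real (1 / real (N + i)))"
    unfolding sum_dyadic n_def[symmetric] intN sum.distrib[symmetric]
  proof (rule sum.cong[OF refl])
    fix i
    obtain r where r: "complex_of_real (1 / real (N + i)) = r" by simp
    show "echar (polyval d c (int N + int i)) / complex_of_int (int N + int i) +
        echar (polyval d c (- (int N + int i))) / complex_of_int (- (int N + int i))
      = w i * G i + (err (int N + int i) - err (- (int N + int i))) * of_real (1 / real (N + i))"
      unfolding divide_dyadic_term split[of "int N + int i"] split[of "- (int N + int i)"] E_even w_def G_def r
      by (simp add: algebra_simps)
  qed
  then have tri: "norm (\<Sum>s\<in>dyadic M j. echar (polyval d c s) / of_int s)
      \<le> norm (\<Sum>i<n. w i * G i) + norm (\<Sum>i<n. (err (int N + int i) - err (- (int N + int i))) * of_real (1 / real (N + i)))"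
    by (simp add: norm_triangle_ineq)
  have part2: "norm (\<Sum>i<n. (err (int N + int i) - err (- (int N + int i))) * of_real (1 / real (N + i)))
      \<le> 4 * pi * (real d * 2 ^ d * \<delta>)"
  proof -
    have "norm (\<Sum>i<n. (err (int N + int i) - err (- (int N + int i))) * of_real (1 / real (N + i)))
        \<le> (\<Sum>i<n. (2 * (2 * pi * (real d * 2 ^ d * \<delta>))) * (1 / real N))"
    proof (rule sum_norm_le)
      fix i assume "i \<in> {..<n}"
      then have i: "i < N" using n by simp
      have "norm (err (int N + int i) - err (- (int N + int i))) \<le> norm (err (int N + int i)) + norm (err (- (int N + int i)))"
        by (rule norm_triangle_ineq4)
      also have "\<dots> \<le> 2 * (2 * pi * (real d * 2 ^ d * \<delta>))"
        using err[of "int N + int i"] err[of "- (int N + int i)"] i by simp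
      finally show "norm ((err (int N + int i) - err (- (int N + int i))) * of_real (1 / real (N + i)))
          \<le> (2 * (2 * pi * (real d * 2 ^ d * \<delta>))) * (1 / real N)"
        unfolding norm_mult norm_of_real using \<delta> N by (intro mult_mono) (auto simp: frac_le)
    qed
    also have "\<dots> = real n * ((2 * (2 * pi * (real d * 2 ^ d * \<delta>))) * (1 / real N))" by simp
    also have "\<dots> \<le> real N * ((2 * (2 * pi * (real d * 2 ^ d * \<delta>))) * (1 / real N))"
      using n \<delta> by (intro mult_right_mono) auto
    finally show ?thesis using N by simp
  qed
  have g_per: "g (t + int q) = g t" for t
  proof -
    have "int q dvd R (t + int q) - R t" unfolding R_def sum_subtractf[symmetric] right_diff_distrib[symmetric]
    proof (intro dvd_sum dvd_mult)
      fix l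
      have "(t + int q) - t dvd (t + int q) ^ l - t ^ l"
        unfolding power_diff_sumr2[of "t + int q"] by (rule dvd_triv_left)
      then show "int q dvd (t + int q) ^ l - t ^ l" by simp
    qed
    then obtain k where "R (t + int q) = R t + int q * k" by (metis add.commute diff_add_cancel dvdE)
    then have "of_int (R (t + int q)) / real q = of_int (R t) / real q + of_int k"
      using q by (simp add: add_divide_distrib)
    then show ?thesis by (simp add: g_def echar_add)
  qed
  have G_sum: "norm (\<Sum>i<m. G i) \<le> 2 * real q" for m
  proof (rule periodic_zero_mean_sum[OF _ _ _ q])
    show "norm (G i) \<le> 2" for i unfolding G_def using norm_triangle_ineq4[of "g (int N + int i)" "g (- (int N + int i))"]
      by (simp add: g_def)
    show "G (i + q) = G i" for i
      using g_per[of "int N + int i"] g_per[of "- (int N + int i) - int q"] by (simp add: G_def algebra_simps)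
    \<comment> \<open>Read backwards, the negative arguments also run through q consecutive
      integers, so both parts of G contribute the same complete residue sum and cancel.\<close>
    have "(\<Sum>i<q. g (- (int N + int i))) = (\<Sum>i<q. g (- (int N + int q - 1) + int i))"
    proof (rule sum.reindex_bij_witness[of _ "\<lambda>i. q - Suc i" "\<lambda>i. q - Suc i"], goal_cases)
      case (5 i)
      then have "- (int N + int q - 1) + int (q - Suc i) = - (int N + int i)" by (simp add: of_nat_diff)
      then show ?case by (simp only:)
    qed auto
    then show "(\<Sum>i<q. G i) = 0"
      using complete_residue_sum[of g q "int N", OF g_per] complete_residue_sum[of g q "- (int N + int q - 1)", OF g_per]
      by (simp add: G_def sum_subtractf)
  qed
  define V where "V = 2 * pi * (real d * (real d * 4 ^ d) * Y / N) + 1 / N"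
  have part1: "norm (\<Sum>i<n. w i * G i) \<le> (1 / N + V) * (2 * real q)"
  proof (rule norm_sum_by_parts[OF _ _ G_sum])
    show "norm (w n) \<le> 1 / N" unfolding w_def norm_mult norm_of_real norm_echar using N by (simp add: frac_le)
    have "norm (w (Suc i) - w i) \<le> V / N" if i: "i < n" for i
    proof -
      let ?e = "\<lambda>i. echar (c 0 + E (int N + int i))"
      let ?r = "\<lambda>i. complex_of_real (1 / real (N + i))"
      have "w (Suc i) - w i = (?e (Suc i) - ?e i) * ?r (Suc i) + ?e i * (?r (Suc i) - ?r i)"
        by (simp add: w_def algebra_simps)
      then have "norm (w (Suc i) - w i) \<le> norm (?e (Suc i) - ?e i) * norm (?r (Suc i)) + norm (?e i) * norm (?r (Suc i) - ?r i)"
        by (metis norm_mult norm_triangle_ineq)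
      also have "\<dots> \<le> 2 * pi * (real d * (real d * 4 ^ d) * Y / N) * (1 / N) + 1 * (1 / real N / real N)"
      proof (intro add_mono mult_mono)
        have "\<bar>E (int N + int (Suc i)) - E (int N + int i)\<bar>
            \<le> real d * (real d * 4 ^ d) * Y / N * \<bar>real_of_int (int N + int (Suc i) - (int N + int i))\<bar>"
          unfolding E_def by (rule power_sum_variation[OF N Y]) (use N n i ev in \<open>auto simp: \<beta>_def Le_def intN\<close>)
        then have "\<bar>(c 0 + E (int N + int (Suc i))) - (c 0 + E (int N + int i))\<bar> \<le> real d * (real d * 4 ^ d) * Y / N"
          by simp
        then show "norm (?e (Suc i) - ?e i) \<le> 2 * pi * (real d * (real d * 4 ^ d) * Y / N)"
          by (intro order_trans[OF norm_echar_diff_le] mult_left_mono) auto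
        show "norm (?r (Suc i)) \<le> 1 / N" unfolding norm_of_real using N by (simp add: frac_le)
        show "norm (?r (Suc i) - ?r i) \<le> 1 / real N / real N"
          unfolding of_real_diff[symmetric] norm_of_real by (rule inverse_variation[OF N])
      qed (use Y in auto)
      also have "\<dots> = V / N" by (simp add: V_def add_divide_distrib)
      finally show ?thesis .
    qed
    then have "(\<Sum>i<n. norm (w (Suc i) - w i)) \<le> (\<Sum>i<n. V / N)" by (intro sum_mono) auto
    also have "\<dots> = n * (V / N)" by simp
    also have "\<dots> \<le> N * (V / N)" using n Y by (intro mult_right_mono) (auto simp: V_def)
    finally show "(\<Sum>i<n. norm (w (Suc i) - w i)) \<le> V" using N by simp
  qed
  define K where "K = (real d + 1) ^ 2 * (4::real) ^ d"
  have K: "1 \<le> K" "real d * (real d * 4 ^ d) \<le> K" "real d * 2 ^ d \<le> K"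
  proof -
    show "1 \<le> K" unfolding K_def using mult_mono[of 1 "(real d + 1) ^ 2" 1 "4 ^ d"] by simp
    have "real d * real d \<le> (real d + 1) ^ 2" by (simp add: power2_eq_square algebra_simps)
    then show "real d * (real d * 4 ^ d) \<le> K" unfolding K_def mult.assoc[symmetric] by (intro mult_right_mono) auto
    show "real d * 2 ^ d \<le> K" unfolding K_def by (intro mult_mono power_mono) (auto simp: power2_eq_square algebra_simps)
  qed
  have "(1 / N + V) * (2 * real q) \<le> 20 * K * (real q * Y / N)"
  proof -
    have "V \<le> 8 * (K * Y / N) + 1 / N"
    proof -
      have "2 * pi * (real d * (real d * 4 ^ d) * Y / N) \<le> 8 * (K * Y / N)"
        using K Y pi_less_4 by (intro mult_mono divide_right_mono mult_right_mono) auto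
      then show ?thesis by (simp add: V_def)
    qed
    moreover have "1 / N \<le> K * Y / N" using mult_mono[OF K(1) Y] K by (intro divide_right_mono) auto
    ultimately have "1 / N + V \<le> 10 * (K * Y / N)" by linarith
    then have "(1 / N + V) * (2 * real q) \<le> 10 * (K * Y / N) * (2 * real q)" by (intro mult_right_mono) auto
    then show ?thesis by (simp add: mult_ac)
  qed
  moreover have "4 * pi * (real d * 2 ^ d * \<delta>) \<le> 20 * K * \<delta>"
  proof -
    have "4 * pi * (real d * 2 ^ d * \<delta>) \<le> 20 * (K * \<delta>)"
      using K \<delta> pi_less_4 by (intro mult_mono mult_right_mono) auto
    then show ?thesis by simp
  qed
  ultimately show ?thesis using tri part1 part2 unfolding intN K_def by (simp add: algebra_simps)
qed

subsection \<open>Polynomials in several variables\<close>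

text \<open>Functions are extended by zero outside \<open>F\<close>, so that exponents can be updated freely.\<close>

definition boxfun :: "'k set \<Rightarrow> ('k \<Rightarrow> 'a::zero set) \<Rightarrow> ('k \<Rightarrow> 'a) set" where
  "boxfun F A = {t. (\<forall>\<kappa>\<in>F. t \<kappa> \<in> A \<kappa>) \<and> (\<forall>\<kappa>. \<kappa> \<notin> F \<longrightarrow> t \<kappa> = 0)}"

lemma boxfunD: "t \<in> boxfun F A \<Longrightarrow> \<kappa> \<in> F \<Longrightarrow> t \<kappa> \<in> A \<kappa>"
  by (simp add: boxfun_def)

lemma boxfun_off: "t \<in> boxfun F A \<Longrightarrow> \<kappa> \<notin> F \<Longrightarrow> t \<kappa> = 0"
  by (simp add: boxfun_def)

lemma boxfun_empty [simp]: "boxfun {} A = {\<lambda>_. 0}"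
  by (auto simp: boxfun_def)

lemma boxfun_upd: "t \<in> boxfun F A \<Longrightarrow> s \<in> A \<mu> \<Longrightarrow> t(\<mu> := s) \<in> boxfun (insert \<mu> F) A"
  by (auto simp: boxfun_def)

lemma boxfun_restrict: "t \<in> boxfun (insert \<mu> F) A \<Longrightarrow> \<mu> \<notin> F \<Longrightarrow> t(\<mu> := 0) \<in> boxfun F A"
  by (auto simp: boxfun_def)

lemma bij_betw_boxfun_insert:
  assumes "\<mu> \<notin> F"
  shows "bij_betw (\<lambda>(t, s). t(\<mu> := s)) (boxfun F A \<times> A \<mu>) (boxfun (insert \<mu> F) A)"
  by (rule bij_betwI[where g="\<lambda>t. (t(\<mu> := 0), t \<mu>)"])
     (use assms in \<open>auto simp: boxfun_def fun_eq_iff\<close>)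

lemma sum_boxfun_insert:
  assumes "\<mu> \<notin> F"
  shows "sum f (boxfun (insert \<mu> F) A) = (\<Sum>t\<in>boxfun F A. \<Sum>s\<in>A \<mu>. f (t(\<mu> := s)))"
proof -
  have "sum f (boxfun (insert \<mu> F) A) = (\<Sum>(t, s)\<in>boxfun F A \<times> A \<mu>. f (t(\<mu> := s)))"
    using sum.reindex_bij_betw[OF bij_betw_boxfun_insert[OF assms], of f A] by (simp add: case_prod_unfold)
  then show ?thesis by (simp add: sum.cartesian_product)
qed

lemma finite_boxfun:
  assumes "finite F" "\<And>\<kappa>. \<kappa> \<in> F \<Longrightarrow> finite (A \<kappa>)"
  shows "finite (boxfun F A)"
  using assms
proof (induction F rule: finite_induct)
  case (insert \<mu> F)
  then show ?case using bij_betw_finite[OF bij_betw_boxfun_insert[OF insert(2), of A]] by auto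
qed simp

lemma card_boxfun:
  assumes "finite F"
  shows "card (boxfun F A) = (\<Prod>\<kappa>\<in>F. card (A \<kappa>))"
  using assms
proof (induction F rule: finite_induct)
  case (insert \<mu> F)
  then show ?case using bij_betw_same_card[OF bij_betw_boxfun_insert[OF insert(2), of A]]
    by (simp add: card_cartesian_product mult.commute)
qed simp

abbreviation exponents :: "'k set \<Rightarrow> nat \<Rightarrow> ('k \<Rightarrow> nat) set" where
  "exponents F d \<equiv> boxfun F (\<lambda>_. {..d})"

definition mpoly :: "'k set \<Rightarrow> nat \<Rightarrow> (('k \<Rightarrow> nat) \<Rightarrow> real) \<Rightarrow> ('k \<Rightarrow> int) \<Rightarrow> real" where
  "mpoly F d c t = (\<Sum>n\<in>exponents F d. c n * (\<Prod>\<kappa>\<in>F. of_int (t \<kappa>) ^ n \<kappa>))"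

text \<open>The variable \<open>\<mu>\<close> is fixed at s; the coefficients of the remaining
  polynomial are themselves polynomials in s.\<close>

definition slice :: "nat \<Rightarrow> (('k \<Rightarrow> nat) \<Rightarrow> real) \<Rightarrow> 'k \<Rightarrow> int \<Rightarrow> ('k \<Rightarrow> nat) \<Rightarrow> real" where
  "slice d c \<mu> s n = polyval d (\<lambda>i. c (n(\<mu> := i))) s"

lemma finite_exponents: "finite F \<Longrightarrow> finite (exponents F d)"
  by (simp add: finite_boxfun)

lemma mpoly_insert:
  assumes "finite F" "\<mu> \<notin> F"
  shows "mpoly (insert \<mu> F) d c (t(\<mu> := s)) = mpoly F d (slice d c \<mu> s) t"
    and "mpoly (insert \<mu> F) d c (t(\<mu> := s)) = polyval d (\<lambda>i. mpoly F d (\<lambda>n. c (n(\<mu> := i))) t) s"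
proof -
  have P: "(\<Prod>\<kappa>\<in>insert \<mu> F. of_int ((t(\<mu> := s)) \<kappa>) ^ (n(\<mu> := i)) \<kappa>)
      = real_of_int s ^ i * (\<Prod>\<kappa>\<in>F. of_int (t \<kappa>) ^ n \<kappa>)" for n :: "'a \<Rightarrow> nat" and i
  proof -
    have "(\<Prod>\<kappa>\<in>F. of_int ((t(\<mu> := s)) \<kappa>) ^ (n(\<mu> := i)) \<kappa>) = (\<Prod>\<kappa>\<in>F. real_of_int (t \<kappa>) ^ n \<kappa>)"
      by (rule prod.cong) (use assms(2) in auto)
    then show ?thesis using assms by simp
  qed
  have 1: "mpoly (insert \<mu> F) d c (t(\<mu> := s))
      = (\<Sum>n\<in>exponents F d. \<Sum>i\<le>d. c (n(\<mu> := i)) * (real_of_int s ^ i * (\<Prod>\<kappa>\<in>F. of_int (t \<kappa>) ^ n \<kappa>)))"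
    unfolding mpoly_def by (subst sum_boxfun_insert[OF assms(2)]) (simp only: P)
  show "mpoly (insert \<mu> F) d c (t(\<mu> := s)) = mpoly F d (slice d c \<mu> s) t"
    unfolding 1 unfolding mpoly_def slice_def polyval_def by (simp add: sum_distrib_right mult.assoc)
  have "(\<Sum>n\<in>exponents F d. \<Sum>i\<le>d. c (n(\<mu> := i)) * (real_of_int s ^ i * (\<Prod>\<kappa>\<in>F. of_int (t \<kappa>) ^ n \<kappa>)))
      = (\<Sum>i\<le>d. \<Sum>n\<in>exponents F d. c (n(\<mu> := i)) * (real_of_int s ^ i * (\<Prod>\<kappa>\<in>F. of_int (t \<kappa>) ^ n \<kappa>)))"
    by (rule sum.swap)
  then show "mpoly (insert \<mu> F) d c (t(\<mu> := s)) = polyval d (\<lambda>i. mpoly F d (\<lambda>n. c (n(\<mu> := i))) t) s"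
    unfolding 1 unfolding mpoly_def polyval_def by (simp add: sum_distrib_right sum_distrib_left mult_ac)
qed

text \<open>Many t in the smaller box have many s for which the value is nearly rational. For these
  t the one-variable result applies in s, and its conclusion, that the coefficients of s ^ i are
  nearly rational, is the hypothesis of the induction for polynomials in t.\<close>

lemma rational_mpoly_approximation:
  assumes "finite F"
  shows "\<exists>C. \<forall>X N \<epsilon> G c. X \<ge> 2 \<and> (\<forall>\<kappa>\<in>F. 1 \<le> N \<kappa> \<and> X ^ C \<le> real (N \<kappa>)) \<and> \<epsilon> \<ge> 0 \<and> \<epsilon> * X ^ C \<le> 1
      \<and> G \<subseteq> boxfun F (\<lambda>\<kappa>. {- int (N \<kappa>)..int (N \<kappa>)}) \<and> (\<Prod>\<kappa>\<in>F. real (N \<kappa>)) / X \<le> card G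
      \<and> (\<forall>t\<in>G. appr (mpoly F d c t) X \<epsilon>)
    \<longrightarrow> (\<forall>n\<in>exponents F d. appr (c n) (X ^ C) (X ^ C * \<epsilon> / (\<Prod>\<kappa>\<in>F. real (N \<kappa>) ^ n \<kappa>)))"
  using assms
proof (induction F rule: finite_induct)
  case empty
  show ?case
  proof (intro exI[of _ 1] allI impI ballI, elim conjE)
    fix X :: real and N :: "'a \<Rightarrow> nat" and \<epsilon> :: real and G :: "('a \<Rightarrow> int) set" and c and n :: "'a \<Rightarrow> nat"
    assume X: "X \<ge> 2" and eps: "0 \<le> \<epsilon>" and G: "G \<subseteq> boxfun {} (\<lambda>\<kappa>. {- int (N \<kappa>)..int (N \<kappa>)})" "(\<Prod>\<kappa>\<in>{}. real (N \<kappa>)) / X \<le> card G"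
      and ap: "\<forall>t\<in>G. appr (mpoly {} d c t) X \<epsilon>" and n: "n \<in> exponents {} d"
    have "G \<noteq> {}" using G(2) X by auto
    then have "appr (c n) X \<epsilon>" using ap n by (auto simp: mpoly_def)
    then show "appr (c n) (X ^ 1) (X ^ 1 * \<epsilon> / (\<Prod>\<kappa>\<in>{}. real (N \<kappa>) ^ n \<kappa>))"
      by (rule appr_mono) (use X eps mult_right_mono[of 1 X \<epsilon>] in auto)
  qed
next
  case (insert \<mu> F)
  obtain C1 where NI: "\<And>X N \<epsilon> G c i. X \<ge> 2 \<Longrightarrow> N \<ge> 1 \<Longrightarrow> \<epsilon> \<ge> 0 \<Longrightarrow> G \<subseteq> {- int N..int N} \<Longrightarrow> real N / X \<le> card G
      \<Longrightarrow> X ^ C1 \<le> real N \<Longrightarrow> \<epsilon> * X ^ C1 \<le> 1 \<Longrightarrow> \<forall>t\<in>G. appr (polyval d c t) X \<epsilon> \<Longrightarrow> i \<le> d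
      \<Longrightarrow> appr (c i) (X ^ C1) (X ^ C1 * \<epsilon> / real N ^ i)"
    using rational_polynomial_approximation[of d] by meson
  obtain C2 where IH: "\<And>X N \<epsilon> G c n. X \<ge> 2 \<Longrightarrow> \<forall>\<kappa>\<in>F. 1 \<le> N \<kappa> \<and> X ^ C2 \<le> real (N \<kappa>) \<Longrightarrow> \<epsilon> \<ge> 0 \<Longrightarrow> \<epsilon> * X ^ C2 \<le> 1
      \<Longrightarrow> G \<subseteq> boxfun F (\<lambda>\<kappa>. {- int (N \<kappa>)..int (N \<kappa>)}) \<Longrightarrow> (\<Prod>\<kappa>\<in>F. real (N \<kappa>)) / X \<le> card G
      \<Longrightarrow> \<forall>t\<in>G. appr (mpoly F d c t) X \<epsilon> \<Longrightarrow> n \<in> exponents F d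
      \<Longrightarrow> appr (c n) (X ^ C2) (X ^ C2 * \<epsilon> / (\<Prod>\<kappa>\<in>F. real (N \<kappa>) ^ n \<kappa>))"
    by (rule exE[OF insert.IH], rule that, elim allE, erule impE, (intro conjI; assumption), erule (1) bspec)
  \<comment> \<open>The box over F has at most X ^ (2 * card F) times the product P of its sides
    many points. Fibres with fewer than N \<mu> / X ^ k elements therefore hold at most N \<mu> * P
    / X ^ 2 points, half of what is available.\<close>
  define k where "k = 2 * card F + 2"
  define A where "A = k * C1 + 4"
  define C where "C = A * C2 + A + k"
  show ?case
  proof (intro exI[of _ C] allI impI ballI, elim conjE)
    fix X :: real and N :: "'a \<Rightarrow> nat" and \<epsilon> :: real and G :: "('a \<Rightarrow> int) set" and c and n :: "'a \<Rightarrow> nat"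
    assume X: "X \<ge> 2" and N: "\<forall>\<kappa>\<in>insert \<mu> F. 1 \<le> N \<kappa> \<and> X ^ C \<le> real (N \<kappa>)" and eps: "0 \<le> \<epsilon>" and epsC: "\<epsilon> * X ^ C \<le> 1"
      and G: "G \<subseteq> boxfun (insert \<mu> F) (\<lambda>\<kappa>. {- int (N \<kappa>)..int (N \<kappa>)})" "(\<Prod>\<kappa>\<in>insert \<mu> F. real (N \<kappa>)) / X \<le> card G"
      and ap: "\<forall>t\<in>G. appr (mpoly (insert \<mu> F) d c t) X \<epsilon>" and n: "n \<in> exponents (insert \<mu> F) d"
    have X1: "1 \<le> X" using X by simp
    have pm: "X ^ a \<le> X ^ b" if "a \<le> b" for a b using X1 that by (rule power_increasing[rotated])
    have small: "\<epsilon> * X ^ a \<le> 1" if "a \<le> C" for a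
      using epsC mult_left_mono[OF pm[OF that] eps] by linarith
    have large: "X ^ a \<le> real (N \<kappa>)" if "a \<le> C" "\<kappa> \<in> insert \<mu> F" for a \<kappa>
      using N pm[OF that(1)] that(2) by fastforce
    have "1 \<le> k" "1 \<le> A" by (simp_all add: k_def A_def)
    then have Xk: "X \<le> X ^ k" and XA: "X \<le> X ^ A" using pm[of 1 k] pm[of 1 A] by simp_all
    let ?B = "\<lambda>\<kappa>. {- int (N \<kappa>)..int (N \<kappa>)}"
    define P where "P = (\<Prod>\<kappa>\<in>F. real (N \<kappa>))"
    have P: "1 \<le> P" unfolding P_def using N by (intro prod_ge_1) auto
    define Gt where "Gt t = {s\<in>?B \<mu>. t(\<mu> := s) \<in> G}" for t
    have finG: "finite G" by (rule finite_subset[OF G(1)]) (use insert in \<open>auto intro: finite_boxfun\<close>)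
    have cG: "real (card G) = (\<Sum>t\<in>boxfun F ?B. real (card (Gt t)))"
    proof -
      have fin: "finite (boxfun (insert \<mu> F) ?B)" using insert by (intro finite_boxfun) auto
      have "real (card G) = (\<Sum>t\<in>boxfun (insert \<mu> F) ?B. of_bool (t \<in> G))"
        using G(1) fin by (simp add: Int_absorb1)
      also have "\<dots> = (\<Sum>t\<in>boxfun F ?B. \<Sum>s\<in>?B \<mu>. of_bool (t(\<mu> := s) \<in> G))"
        by (rule sum_boxfun_insert[OF insert(2)])
      also have "\<dots> = (\<Sum>t\<in>boxfun F ?B. real (card (Gt t)))"
        by (simp add: Gt_def Int_def)
      finally show ?thesis .
    qed
    define \<tau> where "\<tau> = real (N \<mu>) / X ^ k"
    define H where "H = {t\<in>boxfun F ?B. \<tau> \<le> real (card (Gt t))}"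
    have cB: "real (card (?B \<kappa>)) \<le> X ^ 2 * real (N \<kappa>)" if "\<kappa> \<in> insert \<mu> F" for \<kappa>
    proof -
      have "real (card (?B \<kappa>)) \<le> 3 * real (N \<kappa>)" using N that by fastforce
      also have "\<dots> \<le> X ^ 2 * real (N \<kappa>)" using X by (intro absorb_const) auto
      finally show ?thesis .
    qed
    have cbox: "real (card (boxfun F ?B)) \<le> X ^ (2 * card F) * P"
    proof -
      have "real (card (boxfun F ?B)) = (\<Prod>\<kappa>\<in>F. real (card (?B \<kappa>)))"
        using insert by (simp add: card_boxfun)
      also have "\<dots> \<le> (\<Prod>\<kappa>\<in>F. X ^ 2 * real (N \<kappa>))" using cB by (intro prod_mono) auto
      also have "\<dots> = X ^ (2 * card F) * P" by (simp add: prod.distrib P_def power_mult)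
      finally show ?thesis .
    qed
    have "real (card G) - \<tau> * card (boxfun F ?B) \<le> (X ^ 2 * real (N \<mu>)) * card H"
      unfolding cG H_def
    proof (rule popular)
      fix t
      have "card (Gt t) \<le> card (?B \<mu>)" by (rule card_mono) (auto simp: Gt_def)
      then show "real (card (Gt t)) \<le> X ^ 2 * real (N \<mu>)" using cB[of \<mu>] by fastforce
    qed (use insert X in \<open>auto simp: \<tau>_def intro: finite_boxfun\<close>)
    moreover have "\<tau> * card (boxfun F ?B) \<le> \<tau> * (X ^ (2 * card F) * P)"
      using cbox X by (intro mult_left_mono) (auto simp: \<tau>_def)
    moreover have "\<tau> * (X ^ (2 * card F) * P) = N \<mu> * P / X ^ 2"
      using X by (simp add: \<tau>_def k_def power_add power2_eq_square)
    moreover have "N \<mu> * P / X \<le> card G" using G(2) insert by (simp add: P_def)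
    moreover have "N \<mu> * P / X ^ 2 \<le> N \<mu> * P / X / 2" 
      unfolding power2_eq_square divide_divide_eq_left using X P by (intro divide_left_mono mult_left_mono) auto
    ultimately have "N \<mu> * P / X / 2 \<le> (X ^ 2 * real (N \<mu>)) * card H" by linarith
    then have "real (N \<mu>) * (P / (2 * X)) \<le> real (N \<mu>) * (X ^ 2 * card H)" by (simp add: mult_ac)
    then have "P / (2 * X) \<le> X ^ 2 * card H" by (rule mult_left_le_imp_le) (use N in fastforce)
    moreover have "P / X ^ 4 * X ^ 2 \<le> P / (2 * X)"
    proof -
      have "P / X ^ 4 * X ^ 2 = P / (X * X)" using X by (simp add: eval_nat_numeral)
      also have "\<dots> \<le> P / (2 * X)" using X P by (intro divide_left_mono mult_right_mono) auto
      finally show ?thesis .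
    qed
    ultimately have "X ^ 2 * (P / X ^ 4) \<le> X ^ 2 * card H" by (simp add: mult.commute)
    then have cH: "P / X ^ 4 \<le> card H" by (rule mult_left_le_imp_le) (use X in simp)
    have N\<mu>: "1 \<le> N \<mu>" using N by auto
    define i where "i = n \<mu>"
    define m where "m = n(\<mu> := 0)"
    have m: "m \<in> exponents F d" unfolding m_def using n insert(2) by (rule boxfun_restrict)
    have i: "i \<le> d" using boxfunD[OF n, of \<mu>] by (simp add: i_def)
    define e where "e = X ^ (k * C1) * \<epsilon> / real (N \<mu>) ^ i"
    have e: "0 \<le> e" using X eps by (simp add: e_def)
    have e_le: "e \<le> X ^ (k * C1) * \<epsilon>"
    proof -
      have "1 \<le> real (N \<mu>) ^ i" using N\<mu> by simp
      then have "X ^ (k * C1) * \<epsilon> / real (N \<mu>) ^ i \<le> X ^ (k * C1) * \<epsilon> / 1"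
        using X eps N\<mu> by (intro divide_left_mono) auto
      then show ?thesis by (simp add: e_def)
    qed
    have coef: "appr (mpoly F d (\<lambda>n. c (n(\<mu> := i))) t) (X ^ (k * C1)) e" if t: "t \<in> H" for t
      unfolding power_mult e_def
    proof (rule NI[OF _ N\<mu> eps _ _ _ _ _ i])
      show "2 \<le> X ^ k" using Xk X by simp
      show "Gt t \<subseteq> ?B \<mu>" by (auto simp: Gt_def)
      show "real (N \<mu>) / X ^ k \<le> card (Gt t)" using t by (simp add: H_def \<tau>_def)
      show "(X ^ k) ^ C1 \<le> real (N \<mu>)" unfolding power_mult[symmetric] by (rule large) (simp_all add: C_def A_def)
      show "\<epsilon> * (X ^ k) ^ C1 \<le> 1" unfolding power_mult[symmetric] by (rule small) (simp_all add: C_def A_def)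
      show "\<forall>s\<in>Gt t. appr (polyval d (\<lambda>i. mpoly F d (\<lambda>n. c (n(\<mu> := i))) t) s) (X ^ k) \<epsilon>"
      proof
        fix s assume "s \<in> Gt t"
        then have "appr (mpoly (insert \<mu> F) d c (t(\<mu> := s))) X \<epsilon>" using ap by (simp add: Gt_def)
        then show "appr (polyval d (\<lambda>i. mpoly F d (\<lambda>n. c (n(\<mu> := i))) t) s) (X ^ k) \<epsilon>"
          unfolding mpoly_insert(2)[OF insert(1,2)] using Xk by (elim appr_mono) auto
      qed
    qed
    have r1: "appr (c (m(\<mu> := i))) ((X ^ A) ^ C2) ((X ^ A) ^ C2 * e / (\<Prod>\<kappa>\<in>F. real (N \<kappa>) ^ m \<kappa>))"
    proof (rule IH[where G=H and c="\<lambda>n. c (n(\<mu> := i))", OF _ _ e _ _ _ _ m])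
      show "2 \<le> X ^ A" using XA X by simp
      show "\<forall>\<kappa>\<in>F. 1 \<le> N \<kappa> \<and> (X ^ A) ^ C2 \<le> real (N \<kappa>)"
        unfolding power_mult[symmetric] using N large[of "A * C2"] by (auto simp: C_def)
      have "e * (X ^ A) ^ C2 \<le> X ^ (k * C1) * \<epsilon> * (X ^ A) ^ C2" using e_le X by (intro mult_right_mono) auto
      also have "\<dots> = \<epsilon> * X ^ (k * C1 + A * C2)" by (simp add: power_add power_mult)
      also have "\<dots> \<le> 1" by (rule small) (simp add: C_def A_def)
      finally show "e * (X ^ A) ^ C2 \<le> 1" .
      show "H \<subseteq> boxfun F ?B" by (auto simp: H_def)
      have "P / X ^ A \<le> P / X ^ 4" using P X by (intro divide_left_mono pm) (auto simp: A_def)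
      then show "(\<Prod>\<kappa>\<in>F. real (N \<kappa>)) / X ^ A \<le> card H" using cH by (simp add: P_def)
      show "\<forall>t\<in>H. appr (mpoly F d (\<lambda>n. c (n(\<mu> := i))) t) (X ^ A) e"
      proof
        fix t assume "t \<in> H"
        from coef[OF this] show "appr (mpoly F d (\<lambda>n. c (n(\<mu> := i))) t) (X ^ A) e"
          by (rule appr_mono) (use pm[of "k * C1" A] in \<open>auto simp: A_def\<close>)
      qed
    qed
    have r2: "m(\<mu> := i) = n" by (simp add: m_def i_def)
    have r3: "(X ^ A) ^ C2 * e / (\<Prod>\<kappa>\<in>F. real (N \<kappa>) ^ m \<kappa>)
        \<le> X ^ C * \<epsilon> / (\<Prod>\<kappa>\<in>insert \<mu> F. real (N \<kappa>) ^ n \<kappa>)"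
    proof -
      have "(\<Prod>\<kappa>\<in>F. real (N \<kappa>) ^ m \<kappa>) = (\<Prod>\<kappa>\<in>F. real (N \<kappa>) ^ n \<kappa>)"
        by (rule prod.cong) (use insert(2) in \<open>auto simp: m_def\<close>)
      then have "(X ^ A) ^ C2 * e / (\<Prod>\<kappa>\<in>F. real (N \<kappa>) ^ m \<kappa>)
          = X ^ (A * C2 + k * C1) * \<epsilon> / (\<Prod>\<kappa>\<in>insert \<mu> F. real (N \<kappa>) ^ n \<kappa>)"
        using insert(1,2) by (simp add: e_def i_def power_add power_mult)
      also have "\<dots> \<le> X ^ C * \<epsilon> / (\<Prod>\<kappa>\<in>insert \<mu> F. real (N \<kappa>) ^ n \<kappa>)"
        using eps by (intro divide_right_mono mult_right_mono pm prod_nonneg) (auto simp: C_def A_def)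
      finally show ?thesis .
    qed
    have r4: "(X ^ A) ^ C2 \<le> X ^ C" unfolding power_mult[symmetric] by (intro pm) (simp add: C_def)
    show "appr (c n) (X ^ C) (X ^ C * \<epsilon> / (\<Prod>\<kappa>\<in>insert \<mu> F. real (N \<kappa>) ^ n \<kappa>))"
      using appr_mono[OF r1 r4 r3] unfolding r2 .
  qed
qed

section \<open>Multidimensional pieces and their active coefficients\<close>

definition dyadic_sum :: "'k set \<Rightarrow> nat \<Rightarrow> ('k \<Rightarrow> nat) \<Rightarrow> (('k \<Rightarrow> nat) \<Rightarrow> real) \<Rightarrow> ('k \<Rightarrow> nat) \<Rightarrow> complex" where
  "dyadic_sum F d M c j = (\<Sum>t\<in>boxfun F (\<lambda>\<kappa>. dyadic (M \<kappa>) (j \<kappa>)). echar (mpoly F d c t) / of_int (\<Prod>\<kappa>\<in>F. t \<kappa>))"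

text \<open>Up to bounded factors, the size of the monomial with exponent n on the piece j.\<close>

definition weight :: "'k set \<Rightarrow> ('k \<Rightarrow> nat) \<Rightarrow> ('k \<Rightarrow> nat) \<Rightarrow> real" where
  "weight F j n = (\<Prod>\<kappa>\<in>F. (2 ^ j \<kappa>) ^ n \<kappa>)"

text \<open>The distance of x to a fraction is visible on the scale W but not large there. A
  coefficient above the upper bound would make the sum small by Weyl's theorem; one below the lower
  bound behaves like the fraction itself.\<close>

definition active :: "real \<Rightarrow> real \<Rightarrow> real \<Rightarrow> bool" where
  "active x Y W \<longleftrightarrow> (\<exists>q a. 1 \<le> q \<and> real q \<le> Y \<and> 1 / Y \<le> \<bar>x - of_int a / real q\<bar> * W \<and> \<bar>x - of_int a / real q\<bar> * W \<le> Y)"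

lemma dyadic_sum_insert:
  assumes "finite F" "\<mu> \<notin> F"
  shows "dyadic_sum (insert \<mu> F) d M c j = (\<Sum>s\<in>dyadic (M \<mu>) (j \<mu>). dyadic_sum F d M (slice d c \<mu> s) j / of_int s)"
    and "dyadic_sum (insert \<mu> F) d M c j = (\<Sum>t\<in>boxfun F (\<lambda>\<kappa>. dyadic (M \<kappa>) (j \<kappa>)).
      (\<Sum>s\<in>dyadic (M \<mu>) (j \<mu>). echar (polyval d (\<lambda>i. mpoly F d (\<lambda>n. c (n(\<mu> := i))) t) s) / of_int s) / of_int (\<Prod>\<kappa>\<in>F. t \<kappa>))"
proof -
  have P: "(\<Prod>\<kappa>\<in>insert \<mu> F. (t(\<mu> := s)) \<kappa>) = s * (\<Prod>\<kappa>\<in>F. t \<kappa>)" for t :: "'a \<Rightarrow> int" and s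
  proof -
    have "(\<Prod>\<kappa>\<in>F. (t(\<mu> := s)) \<kappa>) = (\<Prod>\<kappa>\<in>F. t \<kappa>)"
      by (rule prod.cong) (use assms(2) in auto)
    then show ?thesis using assms by simp
  qed
  have 1: "dyadic_sum (insert \<mu> F) d M c j = (\<Sum>t\<in>boxfun F (\<lambda>\<kappa>. dyadic (M \<kappa>) (j \<kappa>)).
      \<Sum>s\<in>dyadic (M \<mu>) (j \<mu>). echar (mpoly (insert \<mu> F) d c (t(\<mu> := s))) / of_int (s * (\<Prod>\<kappa>\<in>F. t \<kappa>)))"
    unfolding dyadic_sum_def by (subst sum_boxfun_insert[OF assms(2)]) (simp only: P)
  show "dyadic_sum (insert \<mu> F) d M c j = (\<Sum>t\<in>boxfun F (\<lambda>\<kappa>. dyadic (M \<kappa>) (j \<kappa>)).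
      (\<Sum>s\<in>dyadic (M \<mu>) (j \<mu>). echar (polyval d (\<lambda>i. mpoly F d (\<lambda>n. c (n(\<mu> := i))) t) s) / of_int s) / of_int (\<Prod>\<kappa>\<in>F. t \<kappa>))"
    unfolding 1 unfolding mpoly_insert(2)[OF assms] sum_divide_distrib by simp
  show "dyadic_sum (insert \<mu> F) d M c j = (\<Sum>s\<in>dyadic (M \<mu>) (j \<mu>). dyadic_sum F d M (slice d c \<mu> s) j / of_int s)"
    unfolding 1 unfolding mpoly_insert(1)[OF assms] dyadic_sum_def sum_divide_distrib
    by (subst sum.swap) (simp add: mult.commute)
qed

lemma dyadic_sum_empty: "norm (dyadic_sum {} d M c j) = 1"
  by (simp add: dyadic_sum_def)

lemma norm_dyadic_weighted_sum:
  fixes f :: "int \<Rightarrow> complex"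
  shows "norm (\<Sum>s\<in>dyadic M j. f s / of_int s) \<le> (\<Sum>s\<in>dyadic M j. norm (f s)) / 2 ^ j"
proof -
  have "norm (\<Sum>s\<in>dyadic M j. f s / of_int s) \<le> (\<Sum>s\<in>dyadic M j. norm (f s) / 2 ^ j)"
  proof (rule sum_norm_le)
    fix s assume "s \<in> dyadic M j"
    then have "1 / real_of_int \<bar>s\<bar> \<le> 1 / 2 ^ j" by (rule norm_dyadic_inverse)
    then have "norm (f s) * (1 / real_of_int \<bar>s\<bar>) \<le> norm (f s) * (1 / 2 ^ j)" by (intro mult_left_mono) auto
    then show "norm (f s / of_int s) \<le> norm (f s) / 2 ^ j" by (simp add: norm_divide)
  qed
  then show ?thesis by (simp add: sum_divide_distrib)
qed

lemma norm_dyadic_sum_slice: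
  assumes "finite F" "\<mu> \<notin> F"
  shows "norm (dyadic_sum (insert \<mu> F) d M c j) \<le> (\<Sum>s\<in>dyadic (M \<mu>) (j \<mu>). norm (dyadic_sum F d M (slice d c \<mu> s) j)) / 2 ^ j \<mu>"
  unfolding dyadic_sum_insert(1)[OF assms] by (rule norm_dyadic_weighted_sum)

lemma norm_dyadic_sum_le:
  assumes "finite F"
  shows "norm (dyadic_sum F d M c j) \<le> 2 ^ card F"
  using assms
proof (induction F arbitrary: c rule: finite_induct)
  case empty
  then show ?case by (simp add: dyadic_sum_empty)
next
  case (insert \<mu> F)
  have "norm (dyadic_sum (insert \<mu> F) d M c j) \<le> (\<Sum>s\<in>dyadic (M \<mu>) (j \<mu>). norm (dyadic_sum F d M (slice d c \<mu> s) j)) / 2 ^ j \<mu>"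
    by (rule norm_dyadic_sum_slice[OF insert(1,2)])
  also have "\<dots> \<le> (\<Sum>s\<in>dyadic (M \<mu>) (j \<mu>). 2 ^ card F) / 2 ^ j \<mu>"
    by (intro divide_right_mono sum_mono insert.IH) auto
  also have "\<dots> = real (card (dyadic (M \<mu>) (j \<mu>))) * (2 ^ card F / 2 ^ j \<mu>)" by simp
  also have "\<dots> \<le> real (2 * 2 ^ j \<mu>) * (2 ^ card F / 2 ^ j \<mu>)"
    using card_dyadic[of "M \<mu>" "j \<mu>"] by (intro mult_right_mono) (auto simp del: of_nat_mult of_nat_power)
  also have "\<dots> = 2 ^ card (insert \<mu> F)" using insert by simp
  finally show ?case .
qed

lemma weight_insert:
  assumes "finite F" "\<mu> \<notin> F"
  shows "weight (insert \<mu> F) j (n(\<mu> := l)) = (2 ^ j \<mu>) ^ l * weight F j n"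
proof -
  have "weight F j (n(\<mu> := l)) = weight F j n"
    unfolding weight_def by (rule prod.cong) (use assms(2) in auto)
  then show ?thesis using assms by (simp add: weight_def)
qed

lemma weight_pos: "0 < weight F j n"
  by (simp add: weight_def prod_pos)

lemma card_boxfun_dyadic:
  assumes "finite F"
  shows "real (card (boxfun F (\<lambda>\<kappa>. dyadic (M \<kappa>) (j \<kappa>)))) \<le> 2 ^ card F * (\<Prod>\<kappa>\<in>F. 2 ^ j \<kappa>)"
proof -
  have "real (card (boxfun F (\<lambda>\<kappa>. dyadic (M \<kappa>) (j \<kappa>)))) = (\<Prod>\<kappa>\<in>F. real (card (dyadic (M \<kappa>) (j \<kappa>))))"
    using assms by (simp add: card_boxfun)
  also have "\<dots> \<le> (\<Prod>\<kappa>\<in>F. 2 * 2 ^ j \<kappa>)"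
  proof (rule prod_mono, intro conjI)
    fix \<kappa>
    show "real (card (dyadic (M \<kappa>) (j \<kappa>))) \<le> 2 * 2 ^ j \<kappa>"
      using card_dyadic[of "M \<kappa>" "j \<kappa>"] by (metis of_nat_le_iff of_nat_mult of_nat_numeral of_nat_power)
  qed simp
  finally show ?thesis by (simp add: prod.distrib)
qed

text \<open>For many t the inner sum over the variable \<open>\<nu>\<close> is large, so its
  coefficients, which are polynomials in t, are nearly rational, and with them all c n with n \<nu>
  \<ge> 1. If none of those with odd n \<nu> were active, they would be so close to fractions that
  every inner sum is small by cancellation.\<close>

lemma active_coefficient:
  assumes F: "finite F" and \<nu>: "\<nu> \<notin> F"
  shows "\<exists>C. \<forall>X M c j. X \<ge> 2 \<and> (\<forall>\<kappa>\<in>insert \<nu> F. X ^ C \<le> 2 ^ j \<kappa>) \<and> 1 / X \<le> norm (dyadic_sum (insert \<nu> F) d M c j)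
    \<longrightarrow> (\<exists>n\<in>exponents (insert \<nu> F) d. odd (n \<nu>) \<and> c n \<noteq> 0 \<and> active (c n) (X ^ C) (weight (insert \<nu> F) j n))"
proof -
  obtain C1 where W: "\<And>X c M j l. X \<ge> 2 \<Longrightarrow> 1 / X \<le> norm (\<Sum>s\<in>dyadic M j. echar (polyval d c s) / of_int s)
    \<Longrightarrow> 1 \<le> l \<Longrightarrow> l \<le> d \<Longrightarrow> appr (c l) (X ^ C1) (X ^ C1 / (2 ^ j) ^ l)"
    using weyl_converse_dyadic[of d] by meson
  obtain C2 where NI: "\<And>X N \<epsilon> G c n. X \<ge> 2 \<Longrightarrow> \<forall>\<kappa>\<in>F. 1 \<le> N \<kappa> \<and> X ^ C2 \<le> real (N \<kappa>) \<Longrightarrow> \<epsilon> \<ge> 0 \<Longrightarrow> \<epsilon> * X ^ C2 \<le> 1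
      \<Longrightarrow> G \<subseteq> boxfun F (\<lambda>\<kappa>. {- int (N \<kappa>)..int (N \<kappa>)}) \<Longrightarrow> (\<Prod>\<kappa>\<in>F. real (N \<kappa>)) / X \<le> card G
      \<Longrightarrow> \<forall>t\<in>G. appr (mpoly F d c t) X \<epsilon> \<Longrightarrow> n \<in> exponents F d
      \<Longrightarrow> appr (c n) (X ^ C2) (X ^ C2 * \<epsilon> / (\<Prod>\<kappa>\<in>F. real (N \<kappa>) ^ n \<kappa>))"
    by (rule exE[OF rational_mpoly_approximation[OF F, of d]], rule that, elim allE, erule impE, (intro conjI; assumption), erule (1) bspec)
  define k where "k = card F"
  define m where "m = card (exponents (insert \<nu> F) d)"
  \<comment> \<open>Inner sums below 1 / X ^ p contribute at most P / X ^ 2 in total, half of the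
    available P / X.\<close>
  define p where "p = k + 2"
  define A where "A = p * C1 + k + 4"
  define B where "B = A * C2 + A"
  define r where "r = m + k * d"
  define E where "E = 5 + 2 * (d + 1) + 2 * d + B * m + B + r + 1"
  \<comment> \<open>E is the loss of the cancellation estimate and k that of the summation over t;
    the surplus 2 brings the piece down to 1 / X ^ 2, below 1 / X.\<close>
  define C where "C = k + E + 2 + B * (m + 1)"
  show ?thesis
  proof (intro exI[of _ C] allI impI, elim conjE)
    fix X :: real and M c j
    assume X: "X \<ge> 2" and N: "\<forall>\<kappa>\<in>insert \<nu> F. X ^ C \<le> 2 ^ j \<kappa>"
      and big: "1 / X \<le> norm (dyadic_sum (insert \<nu> F) d M c j)"
    have X1: "1 \<le> X" using X by simp
    have pm: "X ^ a \<le> X ^ b" if "a \<le> b" for a b using X1 that by (rule power_increasing[rotated])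
    have large: "X ^ a \<le> 2 ^ j \<kappa>" if "a \<le> C" "\<kappa> \<in> insert \<nu> F" for a \<kappa>
      using N pm[OF that(1)] that(2) by fastforce
    have "1 \<le> p" "1 \<le> A" by (simp_all add: p_def A_def)
    then have Xp: "X \<le> X ^ p" and XA: "X \<le> X ^ A" using pm[of 1 p] pm[of 1 A] by simp_all
    let ?B = "\<lambda>\<kappa>. dyadic (M \<kappa>) (j \<kappa>)"
    define box where "box = boxfun F ?B"
    define P where "P = (\<Prod>\<kappa>\<in>F. (2::real) ^ j \<kappa>)"
    define cf where "cf t l = mpoly F d (\<lambda>n. c (n(\<nu> := l))) t" for t l
    define inner where "inner t = (\<Sum>s\<in>dyadic (M \<nu>) (j \<nu>). echar (polyval d (cf t) s) / of_int s)" for t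
    have P: "1 \<le> P" unfolding P_def by (intro prod_ge_1) auto
    have finbox: "finite box" unfolding box_def using F by (intro finite_boxfun) auto
    have cbox: "real (card box) \<le> X ^ k * P"
    proof -
      have "real (card box) \<le> 2 ^ k * P" unfolding box_def k_def P_def by (rule card_boxfun_dyadic[OF F])
      also have "\<dots> \<le> X ^ k * P" using two_power_le[OF X, of k] P by (intro mult_right_mono) auto
      finally show ?thesis .
    qed
    have prod_ge: "P \<le> \<bar>real_of_int (\<Prod>\<kappa>\<in>F. t \<kappa>)\<bar>" if t: "t \<in> box" for t
    proof -
      have "P \<le> (\<Prod>\<kappa>\<in>F. real_of_int \<bar>t \<kappa>\<bar>)" unfolding P_def
      proof (rule prod_mono, intro conjI)
        fix \<kappa> assume "\<kappa> \<in> F"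
        then have "2 ^ j \<kappa> \<le> \<bar>t \<kappa>\<bar>" using t unfolding box_def by (auto simp: boxfun_def dyadic_def)
        then have "real_of_int (2 ^ j \<kappa>) \<le> real_of_int \<bar>t \<kappa>\<bar>" by (rule of_int_le_iff[THEN iffD2])
        then show "2 ^ j \<kappa> \<le> real_of_int \<bar>t \<kappa>\<bar>" by simp
      qed simp
      then show ?thesis by (simp add: abs_prod)
    qed
    have DS: "norm (dyadic_sum (insert \<nu> F) d M c j) \<le> (\<Sum>t\<in>box. norm (inner t)) / P"
    proof -
      have "dyadic_sum (insert \<nu> F) d M c j = (\<Sum>t\<in>box. inner t / of_int (\<Prod>\<kappa>\<in>F. t \<kappa>))"
        unfolding dyadic_sum_insert(2)[OF F \<nu>] box_def inner_def cf_def ..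
      also have "norm \<dots> \<le> (\<Sum>t\<in>box. norm (inner t) / P)"
      proof (rule sum_norm_le)
        fix t assume "t \<in> box"
        then show "norm (inner t / of_int (\<Prod>\<kappa>\<in>F. t \<kappa>)) \<le> norm (inner t) / P"
          unfolding norm_divide norm_of_int using P prod_ge[of t] by (intro divide_left_mono mult_pos_pos) (linarith | simp)+
      qed
      finally show ?thesis by (simp add: sum_divide_distrib)
    qed
    have rat: "appr (c n) (X ^ B) (X ^ B / weight (insert \<nu> F) j n)" if n: "n \<in> exponents (insert \<nu> F) d" "1 \<le> n \<nu>" for n
    proof -
      define l where "l = n \<nu>"
      define n' where "n' = n(\<nu> := 0)"
      have n': "n' \<in> exponents F d" unfolding n'_def using n(1) \<nu> by (rule boxfun_restrict)
      have l: "1 \<le> l" "l \<le> d" using n boxfunD[OF n(1), of \<nu>] by (auto simp: l_def)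
      have nn: "n'(\<nu> := l) = n" by (simp add: n'_def l_def)
      define H where "H = {t\<in>box. 1 / X ^ p \<le> norm (inner t)}"
      have "P / X \<le> (\<Sum>t\<in>box. norm (inner t))"
      proof -
        have "1 / X \<le> (\<Sum>t\<in>box. norm (inner t)) / P" using big DS by linarith
        then show ?thesis using P X by (simp add: field_simps)
      qed
      moreover have "(\<Sum>t\<in>box. norm (inner t)) - 1 / X ^ p * card box \<le> 2 * real (card H)"
        unfolding H_def
      proof (rule popular[OF finbox])
        fix t
        have "norm (inner t) \<le> (\<Sum>s\<in>dyadic (M \<nu>) (j \<nu>). norm (echar (polyval d (cf t) s))) / 2 ^ j \<nu>"
          unfolding inner_def by (rule norm_dyadic_weighted_sum)
        also have "\<dots> = real (card (dyadic (M \<nu>) (j \<nu>))) / 2 ^ j \<nu>" by simp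
        also have "\<dots> \<le> real (2 * 2 ^ j \<nu>) / 2 ^ j \<nu>"
          using card_dyadic[of "M \<nu>" "j \<nu>"] by (intro divide_right_mono) (auto simp del: of_nat_mult of_nat_power)
        finally show "norm (inner t) \<le> 2" by simp
      qed (use X in auto)
      moreover have "1 / X ^ p * card box \<le> P / (X * X)"
      proof -
        have "1 / X ^ p * card box \<le> 1 / X ^ p * (X ^ k * P)" using cbox X by (intro mult_left_mono) auto
        also have "\<dots> = P / (X * X)" using X by (simp add: p_def power_add power2_eq_square)
        finally show ?thesis .
      qed
      moreover have "P / (X * X) \<le> P / (2 * X)" using X P by (intro divide_left_mono mult_right_mono) auto
      moreover have "P / X = 2 * (P / (2 * X))" by simp
      ultimately have "P / (2 * X) \<le> 2 * real (card H)" by argo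
      then have H4: "P / (4 * X) \<le> card H" by simp
      have "4 * X \<le> X ^ 3"
        using absorb_const[OF X, of 4 2 X] X by (simp add: power2_eq_square power3_eq_cube)
      then have "P / X ^ 3 \<le> P / (4 * X)" using X P by (intro divide_left_mono) auto
      then have cH: "P / X ^ 3 \<le> card H" using H4 by linarith
      define \<epsilon> where "\<epsilon> = (X ^ p) ^ C1 / (2 ^ j \<nu>) ^ l"
      have eps: "0 \<le> \<epsilon>" using X by (simp add: \<epsilon>_def)
      have ap: "appr (cf t l) ((X ^ p) ^ C1) \<epsilon>" if t: "t \<in> H" for t
        unfolding \<epsilon>_def
      proof (rule W[OF _ _ l])
        show "2 \<le> X ^ p" using Xp X by simp
        show "1 / X ^ p \<le> norm (\<Sum>s\<in>dyadic (M \<nu>) (j \<nu>). echar (polyval d (cf t) s) / of_int s)"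
          using t by (simp add: H_def inner_def)
      qed
      have "appr (c (n'(\<nu> := l))) ((X ^ A) ^ C2) ((X ^ A) ^ C2 * \<epsilon> / (\<Prod>\<kappa>\<in>F. real (2 ^ (j \<kappa> + 1)) ^ n' \<kappa>))"
      proof (rule NI[where G=H and c="\<lambda>n. c (n(\<nu> := l))", OF _ _ eps _ _ _ _ n'])
        show "2 \<le> X ^ A" using XA X by simp
        have "(X ^ A) ^ C2 \<le> real (2 ^ (j \<kappa> + 1))" if "\<kappa> \<in> F" for \<kappa>
        proof -
          have "(X ^ A) ^ C2 \<le> 2 ^ j \<kappa>" unfolding power_mult[symmetric] using that
            by (intro large) (auto simp: C_def B_def)
          also have "(2::real) ^ j \<kappa> \<le> real (2 ^ (j \<kappa> + 1))" by simp
          finally show ?thesis .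
        qed
        then show "\<forall>\<kappa>\<in>F. 1 \<le> (2::nat) ^ (j \<kappa> + 1) \<and> (X ^ A) ^ C2 \<le> real (2 ^ (j \<kappa> + 1))" by simp
        show "\<epsilon> * (X ^ A) ^ C2 \<le> 1"
        proof -
          have "(X ^ p) ^ C1 * (X ^ A) ^ C2 = X ^ (p * C1 + A * C2)" by (simp add: power_add power_mult)
          also have "\<dots> \<le> 2 ^ j \<nu>" by (rule large) (simp_all add: C_def B_def A_def)
          also have "\<dots> \<le> (2 ^ j \<nu>) ^ l" using l power_increasing[of 1 l "(2::real) ^ j \<nu>"] by simp
          finally have "(X ^ p) ^ C1 * (X ^ A) ^ C2 \<le> (2 ^ j \<nu>) ^ l" .
          moreover have "\<epsilon> * (X ^ A) ^ C2 = ((X ^ p) ^ C1 * (X ^ A) ^ C2) / (2 ^ j \<nu>) ^ l" by (simp add: \<epsilon>_def)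
          moreover have "0 < ((2::real) ^ j \<nu>) ^ l" by simp
          ultimately show ?thesis by (simp only: divide_le_eq_1_pos)
        qed
        show "H \<subseteq> boxfun F (\<lambda>\<kappa>. {- int (2 ^ (j \<kappa> + 1))..int (2 ^ (j \<kappa> + 1))})"
        proof
          fix t assume "t \<in> H"
          then have t: "t \<in> boxfun F ?B" by (simp add: H_def box_def)
          show "t \<in> boxfun F (\<lambda>\<kappa>. {- int (2 ^ (j \<kappa> + 1))..int (2 ^ (j \<kappa> + 1))})"
            unfolding boxfun_def mem_Collect_eq
          proof (intro conjI ballI allI impI)
            fix \<kappa> assume "\<kappa> \<in> F"
            then show "t \<kappa> \<in> {- int (2 ^ (j \<kappa> + 1))..int (2 ^ (j \<kappa> + 1))}"
              using boxfunD[OF t] dyadic_subset by blast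
          next
            fix \<kappa> assume "\<kappa> \<notin> F"
            then show "t \<kappa> = 0" by (rule boxfun_off[OF t])
          qed
        qed
        have e1: "(\<Prod>\<kappa>\<in>F. real (2 ^ (j \<kappa> + 1))) = 2 ^ k * P" by (simp add: P_def k_def prod.distrib)
        have e2: "2 ^ k * P / X ^ A \<le> P / X ^ 3"
        proof -
          have "2 ^ k * X ^ 3 \<le> X ^ k * X ^ 3" using two_power_le[OF X, of k] X by (intro mult_right_mono) auto
          also have "\<dots> \<le> X ^ A" unfolding power_add[symmetric] by (intro pm) (simp add: A_def)
          finally have "P * (2 ^ k * X ^ 3) \<le> P * X ^ A" using P by (intro mult_left_mono) auto
          then show ?thesis using X by (simp add: divide_simps mult_ac)
        qed
        show "(\<Prod>\<kappa>\<in>F. real (2 ^ (j \<kappa> + 1))) / X ^ A \<le> card H"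
          unfolding e1 by (rule order_trans[OF e2 cH])
        show "\<forall>t\<in>H. appr (mpoly F d (\<lambda>n. c (n(\<nu> := l))) t) (X ^ A) \<epsilon>"
        proof
          fix t assume "t \<in> H"
          have pA: "(X ^ p) ^ C1 \<le> X ^ A" unfolding power_mult[symmetric] by (intro pm) (simp add: A_def)
          show "appr (mpoly F d (\<lambda>n. c (n(\<nu> := l))) t) (X ^ A) \<epsilon>"
            using appr_mono[OF ap[OF \<open>t \<in> H\<close>] pA order_refl] unfolding cf_def .
        qed
      qed
      then have ap': "appr (c n) (X ^ (A * C2)) (X ^ (A * C2) * \<epsilon> / (\<Prod>\<kappa>\<in>F. real (2 ^ (j \<kappa> + 1)) ^ n' \<kappa>))"
        unfolding nn power_mult .
      have w: "weight (insert \<nu> F) j n = (2 ^ j \<nu>) ^ l * weight F j n'" using weight_insert[OF F \<nu>, of j n' l] by (simp add: nn)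
      show ?thesis
      proof (rule appr_mono[OF ap'])
        show "X ^ (A * C2) \<le> X ^ B" by (intro pm) (simp add: B_def)
        have "X ^ (A * C2) * \<epsilon> / (\<Prod>\<kappa>\<in>F. real (2 ^ (j \<kappa> + 1)) ^ n' \<kappa>) \<le> X ^ (A * C2) * \<epsilon> / weight F j n'"
        proof (rule divide_left_mono)
          show "weight F j n' \<le> (\<Prod>\<kappa>\<in>F. real (2 ^ (j \<kappa> + 1)) ^ n' \<kappa>)"
            unfolding weight_def by (intro prod_mono) (auto intro!: power_mono)
          then show "0 < (\<Prod>\<kappa>\<in>F. real (2 ^ (j \<kappa> + 1)) ^ n' \<kappa>) * weight F j n'"
            using weight_pos[of F j n'] by (intro mult_pos_pos) linarith+
        qed (use X eps in simp)
        also have "\<dots> = X ^ (A * C2 + p * C1) / weight (insert \<nu> F) j n"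
          unfolding w \<epsilon>_def power_mult[symmetric] by (simp add: power_add)
        also have "\<dots> \<le> X ^ B / weight (insert \<nu> F) j n"
          using weight_pos[of "insert \<nu> F" j n] by (intro divide_right_mono pm) (simp_all add: B_def A_def)
        finally show "X ^ (A * C2) * \<epsilon> / (\<Prod>\<kappa>\<in>F. real (2 ^ (j \<kappa> + 1)) ^ n' \<kappa>) \<le> X ^ B / weight (insert \<nu> F) j n" .
      qed
    qed
    show "\<exists>n\<in>exponents (insert \<nu> F) d. odd (n \<nu>) \<and> c n \<noteq> 0 \<and> active (c n) (X ^ C) (weight (insert \<nu> F) j n)"
    proof (rule ccontr)
      assume not_active: "\<not> ?thesis"
      define L where "L = {n\<in>exponents (insert \<nu> F) d. 1 \<le> n \<nu> \<and> c n \<noteq> 0}"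
      have finL: "finite L" and cardL: "card L \<le> m"
        unfolding L_def m_def using F by (auto intro!: card_mono finite_exponents finite_subset[of _ "exponents (insert \<nu> F) d"])
      have "\<exists>q a. 1 \<le> q \<and> real q \<le> (X ^ B) ^ card L \<and> (\<forall>n\<in>L. \<bar>c n - of_int (a n) / real q\<bar> \<le> X ^ B / weight (insert \<nu> F) j n)"
        by (rule common_denominator[OF finL]) (auto simp: L_def intro!: rat)
      then obtain q a0 where q: "1 \<le> q" "real q \<le> (X ^ B) ^ card L"
        and a0: "\<forall>n\<in>L. \<bar>c n - of_int (a0 n) / real q\<bar> \<le> X ^ B / weight (insert \<nu> F) j n" by blast
      have qX: "real q \<le> X ^ (B * m)"
      proof -
        have "(X ^ B) ^ card L \<le> X ^ (B * m)" unfolding power_mult[symmetric] using cardL by (intro pm) simp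
        then show ?thesis using q by linarith
      qed
      \<comment> \<open>A vanishing coefficient gets the fraction 0 and thus no error, as the
        exponent to be found must have c n \<noteq> 0.\<close>
      define a where "a n = (if n \<in> L then a0 n else 0)" for n
      have ev: "\<bar>c n - of_int (a n) / real q\<bar> \<le> X ^ B / weight (insert \<nu> F) j n"
        if "n \<in> exponents (insert \<nu> F) d" "1 \<le> n \<nu>" for n
        using a0 that weight_pos[of "insert \<nu> F" j n] X by (auto simp: a_def L_def)
      \<comment> \<open>The upper bound in \<open>active\<close> holds for all these coefficients
        already, so failing to be active means falling below the lower bound.\<close>
      have od: "\<bar>c n - of_int (a n) / real q\<bar> \<le> 1 / X ^ C / weight (insert \<nu> F) j n"
        if n: "n \<in> exponents (insert \<nu> F) d" "odd (n \<nu>)" for n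
      proof (cases "c n = 0")
        case True
        then show ?thesis using weight_pos[of "insert \<nu> F" j n] X by (simp add: a_def L_def)
      next
        case False
        have n1: "1 \<le> n \<nu>" using n(2) by (cases "n \<nu>") auto
        have qC: "real q \<le> X ^ C" using qX pm[of "B * m" C] by (simp add: C_def)
        have "\<bar>c n - of_int (a n) / real q\<bar> * weight (insert \<nu> F) j n \<le> X ^ B"
          using ev[OF n(1) n1] weight_pos[of "insert \<nu> F" j n] by (simp add: field_simps)
        also have "\<dots> \<le> X ^ C" by (intro pm) (simp add: C_def)
        finally have "\<not> 1 / X ^ C \<le> \<bar>c n - of_int (a n) / real q\<bar> * weight (insert \<nu> F) j n"
          using not_active n False q(1) qC unfolding active_def by blast
        then have "\<bar>c n - of_int (a n) / real q\<bar> * weight (insert \<nu> F) j n \<le> 1 / X ^ C" by linarith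
        then show ?thesis by (simp only: pos_le_divide_eq[OF weight_pos])
      qed
      have small: "norm (inner t) \<le> X ^ E / X ^ C" if t: "t \<in> box" for t
      proof -
        define b where "b l = (\<Sum>n\<in>exponents F d. a (n(\<nu> := l)) * (\<Prod>\<kappa>\<in>F. t \<kappa> ^ n \<kappa>))" for l
        have tpow: "\<bar>\<Prod>\<kappa>\<in>F. real_of_int (t \<kappa>) ^ n \<kappa>\<bar> \<le> X ^ (k * d) * weight F j n" if n: "n \<in> exponents F d" for n
        proof -
          have "\<bar>\<Prod>\<kappa>\<in>F. real_of_int (t \<kappa>) ^ n \<kappa>\<bar> = (\<Prod>\<kappa>\<in>F. \<bar>real_of_int (t \<kappa>)\<bar> ^ n \<kappa>)" by (simp add: abs_prod power_abs)
          also have "\<dots> \<le> (\<Prod>\<kappa>\<in>F. X ^ d * (2 ^ j \<kappa>) ^ n \<kappa>)"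
          proof (rule prod_mono, intro conjI)
            fix \<kappa> assume \<kappa>: "\<kappa> \<in> F"
            then have "\<bar>t \<kappa>\<bar> < 2 ^ (j \<kappa> + 1)" using t unfolding box_def by (auto simp: boxfun_def dyadic_def)
            then have "real_of_int \<bar>t \<kappa>\<bar> \<le> real_of_int (2 ^ (j \<kappa> + 1))" by linarith
            then have "\<bar>real_of_int (t \<kappa>)\<bar> ^ n \<kappa> \<le> (2 * 2 ^ j \<kappa>) ^ n \<kappa>" by (intro power_mono) auto
            also have "\<dots> = 2 ^ n \<kappa> * (2 ^ j \<kappa>) ^ n \<kappa>" by (simp add: power_mult_distrib)
            also have "\<dots> \<le> X ^ d * (2 ^ j \<kappa>) ^ n \<kappa>"
              using two_power_le[OF X, of "n \<kappa>"] pm[of "n \<kappa>" d] boxfunD[OF n \<kappa>] by (intro mult_right_mono) auto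
            finally show "\<bar>real_of_int (t \<kappa>)\<bar> ^ n \<kappa> \<le> X ^ d * (2 ^ j \<kappa>) ^ n \<kappa>" .
          qed simp
          also have "\<dots> = X ^ (k * d) * weight F j n"
            by (simp add: prod.distrib weight_def k_def power_mult[symmetric] mult.commute)
          finally show ?thesis .
        qed
        have cards: "card (exponents F d) \<le> m"
        proof -
          have "card (exponents F d) \<le> card (exponents F d) * card {..d}" by simp
          then show ?thesis unfolding m_def card_boxfun[OF finite.insertI[OF F]] card_boxfun[OF F] using F \<nu> by simp
        qed
        have gen: "\<bar>cf t l - of_int (b l) / real q\<bar> \<le> X ^ r * Z / (2 ^ j \<nu>) ^ l"
          if bd: "\<And>n. n \<in> exponents F d \<Longrightarrow> \<bar>c (n(\<nu> := l)) - of_int (a (n(\<nu> := l))) / real q\<bar> \<le> Z / weight (insert \<nu> F) j (n(\<nu> := l))" and Z: "0 \<le> Z" for l Z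
        proof -
          have "cf t l - of_int (b l) / real q
              = (\<Sum>n\<in>exponents F d. (c (n(\<nu> := l)) - of_int (a (n(\<nu> := l))) / real q) * (\<Prod>\<kappa>\<in>F. real_of_int (t \<kappa>) ^ n \<kappa>))"
            by (simp add: cf_def b_def mpoly_def left_diff_distrib sum_subtractf sum_divide_distrib)
          also have "\<bar>\<dots>\<bar> \<le> (\<Sum>n\<in>exponents F d. X ^ (k * d) * Z / (2 ^ j \<nu>) ^ l)"
          proof (rule order_trans[OF sum_abs sum_mono])
            fix n assume n: "n \<in> exponents F d"
            have "\<bar>c (n(\<nu> := l)) - of_int (a (n(\<nu> := l))) / real q\<bar> * \<bar>\<Prod>\<kappa>\<in>F. real_of_int (t \<kappa>) ^ n \<kappa>\<bar>
                \<le> Z / weight (insert \<nu> F) j (n(\<nu> := l)) * (X ^ (k * d) * weight F j n)"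
              using Z weight_pos[of "insert \<nu> F" j "n(\<nu> := l)"] by (intro mult_mono bd[OF n] tpow[OF n]) auto
            also have "\<dots> = X ^ (k * d) * Z / (2 ^ j \<nu>) ^ l"
              unfolding weight_insert[OF F \<nu>] using weight_pos[of F j n] by simp
            finally show "\<bar>(c (n(\<nu> := l)) - of_int (a (n(\<nu> := l))) / real q) * (\<Prod>\<kappa>\<in>F. real_of_int (t \<kappa>) ^ n \<kappa>)\<bar>
                \<le> X ^ (k * d) * Z / (2 ^ j \<nu>) ^ l" by (simp only: abs_mult)
          qed
          also have "\<dots> = real (card (exponents F d)) * (X ^ (k * d) * Z / (2 ^ j \<nu>) ^ l)" by simp
          also have "\<dots> \<le> X ^ m * (X ^ (k * d) * Z / (2 ^ j \<nu>) ^ l)"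
            using const_le_power[OF X, of m] cards X Z by (intro mult_right_mono) auto
          finally show ?thesis by (simp add: r_def power_add)
        qed
        define Y where "Y = X ^ (r + B)"
        define \<delta> where "\<delta> = X ^ r / X ^ C"
        have "norm (inner t) \<le> 20 * (real d + 1) ^ 2 * 4 ^ d * (real q * Y / 2 ^ j \<nu> + \<delta>)"
          unfolding inner_def
        proof (rule odd_cancellation_dyadic[OF q(1)])
          show "1 \<le> Y" "0 \<le> \<delta>" using X1 by (simp_all add: Y_def \<delta>_def)
          fix l assume l: "1 \<le> l" "l \<le> d"
          have mem: "n(\<nu> := l) \<in> exponents (insert \<nu> F) d" if "n \<in> exponents F d" for n
            using that l(2) by (intro boxfun_upd) auto
          show "\<bar>cf t l - of_int (b l) / real q\<bar> \<le> Y / (2 ^ j \<nu>) ^ l"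
            using gen[of l "X ^ B"] ev[OF mem] l X by (simp add: Y_def power_add)
          assume "odd l"
          then show "\<bar>cf t l - of_int (b l) / real q\<bar> \<le> \<delta> / (2 ^ j \<nu>) ^ l"
            using gen[of l "1 / X ^ C"] od[OF mem] X by (simp add: \<delta>_def)
        qed
        also have "\<dots> \<le> X ^ (5 + 2 * (d + 1) + 2 * d) * (X ^ (B * m + B + r + 1) / X ^ C)"
        proof (rule mult_mono)
          have "(real d + 1) ^ 2 \<le> (X ^ (d + 1)) ^ 2" using const_le_power[OF X, of "d + 1"] by (intro power_mono) auto
          moreover have "(4::real) ^ d \<le> X ^ (2 * d)" using two_power_le[OF X, of "2 * d"] by (simp add: power_mult)
          moreover have "20 \<le> X ^ 5" using two_power_le[OF X, of 5] by simp
          ultimately have "20 * (real d + 1) ^ 2 * 4 ^ d \<le> X ^ 5 * (X ^ (d + 1)) ^ 2 * X ^ (2 * d)"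
            using X by (intro mult_mono) auto
          also have "\<dots> = X ^ (5 + 2 * (d + 1) + 2 * d)" by (simp only: power_add power_mult mult.commute[of 2 "d + 1"])
          finally show "20 * (real d + 1) ^ 2 * 4 ^ d \<le> X ^ (5 + 2 * (d + 1) + 2 * d)" .
          have "real q * Y / 2 ^ j \<nu> \<le> X ^ (B * m) * X ^ (r + B) / X ^ C"
            unfolding Y_def using qX X N by (intro frac_le mult_mono) auto
          also have "\<dots> = X ^ (B * m + B + r) / X ^ C" by (simp add: power_add)
          finally have 1: "real q * Y / 2 ^ j \<nu> \<le> X ^ (B * m + B + r) / X ^ C" .
          have 2: "\<delta> \<le> X ^ (B * m + B + r) / X ^ C" unfolding \<delta>_def using X by (intro divide_right_mono pm) auto
          have "2 * (X ^ (B * m + B + r) / X ^ C) \<le> X * (X ^ (B * m + B + r) / X ^ C)"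
            using X by (intro mult_right_mono) auto
          then show "real q * Y / 2 ^ j \<nu> + \<delta> \<le> X ^ (B * m + B + r + 1) / X ^ C" using 1 2 by simp
          show "0 \<le> real q * Y / 2 ^ j \<nu> + \<delta>" using X by (simp add: Y_def \<delta>_def)
        qed (use X in simp)
        also have "\<dots> = X ^ E / X ^ C"
          by (simp only: E_def times_divide_eq_right power_add[symmetric] add.assoc)
        finally show ?thesis .
      qed
      have "norm (dyadic_sum (insert \<nu> F) d M c j) \<le> (\<Sum>t\<in>box. X ^ E / X ^ C) / P"
        using P by (intro order_trans[OF DS] divide_right_mono sum_mono small) auto
      also have "\<dots> = real (card box) * (X ^ E / X ^ C) / P" by simp
      also have "\<dots> \<le> X ^ k * P * (X ^ E / X ^ C) / P" using cbox X P by (intro divide_right_mono mult_right_mono) auto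
      also have "\<dots> = X ^ (k + E) / X ^ C" using P by (simp add: power_add)
      also have "\<dots> \<le> X ^ (k + E) / X ^ (k + E + 2)" using X by (intro divide_left_mono pm) (auto simp: C_def)
      also have "\<dots> = 1 / (X * X)" using X by (simp add: power_add power2_eq_square)
      also have "\<dots> < 1 / X" using X by (intro divide_strict_left_mono) auto
      finally show False using big by simp
    qed
  qed
qed

subsection \<open>Counting the large dyadic pieces\<close>

text \<open>Modulo 2 the matrix is the identity, so a kernel vector has even entries, and half of it
  is again in the kernel. By descent the entries are divisible by all powers of 2.\<close>

lemma odd_diagonal_kernel:
  fixes A :: "'k \<Rightarrow> 'k \<Rightarrow> int" and \<delta> :: "'k \<Rightarrow> int"
  assumes "finite F" and diag: "\<And>\<nu>. \<nu> \<in> F \<Longrightarrow> odd (A \<nu> \<nu>)"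
    and off: "\<And>\<nu> \<kappa>. \<nu> \<in> F \<Longrightarrow> \<kappa> \<in> F \<Longrightarrow> \<kappa> \<noteq> \<nu> \<Longrightarrow> even (A \<nu> \<kappa>)"
    and ker: "\<And>\<nu>. \<nu> \<in> F \<Longrightarrow> (\<Sum>\<kappa>\<in>F. A \<nu> \<kappa> * \<delta> \<kappa>) = 0"
    and "\<nu> \<in> F"
  shows "\<delta> \<nu> = 0"
proof -
  have "\<exists>\<eta>. (\<forall>\<nu>\<in>F. \<delta> \<nu> = 2 ^ i * \<eta> \<nu>) \<and> (\<forall>\<nu>\<in>F. (\<Sum>\<kappa>\<in>F. A \<nu> \<kappa> * \<eta> \<kappa>) = 0)" for i
  proof (induction i)
    case 0
    then show ?case using ker by (intro exI[of _ \<delta>]) auto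
  next
    case (Suc i)
    then obtain \<eta> where \<eta>: "\<And>\<nu>. \<nu> \<in> F \<Longrightarrow> \<delta> \<nu> = 2 ^ i * \<eta> \<nu>" "\<And>\<nu>. \<nu> \<in> F \<Longrightarrow> (\<Sum>\<kappa>\<in>F. A \<nu> \<kappa> * \<eta> \<kappa>) = 0"
      by blast
    have ev: "even (\<eta> \<nu>)" if \<nu>: "\<nu> \<in> F" for \<nu>
    proof -
      have "A \<nu> \<nu> * \<eta> \<nu> = - (\<Sum>\<kappa>\<in>F - {\<nu>}. A \<nu> \<kappa> * \<eta> \<kappa>)"
        using \<eta>(2)[OF \<nu>] sum.remove[OF assms(1) \<nu>, of "\<lambda>\<kappa>. A \<nu> \<kappa> * \<eta> \<kappa>"] by linarith
      moreover have "even (\<Sum>\<kappa>\<in>F - {\<nu>}. A \<nu> \<kappa> * \<eta> \<kappa>)" using off[OF \<nu>] by (intro dvd_sum) auto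
      ultimately have "even (A \<nu> \<nu> * \<eta> \<nu>)" by simp
      then show ?thesis using diag[OF \<nu>] by simp
    qed
    define \<theta> where "\<theta> \<nu> = \<eta> \<nu> div 2" for \<nu>
    have \<theta>: "\<eta> \<nu> = 2 * \<theta> \<nu>" if "\<nu> \<in> F" for \<nu> using ev[OF that] by (simp add: \<theta>_def)
    have "2 * (\<Sum>\<kappa>\<in>F. A \<nu> \<kappa> * \<theta> \<kappa>) = 0" if "\<nu> \<in> F" for \<nu>
    proof -
      have "2 * (\<Sum>\<kappa>\<in>F. A \<nu> \<kappa> * \<theta> \<kappa>) = (\<Sum>\<kappa>\<in>F. A \<nu> \<kappa> * \<eta> \<kappa>)"
        unfolding sum_distrib_left by (rule sum.cong) (auto simp: \<theta>)
      then show ?thesis using \<eta>(2)[OF that] by simp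
    qed
    then show ?case using \<eta>(1) \<theta> by (intro exI[of _ \<theta>]) auto
  qed
  then have "\<exists>\<eta>. \<delta> \<nu> = 2 ^ nat \<bar>\<delta> \<nu>\<bar> * \<eta>" using \<open>\<nu> \<in> F\<close> by blast
  then obtain \<eta> where \<eta>: "\<delta> \<nu> = 2 ^ nat \<bar>\<delta> \<nu>\<bar> * \<eta>" by blast
  show ?thesis
  proof (rule ccontr)
    assume "\<delta> \<nu> \<noteq> 0"
    then have "\<eta> \<noteq> 0" using \<eta> by auto
    then have "1 \<le> \<bar>\<eta>\<bar>" by linarith
    then have "2 ^ nat \<bar>\<delta> \<nu>\<bar> * 1 \<le> 2 ^ nat \<bar>\<delta> \<nu>\<bar> * \<bar>\<eta>\<bar>" by (intro mult_left_mono) auto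
    also have "\<dots> = \<bar>\<delta> \<nu>\<bar>" by (subst (2) \<eta>) (simp add: abs_mult)
    finally have "int (2 ^ nat \<bar>\<delta> \<nu>\<bar>) \<le> int (nat \<bar>\<delta> \<nu>\<bar>)" by simp
    then show False using less_exp[of "nat \<bar>\<delta> \<nu>\<bar>"] by linarith
  qed
qed

definition dot :: "'k set \<Rightarrow> ('k \<Rightarrow> nat) \<Rightarrow> ('k \<Rightarrow> nat) \<Rightarrow> nat" where
  "dot F n j = (\<Sum>\<kappa>\<in>F. n \<kappa> * j \<kappa>)"

lemma weight_eq_dot: "weight F j n = 2 ^ dot F n j"
  unfolding weight_def dot_def power_sum power_mult[symmetric] by (simp add: mult.commute)

text \<open>An exponent that is odd at \<open>\<nu>\<close> sees the side \<open>\<nu>\<close>, so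
  its scale is large as soon as that side is.\<close>

lemma dot_ge:
  assumes "finite F" "\<nu> \<in> F" "odd (n \<nu>)"
  shows "j \<nu> \<le> dot F n j"
proof -
  have "1 * j \<nu> \<le> n \<nu> * j \<nu>" using assms(3) by (intro mult_right_mono) (auto simp: Suc_le_eq odd_pos)
  also have "\<dots> \<le> dot F n j" unfolding dot_def using assms by (intro member_le_sum) auto
  finally show ?thesis by simp
qed

text \<open>
  The choice of an exponent for each \<open>\<nu>\<close> gives a square matrix that is the identity modulo 2. It has trivial
  kernel, so \<open>j\<close> is determined by the chosen exponents and its positions in their windows.
\<close>

lemma card_windows:
  fixes w :: "('k \<Rightarrow> nat) \<Rightarrow> nat" and L :: nat
  assumes F: "finite F" and \<Lambda>: "finite \<Lambda>"
    and one_odd: "\<And>n \<nu> \<kappa>. n \<in> \<Lambda> \<Longrightarrow> \<nu> \<in> F \<Longrightarrow> \<kappa> \<in> F \<Longrightarrow> odd (n \<nu>) \<Longrightarrow> odd (n \<kappa>) \<Longrightarrow> \<nu> = \<kappa>"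
    and J: "J \<subseteq> {j. (\<forall>\<kappa>. \<kappa> \<notin> F \<longrightarrow> j \<kappa> = 0) \<and> (\<forall>\<nu>\<in>F. \<exists>n\<in>\<Lambda>. odd (n \<nu>) \<and> \<bar>int (dot F n j) - int (w n)\<bar> \<le> int L)}"
  shows "finite J" and "card J \<le> (card \<Lambda> * (2 * L + 1)) ^ card F"
proof -
  have "\<forall>j\<in>J. \<forall>\<nu>\<in>F. \<exists>n. n \<in> \<Lambda> \<and> odd (n \<nu>) \<and> \<bar>int (dot F n j) - int (w n)\<bar> \<le> int L" using J by blast
  then obtain f where f: "\<And>j \<nu>. j \<in> J \<Longrightarrow> \<nu> \<in> F \<Longrightarrow> f j \<nu> \<in> \<Lambda> \<and> odd (f j \<nu> \<nu>) \<and> \<bar>int (dot F (f j \<nu>) j) - int (w (f j \<nu>))\<bar> \<le> int L"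
    by metis
  define T where "T = (SIGMA n:\<Lambda>. {int (w n) - int L..int (w n) + int L})"
  define \<Phi> where "\<Phi> j = (\<lambda>\<nu>\<in>F. (f j \<nu>, int (dot F (f j \<nu>) j)))" for j
  have "\<Phi> j \<in> F \<rightarrow>\<^sub>E T" if "j \<in> J" for j
  proof (rule PiE_I)
    fix \<nu> assume "\<nu> \<in> F"
    then show "\<Phi> j \<nu> \<in> T" using f[OF that, of \<nu>] unfolding \<Phi>_def T_def by (auto simp: abs_le_iff)
  qed (simp add: \<Phi>_def)
  then have sub: "\<Phi> ` J \<subseteq> F \<rightarrow>\<^sub>E T" by blast
  have inj: "inj_on \<Phi> J"
  proof (rule inj_onI)
    fix j j' assume jj: "j \<in> J" "j' \<in> J" and eq: "\<Phi> j = \<Phi> j'"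
    have e: "f j \<nu> = f j' \<nu> \<and> int (dot F (f j \<nu>) j) = int (dot F (f j' \<nu>) j')" if "\<nu> \<in> F" for \<nu>
      using fun_cong[OF eq, of \<nu>] that by (auto simp: \<Phi>_def)
    have z: "int (j \<nu>) - int (j' \<nu>) = 0" if \<nu>: "\<nu> \<in> F" for \<nu>
    proof (rule odd_diagonal_kernel[where A="\<lambda>\<nu> \<kappa>. int (f j \<nu> \<kappa>)" and \<delta>="\<lambda>\<nu>. int (j \<nu>) - int (j' \<nu>)", OF F _ _ _ \<nu>])
      fix \<nu> assume \<nu>: "\<nu> \<in> F"
      show "odd (int (f j \<nu> \<nu>))" using f[OF jj(1) \<nu>] by simp
      show "even (int (f j \<nu> \<kappa>))" if "\<kappa> \<in> F" "\<kappa> \<noteq> \<nu>" for \<kappa>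
        using one_odd[of "f j \<nu>" \<nu> \<kappa>] f[OF jj(1) \<nu>] \<nu> that by auto
      have "(\<Sum>\<kappa>\<in>F. int (f j \<nu> \<kappa>) * (int (j \<kappa>) - int (j' \<kappa>))) = int (dot F (f j \<nu>) j) - int (dot F (f j \<nu>) j')"
        by (simp add: dot_def right_diff_distrib sum_subtractf)
      moreover have "dot F (f j \<nu>) j = dot F (f j \<nu>) j'" using e[OF \<nu>] by (metis of_nat_eq_iff)
      ultimately show "(\<Sum>\<kappa>\<in>F. int (f j \<nu> \<kappa>) * (int (j \<kappa>) - int (j' \<kappa>))) = 0" by simp
    qed
    show "j = j'"
    proof
      fix \<kappa> show "j \<kappa> = j' \<kappa>"
      proof (cases "\<kappa> \<in> F")
        case False
        then show ?thesis using subsetD[OF J jj(1)] subsetD[OF J jj(2)] by simp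
      qed (use z in auto)
    qed
  qed
  have finT: "finite T" unfolding T_def using \<Lambda> by auto
  have finP: "finite (F \<rightarrow>\<^sub>E T)" using F finT by (intro finite_PiE) auto
  show "finite J" by (rule inj_on_finite[OF inj sub finP])
  have "card J \<le> card (F \<rightarrow>\<^sub>E T)" by (rule card_inj_on_le[OF inj sub finP])
  also have "\<dots> = card T ^ card F" using F by (simp add: card_PiE)
  also have "card T = card \<Lambda> * (2 * L + 1)"
  proof -
    have "card T = (\<Sum>n\<in>\<Lambda>. card {int (w n) - int L..int (w n) + int L})" unfolding T_def using \<Lambda> by (intro card_SigmaI) auto
    also have "\<dots> = (\<Sum>n\<in>\<Lambda>. 2 * L + 1)" by (rule sum.cong) auto
    finally show ?thesis by simp
  qed
  finally show "card J \<le> (card \<Lambda> * (2 * L + 1)) ^ card F" .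
qed

lemma active_mono:
  assumes "active x Y W" "Y \<le> Y'"
  shows "active x Y' W"
proof -
  obtain q a where q: "1 \<le> q" "real q \<le> Y" "1 / Y \<le> \<bar>x - of_int a / real q\<bar> * W" "\<bar>x - of_int a / real q\<bar> * W \<le> Y"
    using assms(1) unfolding active_def by blast
  have "1 / Y' \<le> 1 / Y" using q assms(2) by (intro divide_left_mono) (auto intro: mult_pos_pos)
  then show ?thesis unfolding active_def using q assms(2) by (intro exI[of _ q] exI[of _ a]) auto
qed

text \<open>By uniqueness of the approximating fraction, an active real determines its scale.\<close>

lemma active_scale:
  assumes act: "active x Y W" and ap: "appr x Y' (\<epsilon> / W')" and W: "0 < W" "0 < W'" "0 \<le> \<epsilon>"
    and big: "Y * Y' * Y < W / 2" "Y * Y' * \<epsilon> < W' / 2"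
  shows "W' \<le> Y * \<epsilon> * W"
proof -
  obtain q a where q: "1 \<le> q" "real q \<le> Y" "1 / Y \<le> \<bar>x - of_int a / real q\<bar> * W" "\<bar>x - of_int a / real q\<bar> * W \<le> Y"
    using act unfolding active_def by blast
  obtain q' a' where q': "1 \<le> q'" "real q' \<le> Y'" "\<bar>x - of_int a' / real q'\<bar> \<le> \<epsilon> / W'"
    using ap by (rule apprE)
  have Y: "1 \<le> Y" "1 \<le> Y'" using q q' by linarith+
  have x1: "\<bar>x - of_int a / real q\<bar> \<le> Y / W" using q(4) W by (simp add: pos_le_divide_eq)
  have same: "of_int a / real q = of_int a' / real q'"
  proof (rule ccontr)
    assume "of_int a / real q \<noteq> of_int a' / real q'"
    then have "1 \<le> real q * real q' * \<bar>of_int a / real q - of_int a' / real q'\<bar>"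
      using q q' by (intro fraction_separation) auto
    also have "\<dots> \<le> Y * Y' * (Y / W + \<epsilon> / W')"
      using q q' x1 W Y by (intro mult_mono) auto
    also have "\<dots> = Y * Y' * Y / W + Y * Y' * \<epsilon> / W'" by (simp add: distrib_left)
    also have "\<dots> < 1 / 2 + 1 / 2" using big W by (intro add_strict_mono) (simp_all add: pos_divide_less_eq)
    finally show False by simp
  qed
  have "1 / Y \<le> \<epsilon> / W' * W" using q(3) q'(3) W unfolding same by (meson mult_right_mono less_imp_le order_trans)
  then show ?thesis using Y W by (simp add: field_simps)
qed

lemma active_imp_appr: "active x Y W \<Longrightarrow> 0 < W \<Longrightarrow> appr x Y (Y / W)"
  unfolding active_def appr_def by (auto simp: pos_le_divide_eq)

text \<open>
  The scales on which the values \<open>Q s\<close> of a polynomial are active agree, up to a bounded power of \<open>X\<close>,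
  for all \<open>s\<close> outside an exceptional set of relative size \<open>1 / X\<close>: pick the finest scale \<open>w\<close> that is
  reached by a proportion \<open>1 / X\<close> of all \<open>s\<close>; then the coefficients, and with them all values, are
  approximated on this scale.
\<close>

lemma common_scale:
  "\<exists>C. \<forall>(X::real) N b. X \<ge> 2 \<and> N \<ge> 1 \<and> X ^ C \<le> real N \<longrightarrow>
    (\<exists>w E. E \<subseteq> {- 2 * int N..2 * int N} \<and> card E * X \<le> real N \<and>
      (\<forall>s\<in>{- 2 * int N..2 * int N} - E. \<forall>v. X ^ C \<le> 2 ^ v \<and> active (polyval d b s) (X ^ D) (2 ^ v)
        \<longrightarrow> v \<le> w \<and> 2 ^ w \<le> X ^ C * 2 ^ v))"
proof -
  obtain C1 where NI: "\<And>X N \<epsilon> G c i. X \<ge> 2 \<Longrightarrow> N \<ge> 1 \<Longrightarrow> \<epsilon> \<ge> 0 \<Longrightarrow> G \<subseteq> {- int N..int N} \<Longrightarrow> real N / X \<le> card G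
      \<Longrightarrow> X ^ C1 \<le> real N \<Longrightarrow> \<epsilon> * X ^ C1 \<le> 1 \<Longrightarrow> \<forall>t\<in>G. appr (polyval d c t) X \<epsilon> \<Longrightarrow> i \<le> d
      \<Longrightarrow> appr (c i) (X ^ C1) (X ^ C1 * \<epsilon> / real N ^ i)"
    using rational_polynomial_approximation[of d] by meson
  define A where "A = D + 2"
  define B where "B = A * C1 * (d + 1) + d + 1"
  define C where "C = 3 * D + 2 * B + A * C1 + 4"
  show ?thesis
  proof (rule exI[of _ C], intro allI impI, elim conjE)
    fix X :: real and N :: nat and b
    assume X: "X \<ge> 2" and N: "N \<ge> 1" and XN: "X ^ C \<le> real N"
    have X1: "1 \<le> X" using X by simp
    have pm: "X ^ a \<le> X ^ b" if "a \<le> b" for a b using X1 that by (rule power_increasing[rotated])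
    define V where "V = {- 2 * int N..2 * int N}"
    define Q where "Q s = polyval d b s" for s
    define act where "act s v \<longleftrightarrow> X ^ C \<le> 2 ^ v \<and> active (Q s) (X ^ D) (2 ^ v)" for s v
    define S where "S v = {s\<in>V. \<exists>v'\<ge>v. act s v'}" for v
    have finV: "finite V" by (simp add: V_def)
    have big: "X ^ C \<le> W \<Longrightarrow> e + 2 \<le> C \<Longrightarrow> X ^ e < W / 2" for e and W :: real
    proof -
      assume W: "X ^ C \<le> W" and e: "e + 2 \<le> C"
      have "2 * X ^ e < 4 * X ^ e" using X by simp
      also have "\<dots> \<le> X ^ 2 * X ^ e" using X by (intro absorb_const) auto
      also have "\<dots> = X ^ (e + 2)" by (simp add: power_add power2_eq_square)
      also have "\<dots> \<le> W" using pm[OF e] W by linarith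
      finally show "X ^ e < W / 2" by simp
    qed
    \<comment> \<open>A crude bound on the range of active scales of a single point; it only serves
      to make a finest scale exist.\<close>
    have bounded_act: "v \<le> v0 + nat \<lceil>X ^ (2 * D)\<rceil>" if "act s v" "act s v0" for s v v0
    proof -
      have "2 ^ v \<le> X ^ D * X ^ D * (2::real) ^ v0"
      proof (rule active_scale)
        show "active (Q s) (X ^ D) (2 ^ v0)" using that by (simp add: act_def)
        show "appr (Q s) (X ^ D) (X ^ D / 2 ^ v)" using that by (intro active_imp_appr) (auto simp: act_def)
        show "X ^ D * X ^ D * X ^ D < 2 ^ v0 / 2" "X ^ D * X ^ D * X ^ D < 2 ^ v / 2"
          unfolding power_add[symmetric] by (rule big; use that in \<open>auto simp: act_def C_def\<close>)+
      qed (use X in auto)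
      also have "X ^ D * X ^ D = X ^ (2 * D)" by (simp add: power_add[symmetric] mult_2)
      also have "X ^ (2 * D) \<le> 2 ^ nat \<lceil>X ^ (2 * D)\<rceil>"
      proof -
        have "X ^ (2 * D) \<le> real (nat \<lceil>X ^ (2 * D)\<rceil>)" by (rule real_nat_ceiling_ge)
        also have "\<dots> \<le> 2 ^ nat \<lceil>X ^ (2 * D)\<rceil>" by (rule const_le_power) simp
        finally show ?thesis .
      qed
      finally have "(2::real) ^ v \<le> 2 ^ (nat \<lceil>X ^ (2 * D)\<rceil> + v0)" by (simp add: power_add)
      then show ?thesis by (simp add: add.commute)
    qed
    show "\<exists>w E. E \<subseteq> {- 2 * int N..2 * int N} \<and> card E * X \<le> real N \<and>
      (\<forall>s\<in>{- 2 * int N..2 * int N} - E. \<forall>v. X ^ C \<le> 2 ^ v \<and> active (polyval d b s) (X ^ D) (2 ^ v)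
        \<longrightarrow> v \<le> w \<and> 2 ^ w \<le> X ^ C * 2 ^ v)"
    proof (cases "card (S 0) * X \<le> real N")
      \<comment> \<open>Hardly any point is active at all: the active points are the exceptional
        ones, and w is arbitrary.\<close>
      case True
      have "act s v \<Longrightarrow> s \<in> V \<Longrightarrow> s \<in> S 0" for s v by (auto simp: S_def)
      then show ?thesis using True
        by (intro exI[of _ 0] exI[of _ "S 0"]) (auto simp: S_def V_def act_def Q_def)
    next
      case False
      \<comment> \<open>P v says that more than N / X points are active at v or a finer scale. As
        there are finitely many points, each with bounded active scales, a finest such v
        exists.\<close>
      define P where "P v \<longleftrightarrow> real N < card (S v) * X" for v
      have "\<forall>s. \<exists>u. \<forall>v. act s v \<longrightarrow> v \<le> u" using bounded_act by meson
      then obtain u where u: "\<And>s v. act s v \<Longrightarrow> v \<le> u s" by metis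
      define U where "U = (\<Sum>s\<in>V. u s)"
      have "P v \<Longrightarrow> v \<le> U" for v
      proof (rule ccontr)
        assume "P v" "\<not> v \<le> U"
        have "S v = {}"
        proof (rule ccontr)
          assume "S v \<noteq> {}"
          then obtain s v' where s: "s \<in> V" "v \<le> v'" "act s v'" by (auto simp: S_def)
          have "u s \<le> U" unfolding U_def using s finV by (intro member_le_sum) auto
          then show False using u[OF s(3)] s(2) \<open>\<not> v \<le> U\<close> by linarith
        qed
        then show False using \<open>P v\<close> by (simp add: P_def)
      qed
      moreover have "P 0" using False by (simp add: P_def)
      ultimately have "P (Greatest P)" "\<And>v. P v \<Longrightarrow> v \<le> Greatest P"
        using GreatestI_nat[of P 0 U] Greatest_le_nat[of P _ U] by blast+
      then obtain w where w: "P w" "\<not> P (Suc w)" by (metis Suc_n_not_le_n)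
      define E where "E = S (Suc w)"
      \<comment> \<open>Activity is recorded only from X ^ C on, so below this threshold the step
        from w to w + 1 changes nothing, contrary to the choice of w.\<close>
      have XCw: "X ^ C \<le> 2 ^ w"
      proof (rule ccontr)
        assume "\<not> ?thesis"
        then have less: "(2::real) ^ w < X ^ C" by simp
        have "Suc w \<le> v" if "act s v" "w \<le> v" for s v
        proof (rule ccontr)
          assume "\<not> Suc w \<le> v"
          then have "v = w" using that by simp
          then show False using that less by (simp add: act_def)
        qed
        then have "S w = S (Suc w)" by (auto simp: S_def intro: Suc_leD)
        then show False using w by (simp add: P_def)
      qed
      define \<epsilon> where "\<epsilon> = X ^ D / 2 ^ w"
      have eps: "0 \<le> \<epsilon>" using X by (simp add: \<epsilon>_def)
      have "1 \<le> A" by (simp add: A_def)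
      then have XA: "X \<le> X ^ A" using pm[of 1 A] by simp
      have coef: "appr (b i) ((X ^ A) ^ C1) ((X ^ A) ^ C1 * \<epsilon> / real (2 * N) ^ i)" if i: "i \<le> d" for i
      proof (rule NI[where G="S w", OF _ _ eps _ _ _ _ _ i])
        show "2 \<le> X ^ A" using XA X by simp
        show "1 \<le> 2 * N" using N by simp
        show "S w \<subseteq> {- int (2 * N)..int (2 * N)}" by (auto simp: S_def V_def)
        have "real (2 * N) / X ^ A \<le> real (2 * N) / (2 * X)"
        proof (rule divide_left_mono)
          have "2 * X \<le> X ^ 2" using X by (simp add: power2_eq_square)
          also have "\<dots> \<le> X ^ A" by (intro pm) (simp add: A_def)
          finally show "2 * X \<le> X ^ A" .
        qed (use X in auto)
        also have "\<dots> \<le> card (S w)" using w(1) X by (simp add: P_def field_simps)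
        finally show "real (2 * N) / X ^ A \<le> card (S w)" .
        have "(X ^ A) ^ C1 \<le> X ^ C" unfolding power_mult[symmetric] by (intro pm) (simp add: C_def)
        then show "(X ^ A) ^ C1 \<le> real (2 * N)" using XN by simp
        have "X ^ D * (X ^ A) ^ C1 \<le> X ^ C" unfolding power_mult[symmetric] power_add[symmetric] by (intro pm) (simp add: C_def)
        then have "X ^ D * (X ^ A) ^ C1 \<le> 2 ^ w" using XCw by linarith
        then show "\<epsilon> * (X ^ A) ^ C1 \<le> 1" by (simp add: \<epsilon>_def)
        show "\<forall>t\<in>S w. appr (polyval d b t) (X ^ A) \<epsilon>"
        proof
          fix t assume "t \<in> S w"
          then obtain v where v: "w \<le> v" "act t v" by (auto simp: S_def)
          then have "appr (Q t) (X ^ D) (X ^ D / 2 ^ v)" by (intro active_imp_appr) (auto simp: act_def)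
          then have "appr (Q t) (X ^ A) \<epsilon>" 
          proof (rule appr_mono)
            show "X ^ D \<le> X ^ A" by (intro pm) (simp add: A_def)
            show "X ^ D / 2 ^ v \<le> \<epsilon>" unfolding \<epsilon>_def using v X by (intro divide_left_mono power_increasing) auto
          qed
          then show "appr (polyval d b t) (X ^ A) \<epsilon>" by (simp add: Q_def)
        qed
      qed
      \<comment> \<open>The coefficients being nearly rational, so are the values at all points,
        including those that are never active on this scale.\<close>
      have all: "appr (Q s) (X ^ B) (X ^ B * X ^ D / 2 ^ w)" if s: "s \<in> V" for s
      proof -
        have sN: "\<bar>real_of_int s\<bar> \<le> real (2 * N)" using s unfolding V_def by auto
        have "appr (of_int (s ^ i) * b i) ((X ^ A) ^ C1) ((X ^ A) ^ C1 * \<epsilon>)" if i: "i \<in> {..d}" for i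
        proof (rule appr_mono)
          show "appr (of_int (s ^ i) * b i) ((X ^ A) ^ C1) (\<bar>of_int (s ^ i)\<bar> * ((X ^ A) ^ C1 * \<epsilon> / real (2 * N) ^ i))"
            using i by (intro appr_mult_int coef) auto
          have "\<bar>real_of_int (s ^ i)\<bar> \<le> real (2 * N) ^ i" using power_mono[OF sN, of i] by (simp add: power_abs)
          then have "\<bar>real_of_int (s ^ i)\<bar> * ((X ^ A) ^ C1 * \<epsilon> / real (2 * N) ^ i)
              \<le> real (2 * N) ^ i * ((X ^ A) ^ C1 * \<epsilon> / real (2 * N) ^ i)"
            using X eps by (intro mult_right_mono) auto
          then show "\<bar>real_of_int (s ^ i)\<bar> * ((X ^ A) ^ C1 * \<epsilon> / real (2 * N) ^ i) \<le> (X ^ A) ^ C1 * \<epsilon>" using N by simp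
        qed simp
        then have "appr (\<Sum>i\<in>{..d}. of_int (s ^ i) * b i) (((X ^ A) ^ C1) ^ card {..d}) (\<Sum>i\<in>{..d}. (X ^ A) ^ C1 * \<epsilon>)"
          using X1 by (intro appr_sum) auto
        moreover have "(\<Sum>i\<in>{..d}. of_int (s ^ i) * b i) = Q s" by (simp add: Q_def polyval_def mult.commute)
        ultimately have "appr (Q s) (X ^ (A * C1 * (d + 1))) (real (d + 1) * (X ^ (A * C1) * \<epsilon>))"
          by (simp only: power_mult card_atMost sum_constant Suc_eq_plus1)
        then show ?thesis
        proof (rule appr_mono)
          show "X ^ (A * C1 * (d + 1)) \<le> X ^ B" by (intro pm) (simp add: B_def)
          have "real (d + 1) * (X ^ (A * C1) * \<epsilon>) \<le> X ^ (d + 1) * (X ^ (A * C1) * \<epsilon>)"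
            using X eps by (intro mult_right_mono const_le_power) auto
          also have "\<dots> = X ^ (d + 1 + A * C1) * \<epsilon>" by (simp add: power_add)
          also have "\<dots> \<le> X ^ B * \<epsilon>" using eps by (intro mult_right_mono pm) (auto simp: B_def)
          finally show "real (d + 1) * (X ^ (A * C1) * \<epsilon>) \<le> X ^ B * X ^ D / 2 ^ w" by (simp add: \<epsilon>_def)
        qed
      qed
      \<comment> \<open>Off E no scale finer than w is active. Conversely an active scale cannot be
        much coarser than w, as the approximating fraction is unique.\<close>
      have fin: "v \<le> w \<and> 2 ^ w \<le> X ^ C * 2 ^ v" if s: "s \<in> V - E" and v: "act s v" for s v
      proof -
        have "\<not> Suc w \<le> v" using s v by (auto simp: E_def S_def)
        then have vw: "v \<le> w" by simp
        have "2 ^ w \<le> X ^ D * (X ^ B * X ^ D) * (2::real) ^ v"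
        proof (rule active_scale)
          show "active (Q s) (X ^ D) (2 ^ v)" using v by (simp add: act_def)
          show "appr (Q s) (X ^ B) (X ^ B * X ^ D / 2 ^ w)" using s by (intro all) auto
          show "X ^ D * X ^ B * X ^ D < 2 ^ v / 2" "X ^ D * X ^ B * (X ^ B * X ^ D) < 2 ^ w / 2"
            unfolding power_add[symmetric] by (rule big; use v XCw in \<open>auto simp: act_def C_def\<close>)+
        qed (use X in auto)
        also have "X ^ D * (X ^ B * X ^ D) \<le> X ^ C" unfolding power_add[symmetric] by (intro pm) (simp add: C_def)
        finally show ?thesis using vw by simp
      qed
      show ?thesis
      proof (intro exI[of _ w] exI[of _ E] conjI ballI allI impI)
        show "E \<subseteq> {- 2 * int N..2 * int N}" by (auto simp: E_def S_def V_def)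
        show "card E * X \<le> real N" using w(2) by (simp add: P_def E_def)
        fix s v assume "s \<in> {- 2 * int N..2 * int N} - E" "X ^ C \<le> 2 ^ v \<and> active (polyval d b s) (X ^ D) (2 ^ v)"
        then have "v \<le> w \<and> 2 ^ w \<le> X ^ C * 2 ^ v" by (intro fin) (auto simp: V_def act_def Q_def)
        then show "v \<le> w" "2 ^ w \<le> X ^ C * 2 ^ v" by auto
      qed
    qed
  qed
qed

lemma active_coefficients:
  assumes F: "finite F"
  shows "\<exists>C. \<forall>X M c j. X \<ge> 2 \<and> (\<forall>\<kappa>\<in>F. X ^ C \<le> 2 ^ j \<kappa>) \<and> 1 / X \<le> norm (dyadic_sum F d M c j)
    \<longrightarrow> (\<forall>\<nu>\<in>F. \<exists>n\<in>exponents F d. odd (n \<nu>) \<and> c n \<noteq> 0 \<and> active (c n) (X ^ C) (2 ^ dot F n j))"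
proof -
  have "\<exists>C. \<forall>X M c j. X \<ge> 2 \<and> (\<forall>\<kappa>\<in>F. X ^ C \<le> 2 ^ j \<kappa>) \<and> 1 / X \<le> norm (dyadic_sum F d M c j)
    \<longrightarrow> (\<exists>n\<in>exponents F d. odd (n \<nu>) \<and> c n \<noteq> 0 \<and> active (c n) (X ^ C) (2 ^ dot F n j))" if "\<nu> \<in> F" for \<nu>
    using active_coefficient[of "F - {\<nu>}" \<nu> d] F unfolding insert_Diff[OF that] weight_eq_dot by blast
  then obtain C where C: "\<And>\<nu> X M c j. \<nu> \<in> F \<Longrightarrow> X \<ge> 2 \<Longrightarrow> (\<forall>\<kappa>\<in>F. X ^ C \<nu> \<le> 2 ^ j \<kappa>) \<Longrightarrow> 1 / X \<le> norm (dyadic_sum F d M c j)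
    \<Longrightarrow> (\<exists>n\<in>exponents F d. odd (n \<nu>) \<and> c n \<noteq> 0 \<and> active (c n) (X ^ C \<nu>) (2 ^ dot F n j))"
    by metis
  show ?thesis
  proof (intro exI[of _ "sum C F"] allI impI ballI, elim conjE)
    fix X :: real and M c j \<nu>
    assume X: "X \<ge> 2" and N: "\<forall>\<kappa>\<in>F. X ^ sum C F \<le> 2 ^ j \<kappa>" and big: "1 / X \<le> norm (dyadic_sum F d M c j)" and \<nu>: "\<nu> \<in> F"
    have "C \<nu> \<le> sum C F" using F \<nu> by (intro member_le_sum) auto
    then have le: "X ^ C \<nu> \<le> X ^ sum C F" using X by (intro power_increasing) auto
    then have "\<forall>\<kappa>\<in>F. X ^ C \<nu> \<le> 2 ^ j \<kappa>" using N by fastforce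
    from C[OF \<nu> X this big] show "\<exists>n\<in>exponents F d. odd (n \<nu>) \<and> c n \<noteq> 0 \<and> active (c n) (X ^ sum C F) (2 ^ dot F n j)"
      using active_mono[OF _ le] by blast
  qed
qed

section \<open>Induction on the number of variables\<close>

definition big_pieces :: "'k set \<Rightarrow> nat \<Rightarrow> ('k \<Rightarrow> nat) \<Rightarrow> (('k \<Rightarrow> nat) \<Rightarrow> real) \<Rightarrow> real \<Rightarrow> ('k \<Rightarrow> nat) set" where
  "big_pieces F d M c Y = {j. (\<forall>\<kappa>. \<kappa> \<notin> F \<longrightarrow> j \<kappa> = 0) \<and> 1 / Y \<le> norm (dyadic_sum F d M c j)}"

definition sparse_odd :: "'k set \<Rightarrow> nat \<Rightarrow> (('k \<Rightarrow> nat) \<Rightarrow> real) \<Rightarrow> bool" where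
  "sparse_odd F d c \<longleftrightarrow> (\<forall>n\<in>exponents F d. c n \<noteq> 0 \<longrightarrow> (\<forall>\<nu> \<kappa>. odd (n \<nu>) \<and> odd (n \<kappa>) \<longrightarrow> \<nu> = \<kappa>))"

text \<open>
  The number of pieces of size at least \<open>1 / Z ^ K\<close> is by a factor \<open>Z\<close> smaller than \<open>Z ^ K\<close>, so the
  contributions of the levels \<open>Z = 2 ^ i\<close> form a convergent series.
\<close>

definition few_big :: "'k set \<Rightarrow> nat \<Rightarrow> nat \<Rightarrow> real \<Rightarrow> bool" where
  "few_big F d K C \<longleftrightarrow> (\<forall>M c Z. 2 \<le> Z \<and> sparse_odd F d c \<longrightarrow> real (card (big_pieces F d M c (Z ^ K))) * Z \<le> C * Z ^ K)"

lemma dyadic_sum_cong: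
  assumes "\<And>\<kappa>. \<kappa> \<in> F \<Longrightarrow> j \<kappa> = j' \<kappa>"
  shows "dyadic_sum F d M c j = dyadic_sum F d M c j'"
proof -
  have "boxfun F (\<lambda>\<kappa>. dyadic (M \<kappa>) (j \<kappa>)) = boxfun F (\<lambda>\<kappa>. dyadic (M \<kappa>) (j' \<kappa>))"
    using assms by (auto simp: boxfun_def)
  then show ?thesis by (simp add: dyadic_sum_def)
qed

lemma dyadic_empty: "M < 2 ^ j \<Longrightarrow> dyadic M j = {}"
proof -
  assume "M < 2 ^ j"
  then have "int M < 2 ^ j" by (metis of_nat_less_iff of_nat_numeral of_nat_power)
  then have "\<not> (2 ^ j \<le> \<bar>t\<bar> \<and> \<bar>t\<bar> \<le> int M)" for t :: int by linarith
  then show ?thesis unfolding dyadic_def by blast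
qed

lemma dyadic_sum_nonzero:
  assumes "dyadic_sum F d M c j \<noteq> 0" "\<kappa> \<in> F"
  shows "2 ^ j \<kappa> \<le> M \<kappa>"
proof (rule ccontr)
  assume "\<not> ?thesis"
  then have "dyadic (M \<kappa>) (j \<kappa>) = {}" by (intro dyadic_empty) simp
  then have "boxfun F (\<lambda>\<kappa>. dyadic (M \<kappa>) (j \<kappa>)) = {}" using assms(2) by (auto simp: boxfun_def)
  then show False using assms(1) by (simp add: dyadic_sum_def)
qed

lemma finite_big_pieces:
  assumes "finite F" "0 < Y"
  shows "finite (big_pieces F d M c Y)"
proof (rule finite_subset)
  show "big_pieces F d M c Y \<subseteq> boxfun F (\<lambda>\<kappa>. {..M \<kappa>})"
  proof
    fix j assume j: "j \<in> big_pieces F d M c Y"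
    then have "dyadic_sum F d M c j \<noteq> 0" using assms(2) by (auto simp: big_pieces_def)
    then have "j \<kappa> \<le> M \<kappa>" if "\<kappa> \<in> F" for \<kappa>
      using dyadic_sum_nonzero[OF _ that, of d M c j] less_exp[of "j \<kappa>"] by linarith
    then show "j \<in> boxfun F (\<lambda>\<kappa>. {..M \<kappa>})" using j by (simp add: boxfun_def big_pieces_def)
  qed
  show "finite (boxfun F (\<lambda>\<kappa>. {..M \<kappa>}))" using assms(1) by (intro finite_boxfun) auto
qed

lemma few_bigD:
  "few_big F d K C \<Longrightarrow> 2 \<le> Z \<Longrightarrow> sparse_odd F d c \<Longrightarrow> real (card (big_pieces F d M c (Z ^ K))) * Z \<le> C * Z ^ K"
  by (simp add: few_big_def)

text \<open>Apply the bound to Z ^ a: the saving Z ^ a exceeds the saving Z that is asked for.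
  Passing to multiples of K is how the constants of different index sets are made equal.\<close>

lemma few_big_multiple:
  assumes "few_big F d K C" "1 \<le> a" "C \<le> C'"
  shows "few_big F d (a * K) C'"
  unfolding few_big_def
proof (intro allI impI, elim conjE)
  fix M c and Z :: real
  assume Z: "2 \<le> Z" and c: "sparse_odd F d c"
  have Za: "Z \<le> Z ^ a" using Z assms(2) power_increasing[of 1 a Z] by simp
  have "real (card (big_pieces F d M c (Z ^ (a * K)))) * Z \<le> real (card (big_pieces F d M c ((Z ^ a) ^ K))) * Z ^ a"
    unfolding power_mult using Za by (intro mult_left_mono) auto
  also have "\<dots> \<le> C * (Z ^ a) ^ K" using Z Za by (intro few_bigD[OF assms(1) _ c]) auto
  also have "\<dots> \<le> C' * (Z ^ a) ^ K" using assms(3) Z by (intro mult_right_mono) auto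
  finally show "real (card (big_pieces F d M c (Z ^ (a * K)))) * Z \<le> C' * Z ^ (a * K)" by (simp add: power_mult)
qed

lemma sparse_odd_slice:
  assumes "sparse_odd (insert \<mu> F) d c" "\<mu> \<notin> F"
  shows "sparse_odd F d (slice d c \<mu> s)"
  unfolding sparse_odd_def
proof (intro ballI impI allI, elim conjE)
  fix n \<nu> \<kappa> assume n: "n \<in> exponents F d" and nz: "slice d c \<mu> s n \<noteq> 0" and o: "odd (n \<nu>)" "odd (n \<kappa>)"
  have "\<exists>i\<le>d. c (n(\<mu> := i)) \<noteq> 0"
  proof (rule ccontr)
    assume "\<not> ?thesis"
    then have "slice d c \<mu> s n = 0" by (simp add: slice_def polyval_def)
    then show False using nz by simp
  qed
  then obtain i where i: "i \<le> d" "c (n(\<mu> := i)) \<noteq> 0" by blast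
  have "n(\<mu> := i) \<in> exponents (insert \<mu> F) d" using n i by (intro boxfun_upd) auto
  moreover have "n \<mu> = 0" using boxfun_off[OF n assms(2)] .
  then have "\<nu> \<noteq> \<mu>" "\<kappa> \<noteq> \<mu>" using o by auto
  then have "odd ((n(\<mu> := i)) \<nu>)" "odd ((n(\<mu> := i)) \<kappa>)" using o by auto
  ultimately show "\<nu> = \<kappa>" using assms(1) i(2) unfolding sparse_odd_def by blast
qed

text \<open>Split by size at the levels 1 / (Z * 2 ^ I) ^ K. Between consecutive levels the number
  of pieces times their size is at most C * 2 ^ K / (Z * 2 ^ (I + 1)), a geometric series; the
  factor Z saved in \<open>few_big\<close> makes it converge.\<close>

lemma tail_sum:
  assumes few: "few_big F d K C" and F: "finite F" and K: "1 \<le> K" and Z: "2 \<le> Z" and c: "sparse_odd F d c"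
    and J: "finite J" "\<And>j \<kappa>. j \<in> J \<Longrightarrow> \<kappa> \<notin> F \<Longrightarrow> j \<kappa> = 0"
    and small: "\<And>j. j \<in> J \<Longrightarrow> norm (dyadic_sum F d M c j) < 1 / Z ^ K"
  shows "(\<Sum>j\<in>J. norm (dyadic_sum F d M c j)) \<le> C * 2 ^ K / Z"
proof -
  define f where "f j = norm (dyadic_sum F d M c j)" for j
  define S where "S I = {j\<in>J. 1 / (Z * 2 ^ I) ^ K \<le> f j}" for I :: nat
  have C0: "0 \<le> C"
  proof -
    have "0 \<le> real (card (big_pieces F d M c (Z ^ K))) * Z" using Z by simp
    also have "\<dots> \<le> C * Z ^ K" by (rule few_bigD[OF few Z c])
    finally have "0 * Z ^ K \<le> C * Z ^ K" by simp
    then show ?thesis by (rule mult_right_le_imp_le) (use Z in simp)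
  qed
  have level: "sum f (S I) \<le> C * 2 ^ K / Z * (1 - 1 / 2 ^ I)" for I
  proof (induction I)
    case 0
    have "S 0 = {}" using small by (force simp: S_def f_def)
    then show ?case by simp
  next
    case (Suc I)
    define T where "T = {j\<in>J. 1 / (Z * 2 ^ Suc I) ^ K \<le> f j \<and> f j < 1 / (Z * 2 ^ I) ^ K}"
    have mono: "1 / (Z * 2 ^ Suc I) ^ K \<le> 1 / (Z * 2 ^ I) ^ K"
      using Z by (intro divide_left_mono power_mono mult_left_mono) auto
    have "S (Suc I) = S I \<union> T" using mono by (auto simp: S_def T_def)
    then have "sum f (S (Suc I)) = sum f (S I) + sum f T"
      using J(1) by (auto simp: S_def T_def intro!: sum.union_disjoint)
    moreover have "sum f T \<le> C * 2 ^ K / Z * (1 / 2 ^ Suc I)"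
    proof -
      have Z2: "2 \<le> Z * 2 ^ Suc I" 
      proof -
        have "2 * 1 \<le> Z * 2 ^ Suc I" using Z by (intro mult_mono one_le_power) auto
        then show ?thesis by simp
      qed
      have "T \<subseteq> big_pieces F d M c ((Z * 2 ^ Suc I) ^ K)" using J(2) by (auto simp: T_def big_pieces_def f_def)
      then have cT: "card T \<le> card (big_pieces F d M c ((Z * 2 ^ Suc I) ^ K))"
        using Z by (intro card_mono finite_big_pieces[OF F]) auto
      have "real (card T) * (Z * 2 ^ Suc I) \<le> real (card (big_pieces F d M c ((Z * 2 ^ Suc I) ^ K))) * (Z * 2 ^ Suc I)"
        using cT Z by (intro mult_right_mono) auto
      also have "\<dots> \<le> C * (Z * 2 ^ Suc I) ^ K" by (rule few_bigD[OF few Z2 c])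
      finally have cT: "real (card T) \<le> C * (Z * 2 ^ Suc I) ^ K / (Z * 2 ^ Suc I)" using Z by (simp add: pos_le_divide_eq)
      have "sum f T \<le> (\<Sum>j\<in>T. 1 / (Z * 2 ^ I) ^ K)" by (intro sum_mono) (auto simp: T_def)
      also have "\<dots> = real (card T) * (1 / (Z * 2 ^ I) ^ K)" by simp
      also have "\<dots> \<le> C * (Z * 2 ^ Suc I) ^ K / (Z * 2 ^ Suc I) * (1 / (Z * 2 ^ I) ^ K)"
        using cT Z by (intro mult_right_mono) auto
      also have "(Z * 2 ^ Suc I) ^ K = 2 ^ K * (Z * 2 ^ I) ^ K"
        by (simp add: power_mult_distrib[symmetric] mult_ac)
      also have "C * (2 ^ K * (Z * 2 ^ I) ^ K) / (Z * 2 ^ Suc I) * (1 / (Z * 2 ^ I) ^ K) = C * 2 ^ K / Z * (1 / 2 ^ Suc I)"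
        using Z by (simp add: power_mult_distrib)
      finally show ?thesis .
    qed
    ultimately have "sum f (S (Suc I)) \<le> C * 2 ^ K / Z * (1 - 1 / 2 ^ I) + C * 2 ^ K / Z * (1 / 2 ^ Suc I)" using Suc by linarith
    also have "\<dots> = C * 2 ^ K / Z * (1 - 1 / 2 ^ Suc I)" unfolding distrib_left[symmetric] by simp
    finally show ?case .
  qed
  \<comment> \<open>A level below all nonzero terms of the finite sum: I is at least 1 / f j for
    each of them, and 2 ^ I is at least I.\<close>
  define I where "I = (\<Sum>j\<in>J. nat \<lceil>1 / f j\<rceil>)"
  have "sum f J = sum f (S I)"
  proof (rule sum.mono_neutral_right[OF J(1)])
    show "S I \<subseteq> J" by (auto simp: S_def)
    show "\<forall>j\<in>J - S I. f j = 0"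
    proof (intro ballI, rule ccontr)
      fix j assume j: "j \<in> J - S I" "f j \<noteq> 0"
      then have pos: "0 < f j" by (simp add: f_def)
      have "1 / f j \<le> real (nat \<lceil>1 / f j\<rceil>)" by (rule real_nat_ceiling_ge)
      also have "\<dots> \<le> real I" unfolding I_def using j J(1) by (intro of_nat_mono member_le_sum) auto
      also have "\<dots> \<le> 2 ^ I" by (rule const_le_power) simp
      also have "\<dots> \<le> Z * 2 ^ I" using Z by simp
      also have "\<dots> \<le> (Z * 2 ^ I) ^ K"
      proof -
        have "1 * 1 \<le> Z * 2 ^ I" using Z by (intro mult_mono one_le_power) auto
        then have "1 \<le> Z * 2 ^ I" by simp
        then show ?thesis using K power_increasing[of 1 K "Z * 2 ^ I"] by simp
      qed
      finally have "1 / (Z * 2 ^ I) ^ K \<le> f j" using pos Z by (simp add: field_simps)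
      then show False using j by (simp add: S_def)
    qed
  qed
  also have "\<dots> \<le> C * 2 ^ K / Z * (1 - 1 / 2 ^ I)" by (rule level)
  also have "\<dots> \<le> C * 2 ^ K / Z * 1" using C0 Z by (intro mult_left_mono) auto
  finally show ?thesis by (simp add: f_def)
qed

text \<open>The pieces of size at least 1 / 2 ^ K are few and trivially bounded; the others form a
  tail with Z = 2.\<close>

lemma total_sum:
  assumes few: "few_big F d K C" and F: "finite F" and K: "1 \<le> K" and c: "sparse_odd F d c"
    and J: "finite J" "\<And>j \<kappa>. j \<in> J \<Longrightarrow> \<kappa> \<notin> F \<Longrightarrow> j \<kappa> = 0"
  shows "(\<Sum>j\<in>J. norm (dyadic_sum F d M c j)) \<le> C * 2 ^ K * 2 ^ card F"
proof -
  define f where "f j = norm (dyadic_sum F d M c j)" for j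
  define B where "B = big_pieces F d M c (2 ^ K)"
  have finB: "finite B" unfolding B_def by (rule finite_big_pieces[OF F]) simp
  have cB: "real (card B) * 2 \<le> C * 2 ^ K" unfolding B_def by (rule few_bigD[OF few order_refl c])
  have split: "sum f J = sum f (J \<inter> B) + sum f (J - B)"
    using J(1) by (metis Int_Diff_Un Int_Diff_disjoint finite_Diff finite_Int sum.union_disjoint)
  have "sum f (J \<inter> B) \<le> (\<Sum>j\<in>J \<inter> B. 2 ^ card F)" unfolding f_def by (intro sum_mono norm_dyadic_sum_le[OF F])
  also have "\<dots> = real (card (J \<inter> B)) * 2 ^ card F" by simp
  also have "\<dots> \<le> C * 2 ^ K / 2 * 2 ^ card F"
  proof (rule mult_right_mono)
    have "card (J \<inter> B) \<le> card B" using finB by (intro card_mono) auto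
    then show "real (card (J \<inter> B)) \<le> C * 2 ^ K / 2" using cB by linarith
  qed simp
  finally have 1: "sum f (J \<inter> B) \<le> C * 2 ^ K / 2 * 2 ^ card F" .
  have "sum f (J - B) \<le> C * 2 ^ K / 2"
    unfolding f_def
  proof (rule tail_sum[OF few F K order_refl c])
    fix j assume "j \<in> J - B"
    then show "norm (dyadic_sum F d M c j) < 1 / 2 ^ K" using J(2) by (force simp: B_def big_pieces_def)
  qed (use J in auto)
  also have "C * 2 ^ K / 2 \<le> C * 2 ^ K / 2 * 2 ^ card F"
  proof -
    have "0 \<le> C * 2 ^ K / 2" using cB by linarith
    then show ?thesis using mult_left_mono[of 1 "2 ^ card F" "C * 2 ^ K / 2"] by simp
  qed
  finally show ?thesis using 1 split by (simp add: f_def)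
qed

text \<open>A rounded binary logarithm, bounded crudely by Z: each window may cost a factor Z, since
  K exceeds the number of variables.\<close>

lemma log_bound:
  assumes "2 \<le> (Z::real)"
  obtains l :: nat where "Z \<le> 2 ^ l" "real l \<le> Z"
proof -
  define l where "l = (LEAST l. Z \<le> 2 ^ l)"
  have "Z \<le> real (nat \<lceil>Z\<rceil>)" by (rule real_nat_ceiling_ge)
  also have "\<dots> \<le> 2 ^ nat \<lceil>Z\<rceil>" by (rule const_le_power) simp
  finally have l: "Z \<le> 2 ^ l" unfolding l_def by (rule LeastI)
  have "real l \<le> Z"
  proof (cases l)
    case (Suc i)
    have "\<not> Z \<le> 2 ^ i" by (rule not_less_Least) (use Suc in \<open>simp add: l_def\<close>)
    moreover have "real (Suc i) \<le> 2 ^ i" using less_exp[of i] by (metis Suc_leI of_nat_le_iff of_nat_numeral of_nat_power)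
    ultimately show ?thesis using Suc by simp
  qed (use assms in simp)
  then show thesis using l that by blast
qed

text \<open>All sides exceed a power of X = Z ^ K, so for every variable some exponent is active for
  this X, in a window of length O(log X). The exponent u is found before K; the medium pieces can
  therefore be asked to fill the gap below (Z ^ K) ^ u.\<close>

lemma large_pieces:
  assumes F: "finite F"
  shows "\<exists>u. \<forall>K\<ge>card F + 1. \<exists>B\<ge>0. \<forall>(Z::real) M c. 2 \<le> Z \<and> sparse_odd F d c \<longrightarrow>
    real (card {j\<in>big_pieces F d M c (Z ^ K). \<forall>\<kappa>\<in>F. (Z ^ K) ^ u \<le> 2 ^ j \<kappa>}) * Z \<le> B * Z ^ K"
proof -
  obtain C where act: "\<And>X M c j \<nu>. X \<ge> 2 \<Longrightarrow> \<forall>\<kappa>\<in>F. X ^ C \<le> 2 ^ j \<kappa> \<Longrightarrow> 1 / X \<le> norm (dyadic_sum F d M c j) \<Longrightarrow> \<nu> \<in> F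
    \<Longrightarrow> \<exists>n\<in>exponents F d. odd (n \<nu>) \<and> c n \<noteq> 0 \<and> active (c n) (X ^ C) (2 ^ dot F n j)"
    by (rule exE[OF active_coefficients[OF F, of d]], rule that, elim allE, erule impE, (intro conjI; assumption), erule (1) bspec)
  \<comment> \<open>Then X ^ u = Y ^ 3 * X ^ 2 for Y = X ^ C, which is large enough for uniqueness
    of the fraction in \<open>active_scale\<close>.\<close>
  define u where "u = 3 * C + 2"
  define m where "m = card (exponents F d)"
  show ?thesis
  proof (rule exI[of _ u], intro allI impI)
    fix K assume K: "card F + 1 \<le> K"
    define b where "b = real m * (4 * real K * real C + 1)"
    show "\<exists>B\<ge>0. \<forall>(Z::real) M c. 2 \<le> Z \<and> sparse_odd F d c \<longrightarrow>
      real (card {j\<in>big_pieces F d M c (Z ^ K). \<forall>\<kappa>\<in>F. (Z ^ K) ^ u \<le> 2 ^ j \<kappa>}) * Z \<le> B * Z ^ K"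
    proof (rule exI[of _ "b ^ card F"], intro conjI allI impI, goal_cases)
      case 1
      then show ?case by (simp add: b_def)
    next
      case (2 Z M c)
      then have Z: "2 \<le> Z" and c: "sparse_odd F d c" by auto
      define J where "J = {j\<in>big_pieces F d M c (Z ^ K). \<forall>\<kappa>\<in>F. (Z ^ K) ^ u \<le> 2 ^ j \<kappa>}"
      define X where "X = Z ^ K"
      have X: "2 \<le> X" unfolding X_def using Z K power_increasing[of 1 K Z] by simp
      have pm: "X ^ a \<le> X ^ b" if "a \<le> b" for a b using X that by (intro power_increasing) auto
      obtain l where l: "Z \<le> 2 ^ l" "real l \<le> Z" using Z by (rule log_bound)
      define Y where "Y = X ^ C"
      define \<Lambda> where "\<Lambda> = {n\<in>exponents F d. c n \<noteq> 0}"
      define A where "A n j \<longleftrightarrow> Y ^ 3 * X ^ 2 \<le> 2 ^ dot F n j \<and> active (c n) Y (2 ^ dot F n j)" for n j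
      \<comment> \<open>Any piece at which n is active can serve as the centre of the window; by
        uniqueness of the fraction the others agree with it up to L.\<close>
      define w where "w n = dot F n (SOME j. A n j)" for n
      define L where "L = 2 * K * C * l"
      have Y: "1 \<le> Y" using X by (simp add: Y_def)
      have Y2L: "Y * Y \<le> 2 ^ L"
      proof -
        have "K * C + K * C = 2 * K * C" by simp
        then have "Y * Y = Z ^ (2 * K * C)" unfolding Y_def X_def power_mult[symmetric] power_add[symmetric] by (simp only:)
        also have "\<dots> \<le> (2 ^ l) ^ (2 * K * C)" using l Z by (intro power_mono) auto
        also have "\<dots> = 2 ^ L" unfolding power_mult[symmetric] L_def by (simp add: mult_ac)
        finally show ?thesis .
      qed
      have half: "dot F n j' \<le> dot F n j + L" if "A n j" "A n j'" for n j j'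
      proof -
        have big: "Y * Y * Y < W / 2" if "Y ^ 3 * X ^ 2 \<le> W" for W
        proof -
          have "2 * Y ^ 3 < 4 * Y ^ 3" using Y by simp
          also have "\<dots> \<le> X ^ 2 * Y ^ 3" using X Y by (intro absorb_const) auto
          finally show ?thesis using that by (simp add: power3_eq_cube mult.commute)
        qed
        have "2 ^ dot F n j' \<le> Y * Y * (2::real) ^ dot F n j"
        proof (rule active_scale[OF _ active_imp_appr])
          show "active (c n) Y (2 ^ dot F n j)" "active (c n) Y (2 ^ dot F n j')" using that by (auto simp: A_def)
          show "Y * Y * Y < 2 ^ dot F n j / 2" "Y * Y * Y < 2 ^ dot F n j' / 2" using that by (auto simp: A_def intro: big simp del: less_divide_eq_numeral1)
        qed (use Y in auto)
        also have "\<dots> \<le> 2 ^ L * 2 ^ dot F n j" using Y2L by (intro mult_right_mono) auto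
        finally have "(2::real) ^ dot F n j' \<le> 2 ^ (dot F n j + L)" by (simp add: power_add mult.commute)
        then show ?thesis by simp
      qed
      have close: "\<bar>int (dot F n j) - int (w n)\<bar> \<le> int L" if "A n j" for n j
      proof -
        have "A n (SOME j. A n j)" using that by (rule someI[of "A n"])
        then show ?thesis using half[OF that, of "SOME j. A n j"] half[OF _ that, of "SOME j. A n j"] by (simp add: w_def)
      qed
      have sub: "J \<subseteq> {j. (\<forall>\<kappa>. \<kappa> \<notin> F \<longrightarrow> j \<kappa> = 0) \<and> (\<forall>\<nu>\<in>F. \<exists>n\<in>\<Lambda>. odd (n \<nu>) \<and> \<bar>int (dot F n j) - int (w n)\<bar> \<le> int L)}"
      proof
        fix j assume j: "j \<in> J"
        then have off: "\<forall>\<kappa>. \<kappa> \<notin> F \<longrightarrow> j \<kappa> = 0" and big: "1 / X \<le> norm (dyadic_sum F d M c j)"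
          and lar: "\<forall>\<kappa>\<in>F. X ^ u \<le> 2 ^ j \<kappa>" by (auto simp: J_def big_pieces_def X_def)
        have "\<forall>\<kappa>\<in>F. X ^ C \<le> 2 ^ j \<kappa>" using lar pm[of C u] unfolding u_def by fastforce
        note act' = act[OF X this big]
        have "\<exists>n\<in>\<Lambda>. odd (n \<nu>) \<and> \<bar>int (dot F n j) - int (w n)\<bar> \<le> int L" if \<nu>: "\<nu> \<in> F" for \<nu>
        proof -
          obtain n where n: "n \<in> exponents F d" "odd (n \<nu>)" "c n \<noteq> 0" "active (c n) (X ^ C) (2 ^ dot F n j)"
            using act'[OF \<nu>] by blast
          have "Y ^ 3 * X ^ 2 = X ^ u" unfolding Y_def u_def power_add power_mult[symmetric] by (simp add: mult.commute)
          also have "\<dots> \<le> 2 ^ j \<nu>" using lar \<nu> by blast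
          also have "\<dots> \<le> 2 ^ dot F n j" using dot_ge[of F \<nu> n j, OF F \<nu> n(2)] by (intro power_increasing) auto
          finally have "A n j" using n by (simp add: A_def Y_def)
          then show ?thesis using close n by (auto simp: \<Lambda>_def)
        qed
        then show "j \<in> {j. (\<forall>\<kappa>. \<kappa> \<notin> F \<longrightarrow> j \<kappa> = 0) \<and> (\<forall>\<nu>\<in>F. \<exists>n\<in>\<Lambda>. odd (n \<nu>) \<and> \<bar>int (dot F n j) - int (w n)\<bar> \<le> int L)}"
          using off by blast
      qed
      have fin\<Lambda>: "finite \<Lambda>" using finite_exponents[OF F, of d] by (simp add: \<Lambda>_def)
      have "card J \<le> (card \<Lambda> * (2 * L + 1)) ^ card F"
        by (rule card_windows(2)[OF F fin\<Lambda> _ sub]) (use c in \<open>auto simp: \<Lambda>_def sparse_odd_def\<close>)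
      then have "real (card J) \<le> real ((card \<Lambda> * (2 * L + 1)) ^ card F)" by (rule of_nat_mono)
      also have "\<dots> = (real (card \<Lambda>) * (2 * real L + 1)) ^ card F" by (simp add: algebra_simps)
      also have "\<dots> \<le> (b * Z) ^ card F"
      proof (rule power_mono)
        have "real (card \<Lambda>) \<le> real m" unfolding m_def \<Lambda>_def using finite_exponents[OF F, of d] by (intro of_nat_mono card_mono) auto
        moreover have "2 * real L + 1 \<le> (4 * real K * real C + 1) * Z"
        proof -
          have "real L = 2 * real K * real C * real l" by (simp add: L_def)
          also have "\<dots> \<le> 2 * real K * real C * Z" using l by (intro mult_left_mono) auto
          finally show ?thesis using Z by (simp add: algebra_simps)
        qed
        ultimately have "real (card \<Lambda>) * (2 * real L + 1) \<le> real m * ((4 * real K * real C + 1) * Z)"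
          by (intro mult_mono) auto
        then show "real (card \<Lambda>) * (2 * real L + 1) \<le> b * Z" by (simp add: b_def mult.assoc)
      qed simp
      finally have "real (card J) * Z \<le> (b * Z) ^ card F * Z" using Z by (intro mult_right_mono) auto
      also have "\<dots> = b ^ card F * Z ^ (card F + 1)" by (simp add: power_mult_distrib)
      also have "\<dots> \<le> b ^ card F * Z ^ K" using K Z by (intro mult_left_mono power_increasing) (auto simp: b_def)
      finally show ?case by (simp add: J_def)
    qed
  qed
qed

text \<open>Some slice of a large piece is itself large, and the pieces of a slice are counted by
  the hypothesis for F with a multiple of Z ^ a in place of Z. This saves Z ^ a \<ge> Z ^ (2 *
  \<tau> + 1), which pays for at most Z ^ \<tau> levels of the variable and about 5 * Z ^ \<tau>
  values of s, and leaves the required factor Z.\<close>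

lemma tiny_pieces:
  assumes F: "finite F" and \<mu>: "\<mu> \<notin> F" and few: "few_big F d K C" and K: "1 \<le> K" and C: "0 \<le> C" and a: "2 * \<tau> + 1 \<le> a"
  shows "\<exists>B\<ge>0. \<forall>(Z::real) M c. 2 \<le> Z \<and> sparse_odd (insert \<mu> F) d c \<longrightarrow>
    real (card {j\<in>big_pieces (insert \<mu> F) d M c (Z ^ (a * K)). 2 ^ j \<mu> < Z ^ \<tau>}) * Z \<le> B * Z ^ (a * K)"
proof (rule exI[of _ "10 * C * 2 ^ K"], intro conjI allI impI, goal_cases)
  case 1
  then show ?case using C by simp
next
  case (2 Z M c)
  then have Z: "2 \<le> Z" and c: "sparse_odd (insert \<mu> F) d c" by auto
  define J where "J = {j\<in>big_pieces (insert \<mu> F) d M c (Z ^ (a * K)). 2 ^ j \<mu> < Z ^ \<tau>}"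
  define n where "n = nat \<lfloor>Z ^ \<tau>\<rfloor>"
  have nZ: "real n \<le> Z ^ \<tau>" unfolding n_def using Z by (intro of_nat_floor) simp
  have n1: "1 \<le> n" unfolding n_def using Z by (simp add: le_nat_iff le_floor_iff)
  \<comment> \<open>The factor 2 makes up for the loss in passing to the best slice: a dyadic set of
    level r has up to 2 * 2 ^ r points.\<close>
  define Z' where "Z' = 2 * Z ^ a"
  have Z': "2 \<le> Z'" using Z by (simp add: Z'_def)
  define B where "B s = big_pieces F d M (slice d c \<mu> s) (Z' ^ K)" for s
  have finB: "finite (B s)" for s unfolding B_def using Z' by (intro finite_big_pieces[OF F]) simp
  have cB: "real (card (B s)) * Z' \<le> C * Z' ^ K" for s
    unfolding B_def by (rule few_bigD[OF few Z' sparse_odd_slice[OF c \<mu>]])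
  have sub: "J \<subseteq> (\<lambda>(r, s, j). j(\<mu> := r)) ` (SIGMA r:{..<n}. SIGMA s:{- (2 * int n)..2 * int n}. B s)"
  proof
    fix j assume j: "j \<in> J"
    define r where "r = j \<mu>"
    define j' where "j' = j(\<mu> := 0)"
    have rn: "2 ^ r \<le> n" unfolding n_def
    proof -
      have "real (2 ^ r) \<le> Z ^ \<tau>" using j by (simp add: J_def r_def)
      then show "2 ^ r \<le> nat \<lfloor>Z ^ \<tau>\<rfloor>" by (rule le_nat_floor)
    qed
    have eq: "dyadic_sum F d M (slice d c \<mu> s) j' = dyadic_sum F d M (slice d c \<mu> s) j" for s
      by (rule dyadic_sum_cong) (use \<mu> in \<open>auto simp: j'_def\<close>)
    have big: "1 / Z ^ (a * K) \<le> norm (dyadic_sum (insert \<mu> F) d M c j)" using j by (simp add: J_def big_pieces_def)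
    have "\<exists>s\<in>dyadic (M \<mu>) r. 1 / (2 * Z ^ (a * K)) \<le> norm (dyadic_sum F d M (slice d c \<mu> s) j')"
    proof (rule ccontr)
      assume "\<not> ?thesis"
      then have small: "\<And>s. s \<in> dyadic (M \<mu>) r \<Longrightarrow> norm (dyadic_sum F d M (slice d c \<mu> s) j) < 1 / (2 * Z ^ (a * K))"
        by (simp add: eq not_le)
      have ne: "dyadic (M \<mu>) r \<noteq> {}"
      proof
        assume "dyadic (M \<mu>) r = {}"
        then have "dyadic_sum (insert \<mu> F) d M c j = 0" unfolding dyadic_sum_insert(1)[OF F \<mu>] by (simp add: r_def)
        moreover have "0 < 1 / Z ^ (a * K)" using Z by simp
        ultimately show False using big by simp
      qed
      have "norm (dyadic_sum (insert \<mu> F) d M c j) \<le> (\<Sum>s\<in>dyadic (M \<mu>) r. norm (dyadic_sum F d M (slice d c \<mu> s) j)) / 2 ^ r"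
        unfolding r_def by (rule norm_dyadic_sum_slice[OF F \<mu>])
      also have "\<dots> < (\<Sum>s\<in>dyadic (M \<mu>) r. 1 / (2 * Z ^ (a * K))) / 2 ^ r"
        using ne small by (intro divide_strict_right_mono sum_strict_mono) auto
      also have "\<dots> = real (card (dyadic (M \<mu>) r)) * (1 / (2 * Z ^ (a * K))) / 2 ^ r" by simp
      also have "\<dots> \<le> real (2 * 2 ^ r) * (1 / (2 * Z ^ (a * K))) / 2 ^ r"
        using card_dyadic[of "M \<mu>" r] Z by (intro divide_right_mono mult_right_mono) (auto simp del: of_nat_mult of_nat_power)
      also have "\<dots> = 1 / Z ^ (a * K)" using Z by simp
      finally show False using big by simp
    qed
    then obtain s where s: "s \<in> dyadic (M \<mu>) r" "1 / (2 * Z ^ (a * K)) \<le> norm (dyadic_sum F d M (slice d c \<mu> s) j')" by blast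
    have "2 * Z ^ (a * K) \<le> Z' ^ K"
    proof -
      have "(2::real) \<le> 2 ^ K" using K power_increasing[of 1 K "2::real"] by simp
      then have "2 * (Z ^ a) ^ K \<le> 2 ^ K * (Z ^ a) ^ K" using Z by (intro mult_right_mono) auto
      then show ?thesis by (simp add: Z'_def power_mult_distrib power_mult)
    qed
    then have "1 / Z' ^ K \<le> 1 / (2 * Z ^ (a * K))" using Z Z' by (intro divide_left_mono) auto
    then have "1 / Z' ^ K \<le> norm (dyadic_sum F d M (slice d c \<mu> s) j')" using s(2) by linarith
    moreover have "\<kappa> \<notin> F \<Longrightarrow> j' \<kappa> = 0" for \<kappa> using j by (auto simp: j'_def J_def big_pieces_def)
    ultimately have "j' \<in> B s" by (simp add: B_def big_pieces_def)
    moreover have "s \<in> {- (2 * int n)..2 * int n}"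
    proof -
      have "\<bar>s\<bar> \<le> 2 * int (2 ^ r)" using s(1) by (simp add: dyadic_def)
      also have "\<dots> \<le> 2 * int n" using rn by (intro mult_left_mono) (auto simp only: of_nat_le_iff)
      finally show ?thesis by (simp add: abs_le_iff)
    qed
    moreover have "r < n" using rn less_exp[of r] by linarith
    moreover have "j'(\<mu> := r) = j" by (simp add: j'_def r_def)
    ultimately show "j \<in> (\<lambda>(r, s, j). j(\<mu> := r)) ` (SIGMA r:{..<n}. SIGMA s:{- (2 * int n)..2 * int n}. B s)"
      by (intro image_eqI[of _ _ "(r, s, j')"]) auto
  qed
  have fin: "finite (SIGMA r:{..<n}. SIGMA s:{- (2 * int n)..2 * int n}. B s)" using finB by auto
  have "card J \<le> card (SIGMA r:{..<n}. SIGMA s:{- (2 * int n)..2 * int n}. B s)"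
    using surj_card_le[OF fin sub] .
  also have "\<dots> = n * (\<Sum>s\<in>{- (2 * int n)..2 * int n}. card (B s))" using finB by (simp add: card_SigmaI)
  finally have "real (card J) \<le> real (n * (\<Sum>s\<in>{- (2 * int n)..2 * int n}. card (B s)))" by (rule of_nat_mono)
  then have "real (card J) * Z' \<le> real n * (\<Sum>s\<in>{- (2 * int n)..2 * int n}. real (card (B s)) * Z')"
    using Z' by (simp add: sum_distrib_right[symmetric] mult.assoc[symmetric] mult_right_mono)
  also have "\<dots> \<le> real n * (\<Sum>s\<in>{- (2 * int n)..2 * int n}. C * Z' ^ K)"
    using cB by (intro mult_left_mono sum_mono) auto
  also have "\<dots> = real n * (real (card {- (2 * int n)..2 * int n}) * (C * Z' ^ K))" by simp
  also have "\<dots> \<le> Z ^ \<tau> * (5 * Z ^ \<tau> * (C * Z' ^ K))"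
  proof (intro mult_mono mult_right_mono)
    have "card {- (2 * int n)..2 * int n} \<le> 5 * n" using n1 by simp
    then have "real (card {- (2 * int n)..2 * int n}) \<le> 5 * real n" by linarith
    then show "real (card {- (2 * int n)..2 * int n}) \<le> 5 * Z ^ \<tau>" using nZ by linarith
  qed (use nZ C Z Z' in auto)
  finally have fin: "real (card J) * Z' \<le> Z ^ \<tau> * (5 * Z ^ \<tau> * (C * Z' ^ K))" .
  have Z'K: "Z' ^ K = 2 ^ K * Z ^ (a * K)" by (simp add: Z'_def power_mult_distrib power_mult)
  have "real (card J) * (2 * Z ^ a) \<le> 5 * (C * 2 ^ K) * (Z ^ \<tau> * Z ^ \<tau> * Z ^ (a * K))"
    using fin unfolding Z'K unfolding Z'_def by (simp only: mult_ac)
  moreover have "0 \<le> real (card J) * Z ^ a" using Z by simp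
  ultimately have main: "real (card J) * Z ^ a \<le> 5 * (C * 2 ^ K) * (Z ^ \<tau> * Z ^ \<tau> * Z ^ (a * K))" by argo
  have "real (card J) * Z * Z ^ (2 * \<tau>) = real (card J) * Z ^ (2 * \<tau> + 1)" by simp
  also have "\<dots> \<le> real (card J) * Z ^ a" using a Z by (intro mult_left_mono power_increasing) auto
  also have "\<dots> \<le> 5 * (C * 2 ^ K) * (Z ^ \<tau> * Z ^ \<tau> * Z ^ (a * K))" by (rule main)
  also have "\<dots> = 5 * (C * 2 ^ K) * Z ^ (a * K) * Z ^ (2 * \<tau>)" by (simp add: mult_2 power_add)
  finally have "real (card J) * Z \<le> 5 * (C * 2 ^ K) * Z ^ (a * K)"
    by (rule mult_right_le_imp_le) (use Z in simp)
  also have "\<dots> \<le> 10 * C * 2 ^ K * Z ^ (a * K)" using C Z by (simp add: mult.assoc mult_right_mono)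
  finally show ?case by (simp add: J_def)
qed

text \<open>The level of \<open>\<mu>\<close> is fixed and its slices are compared. For most s the
  active scales of the slice coefficients lie near common centres w, so outside a few windows the
  slice pieces are below 1 / X and their total over j is O(1 / Z ^ 2) by \<open>tail_sum\<close>.
  The exceptional s form a proportion O(1 / Z ^ 2) and have bounded totals by
  \<open>total_sum\<close>. Averaging over s leaves few large j. It is essential that
  \<open>\<tau>\<close> is determined by the smaller index set alone, before K and u.\<close>

lemma medium_pieces:
  assumes F: "finite F" and \<mu>: "\<mu> \<notin> F" and few: "few_big F d K1 C1" and K1: "1 \<le> K1" and C1: "0 \<le> C1"
  shows "\<exists>\<tau>. \<forall>K u. card F + 2 \<le> K \<longrightarrow> (\<exists>B\<ge>0. \<forall>(Z::real) M c. 2 \<le> Z \<and> sparse_odd (insert \<mu> F) d c \<longrightarrow>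
    real (card {j\<in>big_pieces (insert \<mu> F) d M c (Z ^ K). (\<forall>\<kappa>\<in>insert \<mu> F. Z ^ \<tau> \<le> 2 ^ j \<kappa>) \<and> 2 ^ j \<mu> < (Z ^ K) ^ u}) * Z \<le> B * Z ^ K)"
proof -
  obtain D where act: "\<And>X M c j \<nu>. X \<ge> 2 \<Longrightarrow> \<forall>\<kappa>\<in>F. X ^ D \<le> 2 ^ j \<kappa> \<Longrightarrow> 1 / X \<le> norm (dyadic_sum F d M c j) \<Longrightarrow> \<nu> \<in> F
    \<Longrightarrow> \<exists>n\<in>exponents F d. odd (n \<nu>) \<and> c n \<noteq> 0 \<and> active (c n) (X ^ D) (2 ^ dot F n j)"
    by (rule exE[OF active_coefficients[OF F, of d]], rule that, elim allE, erule impE, (intro conjI; assumption), erule (1) bspec)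
  obtain S where scale: "\<forall>(X::real) N b. X \<ge> 2 \<and> N \<ge> 1 \<and> X ^ S \<le> real N \<longrightarrow>
    (\<exists>w E. E \<subseteq> {- 2 * int N..2 * int N} \<and> card E * X \<le> real N \<and>
      (\<forall>s\<in>{- 2 * int N..2 * int N} - E. \<forall>v. X ^ S \<le> 2 ^ v \<and> active (polyval d b s) (X ^ D) (2 ^ v)
        \<longrightarrow> v \<le> w \<and> 2 ^ w \<le> X ^ S * 2 ^ v))"
    using common_scale[of d D] by (rule exE)
  define \<tau> where "\<tau> = 2 * K1 * (D + S)"
  define k where "k = card F"
  define m where "m = card (exponents F d)"
  define b where "b = real m * (4 * real K1 * real S + 1)"
  define Ct where "Ct = C1 * 2 ^ K1 * 2 ^ k"
  define B2 where "B2 = real m * Ct + 2 * (C1 * 2 ^ K1)"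
  have nn: "0 \<le> b" "0 \<le> Ct" "0 \<le> B2" using C1 by (simp_all add: b_def Ct_def B2_def)
  show ?thesis
  proof (rule exI[of _ \<tau>], intro allI impI)
    fix K u assume K: "card F + 2 \<le> K"
    show "\<exists>B\<ge>0. \<forall>(Z::real) M c. 2 \<le> Z \<and> sparse_odd (insert \<mu> F) d c \<longrightarrow>
      real (card {j\<in>big_pieces (insert \<mu> F) d M c (Z ^ K). (\<forall>\<kappa>\<in>insert \<mu> F. Z ^ \<tau> \<le> 2 ^ j \<kappa>) \<and> 2 ^ j \<mu> < (Z ^ K) ^ u}) * Z \<le> B * Z ^ K"
    proof (rule exI[of _ "real K * real u * (b ^ k + B2)"], intro conjI allI impI, goal_cases)
      case 1
      then show ?case using nn by simp
    next
      case (2 Z M c)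
      then have Z: "2 \<le> Z" and c: "sparse_odd (insert \<mu> F) d c" by auto
      \<comment> \<open>Chosen so that 1 / X = 1 / (Z ^ 2) ^ K1 is the threshold of
        \<open>tail_sum\<close> for Z ^ 2. Of the two factors Z saved, one pays for the number of
        levels of \<open>\<mu>\<close> and the other is the one claimed.\<close>
      define X where "X = Z ^ (2 * K1)"
      have Z2X: "Z\<^sup>2 \<le> X" unfolding X_def using Z K1 by (intro power_increasing) auto
      have X: "2 \<le> X" unfolding X_def using Z K1 power_increasing[of 1 "2 * K1" Z] by simp
      obtain l where l: "Z \<le> 2 ^ l" "real l \<le> Z" using Z by (rule log_bound)
      define L where "L = 2 * K1 * S * l"
      have XL: "X ^ S \<le> 2 ^ L"
      proof -
        have "X ^ S = Z ^ (2 * K1 * S)" by (simp add: X_def power_mult)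
        also have "\<dots> \<le> (2 ^ l) ^ (2 * K1 * S)" using l Z by (intro power_mono) auto
        also have "\<dots> = 2 ^ L" unfolding power_mult[symmetric] L_def by (simp add: mult_ac)
        finally show ?thesis .
      qed
      have X\<tau>: "X ^ D \<le> Z ^ \<tau>" "X ^ S \<le> Z ^ \<tau>"
        unfolding X_def power_mult[symmetric] \<tau>_def using Z by (auto intro!: power_increasing mult_le_mono2)
      define \<Lambda> where "\<Lambda> = {n\<in>exponents F d. \<forall>\<nu> \<kappa>. odd (n \<nu>) \<and> odd (n \<kappa>) \<longrightarrow> \<nu> = \<kappa>}"
      have fin\<Lambda>: "finite \<Lambda>" using finite_exponents[OF F, of d] by (simp add: \<Lambda>_def)
      have c\<Lambda>: "card \<Lambda> \<le> m" unfolding m_def \<Lambda>_def using finite_exponents[OF F, of d] by (intro card_mono) auto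
      define J where "J = {j\<in>big_pieces (insert \<mu> F) d M c (Z ^ K). (\<forall>\<kappa>\<in>insert \<mu> F. Z ^ \<tau> \<le> 2 ^ j \<kappa>) \<and> 2 ^ j \<mu> < (Z ^ K) ^ u}"
      define Jr where "Jr r = {j\<in>J. j \<mu> = r}" for r
      have finJ: "finite J" unfolding J_def using finite_big_pieces[of "insert \<mu> F" "Z ^ K" d M c] F Z by simp
      have slab: "real (card (Jr r)) \<le> (b * Z) ^ k + B2 * Z ^ K / Z\<^sup>2" for r
      proof (cases "Jr r = {}")
        case True
        then show ?thesis using nn Z by simp
      next
        case False
        then obtain j0 where "j0 \<in> J" "j0 \<mu> = r" by (auto simp: Jr_def)
        then have Zr: "Z ^ \<tau> \<le> 2 ^ r" by (auto simp: J_def)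
        define N where "N = (2::nat) ^ r"
        have N: "1 \<le> N" "X ^ S \<le> real N" using X\<tau>(2) Zr by (simp_all add: N_def)
        have realN: "(2::real) ^ r = real N" by (simp add: N_def)
        have "\<forall>n. \<exists>w E. E \<subseteq> {- 2 * int N..2 * int N} \<and> card E * X \<le> real N \<and>
          (\<forall>s\<in>{- 2 * int N..2 * int N} - E. \<forall>v. X ^ S \<le> 2 ^ v \<and> active (slice d c \<mu> s n) (X ^ D) (2 ^ v)
            \<longrightarrow> v \<le> w \<and> 2 ^ w \<le> X ^ S * 2 ^ v)"
          unfolding slice_def using scale X N by blast
        then obtain w E where E: "\<And>n. E n \<subseteq> {- 2 * int N..2 * int N}" "\<And>n. card (E n) * X \<le> real N"
          and wE: "\<And>n s v. s \<in> {- 2 * int N..2 * int N} - E n \<Longrightarrow> X ^ S \<le> 2 ^ v \<Longrightarrow> active (slice d c \<mu> s n) (X ^ D) (2 ^ v)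
            \<Longrightarrow> v \<le> w n \<and> 2 ^ w n \<le> X ^ S * 2 ^ v"
          by metis
        define V where "V = dyadic (M \<mu>) r"
        have V: "V \<subseteq> {- 2 * int N..2 * int N}" using dyadic_subset[of "M \<mu>" r] by (auto simp: V_def N_def)
        define E' where "E' = (\<Union>n\<in>\<Lambda>. E n)"
        define T where "T = {j. (\<forall>\<kappa>. \<kappa> \<notin> F \<longrightarrow> j \<kappa> = 0) \<and> (\<forall>\<nu>\<in>F. \<exists>n\<in>\<Lambda>. odd (n \<nu>) \<and> \<bar>int (dot F n j) - int (w n)\<bar> \<le> int L)}"
        have one_odd: "\<nu> = \<kappa>" if "n \<in> \<Lambda>" "\<nu> \<in> F" "\<kappa> \<in> F" "odd (n \<nu>)" "odd (n \<kappa>)" for n \<nu> \<kappa>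
          using that by (auto simp: \<Lambda>_def)
        have finT: "finite T"
        proof (rule card_windows(1)[OF F fin\<Lambda>, where w=w and L=L])
          show "\<And>n \<nu> \<kappa>. n \<in> \<Lambda> \<Longrightarrow> \<nu> \<in> F \<Longrightarrow> \<kappa> \<in> F \<Longrightarrow> odd (n \<nu>) \<Longrightarrow> odd (n \<kappa>) \<Longrightarrow> \<nu> = \<kappa>" by (rule one_odd)
        qed (simp add: T_def)
        have "card T \<le> (card \<Lambda> * (2 * L + 1)) ^ card F"
        proof (rule card_windows(2)[OF F fin\<Lambda>, where w=w and L=L])
          show "\<And>n \<nu> \<kappa>. n \<in> \<Lambda> \<Longrightarrow> \<nu> \<in> F \<Longrightarrow> \<kappa> \<in> F \<Longrightarrow> odd (n \<nu>) \<Longrightarrow> odd (n \<kappa>) \<Longrightarrow> \<nu> = \<kappa>" by (rule one_odd)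
        qed (simp add: T_def)
        then have "real (card T) \<le> real ((card \<Lambda> * (2 * L + 1)) ^ card F)" by (rule of_nat_mono)
        also have "\<dots> = (real (card \<Lambda>) * (2 * real L + 1)) ^ k" by (simp add: k_def algebra_simps)
        also have "\<dots> \<le> (b * Z) ^ k"
        proof (rule power_mono)
          have "2 * real L + 1 \<le> (4 * real K1 * real S + 1) * Z"
          proof -
            have "real L = 2 * real K1 * real S * real l" by (simp add: L_def)
            also have "\<dots> \<le> 2 * real K1 * real S * Z" using l by (intro mult_left_mono) auto
            finally show ?thesis using Z by (simp add: algebra_simps)
          qed
          then have "real (card \<Lambda>) * (2 * real L + 1) \<le> real m * ((4 * real K1 * real S + 1) * Z)"
            using c\<Lambda> by (intro mult_mono) auto
          then show "real (card \<Lambda>) * (2 * real L + 1) \<le> b * Z" by (simp add: b_def mult.assoc)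
        qed simp
        finally have cT: "real (card T) \<le> (b * Z) ^ k" .
        define f where "f s j = norm (dyadic_sum F d M (slice d c \<mu> s) j)" for s j
        define P where "P = (\<lambda>j. j(\<mu> := 0)) ` Jr r"
        have finP: "finite P" unfolding P_def Jr_def using finJ by simp
        have "inj_on (\<lambda>j. j(\<mu> := 0)) (Jr r)"
        proof (rule inj_onI)
          fix j j' assume "j \<in> Jr r" "j' \<in> Jr r" "j(\<mu> := 0) = j'(\<mu> := 0)"
          then show "j = j'" by (metis (mono_tags, lifting) Jr_def fun_upd_triv fun_upd_upd mem_Collect_eq)
        qed
        then have cP: "card P = card (Jr r)" unfolding P_def by (rule card_image)
        have Pprop: "(\<forall>\<kappa>. \<kappa> \<notin> F \<longrightarrow> j \<kappa> = 0) \<and> (\<forall>\<kappa>\<in>F. Z ^ \<tau> \<le> 2 ^ j \<kappa>) \<and> 1 / Z ^ K \<le> (\<Sum>s\<in>V. f s j) / N"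
          if j: "j \<in> P" for j
        proof -
          obtain i where i: "i \<in> J" "i \<mu> = r" "j = i(\<mu> := 0)" using j by (auto simp: P_def Jr_def)
          have eq: "dyadic_sum F d M c' j = dyadic_sum F d M c' i" for c'
            by (rule dyadic_sum_cong) (use \<mu> i in auto)
          have "1 / Z ^ K \<le> norm (dyadic_sum (insert \<mu> F) d M c i)" using i by (simp add: J_def big_pieces_def)
          also have "\<dots> \<le> (\<Sum>s\<in>V. f s j) / N"
            using norm_dyadic_sum_slice[OF F \<mu>, of d M c i] by (simp add: V_def f_def eq i(2) N_def)
          finally show ?thesis using i \<mu> by (auto simp: J_def big_pieces_def)
        qed
        \<comment> \<open>The pieces outside the windows are not counted directly: each contributes
          at least 1 / Z ^ K to the average of its slices, and the average is bounded after
          exchanging the sums over s and j.\<close>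
        define Q where "Q = P - T"
        have finQ: "finite Q" using finP by (simp add: Q_def)
        have small: "f s j < 1 / X" if s: "s \<in> V - E'" and j: "j \<in> Q" for s j
        proof (rule ccontr)
          assume "\<not> f s j < 1 / X"
          then have big: "1 / X \<le> norm (dyadic_sum F d M (slice d c \<mu> s) j)" by (simp add: f_def)
          have jP: "j \<in> P" using j by (simp add: Q_def)
          have "\<forall>\<kappa>\<in>F. X ^ D \<le> 2 ^ j \<kappa>" using Pprop[OF jP] X\<tau>(1) order_trans by blast
          note act' = act[OF X this big]
          have "\<exists>n\<in>\<Lambda>. odd (n \<nu>) \<and> \<bar>int (dot F n j) - int (w n)\<bar> \<le> int L" if \<nu>: "\<nu> \<in> F" for \<nu>
          proof -
            obtain n where n: "n \<in> exponents F d" "odd (n \<nu>)" "slice d c \<mu> s n \<noteq> 0" "active (slice d c \<mu> s n) (X ^ D) (2 ^ dot F n j)"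
              using act'[OF \<nu>] by blast
            have n\<Lambda>: "n \<in> \<Lambda>" using n(1,3) sparse_odd_slice[OF c \<mu>, of s] unfolding \<Lambda>_def sparse_odd_def by blast
            have "X ^ S \<le> 2 ^ j \<nu>" using Pprop[OF jP] X\<tau>(2) \<nu> order_trans by blast
            also have "\<dots> \<le> 2 ^ dot F n j" using dot_ge[of F \<nu> n j, OF F \<nu> n(2)] by (intro power_increasing) auto
            finally have XS: "X ^ S \<le> 2 ^ dot F n j" .
            have "s \<in> {- 2 * int N..2 * int N} - E n" using s V n\<Lambda> by (auto simp: E'_def)
            from wE[OF this XS n(4)] have le: "dot F n j \<le> w n" and le2: "2 ^ w n \<le> X ^ S * 2 ^ dot F n j" by auto
            note le2
            also have "X ^ S * 2 ^ dot F n j \<le> 2 ^ L * 2 ^ dot F n j" using XL by (intro mult_right_mono) auto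
            finally have "(2::real) ^ w n \<le> 2 ^ (L + dot F n j)" by (simp add: power_add)
            then have "w n \<le> L + dot F n j" by simp
            then show ?thesis using n\<Lambda> n(2) le by (intro bexI[of _ n]) auto
          qed
          then have "j \<in> T" using Pprop[OF jP] by (simp add: T_def)
          then show False using j by (simp add: Q_def)
        qed
        have column: "(\<Sum>j\<in>Q. f s j) \<le> Ct * of_bool (s \<in> E') + C1 * 2 ^ K1 / Z\<^sup>2" if s: "s \<in> V" for s
        proof (cases "s \<in> E'")
          case True
          have "(\<Sum>j\<in>Q. f s j) \<le> Ct" unfolding f_def Ct_def k_def
            by (rule total_sum[OF few F K1 sparse_odd_slice[OF c \<mu>] finQ]) (use Pprop in \<open>auto simp: Q_def\<close>)
          moreover have "0 \<le> C1 * 2 ^ K1 / Z\<^sup>2" using C1 by simp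
          ultimately show ?thesis using True by simp
        next
          case False
          have "2 \<le> Z\<^sup>2" using Z power_increasing[of 1 2 Z] by simp
          have "(\<Sum>j\<in>Q. f s j) \<le> C1 * 2 ^ K1 / Z\<^sup>2" unfolding f_def
          proof (rule tail_sum[OF few F K1 \<open>2 \<le> Z\<^sup>2\<close> sparse_odd_slice[OF c \<mu>] finQ])
            show "\<And>j \<kappa>. j \<in> Q \<Longrightarrow> \<kappa> \<notin> F \<Longrightarrow> j \<kappa> = 0" using Pprop by (auto simp: Q_def)
            show "norm (dyadic_sum F d M (slice d c \<mu> s) j) < 1 / (Z\<^sup>2) ^ K1" if "j \<in> Q" for j
              using small[of s j] s False that by (simp add: f_def X_def power_mult)
          qed
          then show ?thesis using False by simp
        qed
        have cE: "real (card (V \<inter> E')) * X \<le> real m * N"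
        proof -
          have finE: "finite (E n)" for n using E(1) finite_subset by blast
          have "card (V \<inter> E') \<le> card E'" unfolding E'_def using fin\<Lambda> finE by (intro card_mono) auto
          also have "\<dots> \<le> (\<Sum>n\<in>\<Lambda>. card (E n))" unfolding E'_def by (rule card_UN_le[OF fin\<Lambda>])
          finally have "real (card (V \<inter> E')) \<le> (\<Sum>n\<in>\<Lambda>. real (card (E n)))" by (metis of_nat_le_iff of_nat_sum)
          then have "real (card (V \<inter> E')) * X \<le> (\<Sum>n\<in>\<Lambda>. real (card (E n))) * X" using X by (intro mult_right_mono) auto
          also have "\<dots> \<le> (\<Sum>n\<in>\<Lambda>. real N)" unfolding sum_distrib_right by (intro sum_mono E(2))
          also have "\<dots> \<le> real m * N" using c\<Lambda> by (simp add: mult_right_mono)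
          finally show ?thesis .
        qed
        have cV: "real (card V) \<le> 2 * real N"
          using card_dyadic[of "M \<mu>" r] unfolding V_def N_def by (metis of_nat_le_iff of_nat_mult of_nat_numeral)
        have finV: "finite V" by (simp add: V_def)
        have "real (card Q) * (1 / Z ^ K) = (\<Sum>j\<in>Q. 1 / Z ^ K)" by simp
        also have "\<dots> \<le> (\<Sum>j\<in>Q. (\<Sum>s\<in>V. f s j) / N)" using Pprop by (intro sum_mono) (auto simp: Q_def)
        also have "\<dots> = (\<Sum>s\<in>V. \<Sum>j\<in>Q. f s j) / N" unfolding sum_divide_distrib[symmetric] by (subst sum.swap) simp
        also have "\<dots> \<le> (\<Sum>s\<in>V. Ct * of_bool (s \<in> E') + C1 * 2 ^ K1 / Z\<^sup>2) / N"
          using column by (intro divide_right_mono sum_mono) auto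
        also have "\<dots> = (Ct * real (card (V \<inter> E')) + real (card V) * (C1 * 2 ^ K1 / Z\<^sup>2)) / N"
          using finV by (simp add: sum.distrib sum_distrib_left[symmetric] Int_def)
        also have "\<dots> \<le> (Ct * (real m * N / Z\<^sup>2) + 2 * real N * (C1 * 2 ^ K1 / Z\<^sup>2)) / N"
        proof (intro divide_right_mono add_mono mult_left_mono mult_right_mono)
          have "real (card (V \<inter> E')) \<le> real m * N / X" using cE X by (simp add: pos_le_divide_eq)
          also have "\<dots> \<le> real m * N / Z\<^sup>2" using Z2X Z X by (intro divide_left_mono) auto
          finally show "real (card (V \<inter> E')) \<le> real m * N / Z\<^sup>2" .
        qed (use cV nn C1 Z in auto)
        also have "\<dots> = B2 / Z\<^sup>2" using N(1) by (simp add: B2_def add_divide_distrib mult.commute)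
        finally have "real (card Q) \<le> B2 / Z\<^sup>2 * Z ^ K" using Z by (simp add: divide_le_eq)
        moreover have "card (Jr r) \<le> card T + card Q"
        proof -
          have "card (Jr r) \<le> card (T \<union> Q)" unfolding cP[symmetric] using finT finQ by (intro card_mono) (auto simp: Q_def)
          also have "\<dots> \<le> card T + card Q" by (rule card_Un_le)
          finally show ?thesis .
        qed
        ultimately show ?thesis using cT by simp
      qed
      \<comment> \<open>Because 2 ^ r < (Z ^ K) ^ u, only O(log Z) levels of \<open>\<mu>\<close>
        occur.\<close>
      define R where "R = l * K * u"
      have "J \<subseteq> (\<Union>r<R. Jr r)"
      proof
        fix j assume j: "j \<in> J"
        have "2 ^ j \<mu> < (Z ^ K) ^ u" using j by (simp add: J_def)
        also have "\<dots> = Z ^ (K * u)" by (simp add: power_mult)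
        also have "\<dots> \<le> (2 ^ l) ^ (K * u)" using l Z by (intro power_mono) auto
        also have "\<dots> = 2 ^ R" unfolding R_def power_mult[symmetric] by (simp add: mult.assoc)
        finally have "j \<mu> < R" by simp
        then show "j \<in> (\<Union>r<R. Jr r)" using j by (auto simp: Jr_def)
      qed
      then have "card J \<le> card (\<Union>r<R. Jr r)" using finJ by (intro card_mono) (auto simp: Jr_def)
      also have "\<dots> \<le> (\<Sum>r<R. card (Jr r))" by (rule card_UN_le) simp
      finally have "real (card J) \<le> (\<Sum>r<R. real (card (Jr r)))" by (metis of_nat_le_iff of_nat_sum)
      also have "\<dots> \<le> (\<Sum>r<R. (b * Z) ^ k + B2 * Z ^ K / Z\<^sup>2)" by (intro sum_mono slab)
      also have "\<dots> = real R * ((b * Z) ^ k + B2 * Z ^ K / Z\<^sup>2)" by simp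
      also have "\<dots> \<le> (real K * real u * Z) * ((b * Z) ^ k + B2 * Z ^ K / Z\<^sup>2)"
      proof (rule mult_right_mono)
        have "real R = real K * real u * real l" by (simp add: R_def)
        also have "\<dots> \<le> real K * real u * Z" using l by (intro mult_left_mono) auto
        finally show "real R \<le> real K * real u * Z" .
      qed (use nn Z in simp)
      finally have "real (card J) * Z \<le> (real K * real u * Z) * ((b * Z) ^ k + B2 * Z ^ K / Z\<^sup>2) * Z"
        using Z by (intro mult_right_mono) auto
      also have "\<dots> = real K * real u * (b ^ k * Z ^ (k + 2) + B2 * Z ^ K)"
        using Z by (simp add: power_mult_distrib power2_eq_square distrib_left distrib_right)
      also have "\<dots> \<le> real K * real u * (b ^ k * Z ^ K + B2 * Z ^ K)"
        using K Z nn by (intro mult_left_mono add_right_mono power_increasing) (auto simp: k_def)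
      also have "\<dots> = real K * real u * (b ^ k + B2) * Z ^ K" by (simp add: algebra_simps)
      finally show ?case by (simp add: J_def)
    qed
  qed
qed

lemma few_big_empty: "few_big ({} :: 'k set) d 1 1"
  unfolding few_big_def
proof (intro allI impI, elim conjE)
  fix M :: "'k \<Rightarrow> nat" and c and Z :: real assume Z: "2 \<le> Z"
  have "big_pieces {} d M c (Z ^ 1) \<subseteq> {\<lambda>_. 0}" by (auto simp: big_pieces_def)
  then have "card (big_pieces {} d M c (Z ^ 1)) \<le> card {\<lambda>_::'k. 0::nat}" by (intro card_mono) simp_all
  then have "card (big_pieces {} d M c (Z ^ 1)) \<le> 1" by simp
  then have "real (card (big_pieces {} d M c (Z ^ 1))) * Z \<le> 1 * Z" using Z by (intro mult_right_mono) auto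
  then show "real (card (big_pieces {} d M c (Z ^ 1))) * Z \<le> 1 * Z ^ 1" by simp
qed

text \<open>The order of the choices is decisive: u and the thresholds of the medium pieces serve
  every later K, \<open>\<tau>\<close> dominates these thresholds, and only then is a, and with it K
  = a * K1, taken large enough to pay for sides up to Z ^ \<tau>. A piece that is neither large nor
  tiny has a side in the medium range.\<close>

lemma few_big_exists:
  assumes "finite F"
  shows "\<exists>K C. 1 \<le> K \<and> 0 \<le> C \<and> few_big F d K C"
  using assms
proof (induction F rule: finite_psubset_induct)
  case (psubset F)
  note F = psubset.hyps(1)
  show ?case
  proof (cases "F = {}")
    case True
    then show ?thesis using few_big_empty[of d] by (intro exI[of _ 1] exI[of _ "1::real"]) simp
  next
    case False
    define k where "k = card F"
    have "\<exists>K C. 1 \<le> K \<and> 0 \<le> C \<and> few_big (F - {\<mu>}) d K C" if "\<mu> \<in> F" for \<mu>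
      using that by (intro psubset.IH) auto
    then obtain K0 C0 where KC: "\<And>\<mu>. \<mu> \<in> F \<Longrightarrow> 1 \<le> K0 \<mu> \<and> 0 \<le> C0 \<mu> \<and> few_big (F - {\<mu>}) d (K0 \<mu>) (C0 \<mu>)" by metis
    \<comment> \<open>A product, since \<open>few_big_multiple\<close> passes to multiples of each
      \<open>K0 \<mu>\<close>.\<close>
    define K1 where "K1 = prod K0 F"
    define C1 where "C1 = sum C0 F"
    have K1: "1 \<le> K1" unfolding K1_def using KC by (intro prod_ge_1) auto
    have C1: "0 \<le> C1" unfolding C1_def using KC by (intro sum_nonneg) auto
    have few: "few_big (F - {\<mu>}) d K1 C1" if \<mu>: "\<mu> \<in> F" for \<mu>
    proof -
      have "K1 = prod K0 (F - {\<mu>}) * K0 \<mu>" unfolding K1_def using F \<mu> by (simp add: prod.remove mult.commute)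
      moreover have "1 \<le> prod K0 (F - {\<mu>})" using KC by (intro prod_ge_1) auto
      moreover have "C0 \<mu> \<le> C1" unfolding C1_def using F \<mu> KC by (intro member_le_sum) auto
      ultimately show ?thesis using few_big_multiple[of "F - {\<mu>}" d "K0 \<mu>" "C0 \<mu>" "prod K0 (F - {\<mu>})" C1] KC[OF \<mu>] by simp
    qed
    have ins: "insert \<mu> (F - {\<mu>}) = F" and cardF: "card (F - {\<mu>}) + 1 = k" if "\<mu> \<in> F" for \<mu>
      using that F card.remove[OF F that] by (auto simp: k_def)
    obtain u where large: "\<forall>K\<ge>k + 1. \<exists>B\<ge>0. \<forall>(Z::real) M c. 2 \<le> Z \<and> sparse_odd F d c \<longrightarrow>
      real (card {j\<in>big_pieces F d M c (Z ^ K). \<forall>\<kappa>\<in>F. (Z ^ K) ^ u \<le> 2 ^ j \<kappa>}) * Z \<le> B * Z ^ K"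
      using large_pieces[OF F, of d] unfolding k_def by blast
    have "\<forall>\<mu>\<in>F. \<exists>\<tau>. \<forall>K u. k + 1 \<le> K \<longrightarrow> (\<exists>B\<ge>0. \<forall>(Z::real) M c. 2 \<le> Z \<and> sparse_odd F d c \<longrightarrow>
      real (card {j\<in>big_pieces F d M c (Z ^ K). (\<forall>\<kappa>\<in>F. Z ^ \<tau> \<le> 2 ^ j \<kappa>) \<and> 2 ^ j \<mu> < (Z ^ K) ^ u}) * Z \<le> B * Z ^ K)"
    proof
      fix \<mu> assume \<mu>: "\<mu> \<in> F"
      have fin: "finite (F - {\<mu>})" "\<mu> \<notin> F - {\<mu>}" using F by auto
      have c2: "card (F - {\<mu>}) + 2 = k + 1" using cardF[OF \<mu>] by simp
      show "\<exists>\<tau>. \<forall>K u. k + 1 \<le> K \<longrightarrow> (\<exists>B\<ge>0. \<forall>(Z::real) M c. 2 \<le> Z \<and> sparse_odd F d c \<longrightarrow>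
        real (card {j\<in>big_pieces F d M c (Z ^ K). (\<forall>\<kappa>\<in>F. Z ^ \<tau> \<le> 2 ^ j \<kappa>) \<and> 2 ^ j \<mu> < (Z ^ K) ^ u}) * Z \<le> B * Z ^ K)"
        using medium_pieces[OF fin few[OF \<mu>] K1 C1] unfolding ins[OF \<mu>] c2 .
    qed
    from bchoice[OF this] obtain t where med: "\<forall>\<mu>\<in>F. \<forall>K u. k + 1 \<le> K \<longrightarrow> (\<exists>B\<ge>0. \<forall>(Z::real) M c. 2 \<le> Z \<and> sparse_odd F d c \<longrightarrow>
      real (card {j\<in>big_pieces F d M c (Z ^ K). (\<forall>\<kappa>\<in>F. Z ^ t \<mu> \<le> 2 ^ j \<kappa>) \<and> 2 ^ j \<mu> < (Z ^ K) ^ u}) * Z \<le> B * Z ^ K)"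
      by (rule exE)
    define \<tau> where "\<tau> = sum t F"
    define a where "a = 2 * \<tau> + 1 + (k + 1)"
    define K where "K = a * K1"
    have aK: "a \<le> K" using K1 by (simp add: K_def)
    have K: "1 \<le> K" "k + 1 \<le> K" using aK by (simp_all add: a_def)
    obtain B0 where B0: "0 \<le> B0" "\<forall>(Z::real) M c. 2 \<le> Z \<and> sparse_odd F d c \<longrightarrow>
      real (card {j\<in>big_pieces F d M c (Z ^ K). \<forall>\<kappa>\<in>F. (Z ^ K) ^ u \<le> 2 ^ j \<kappa>}) * Z \<le> B0 * Z ^ K"
      using large K(2) by blast
    have "\<forall>\<mu>\<in>F. \<exists>B\<ge>0. \<forall>(Z::real) M c. 2 \<le> Z \<and> sparse_odd F d c \<longrightarrow>
      real (card {j\<in>big_pieces F d M c (Z ^ K). (\<forall>\<kappa>\<in>F. Z ^ t \<mu> \<le> 2 ^ j \<kappa>) \<and> 2 ^ j \<mu> < (Z ^ K) ^ u}) * Z \<le> B * Z ^ K"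
      using med K(2) by blast
    from bchoice[OF this] obtain B1 where B1: "\<forall>\<mu>\<in>F. 0 \<le> B1 \<mu> \<and> (\<forall>(Z::real) M c. 2 \<le> Z \<and> sparse_odd F d c \<longrightarrow>
      real (card {j\<in>big_pieces F d M c (Z ^ K). (\<forall>\<kappa>\<in>F. Z ^ t \<mu> \<le> 2 ^ j \<kappa>) \<and> 2 ^ j \<mu> < (Z ^ K) ^ u}) * Z \<le> B1 \<mu> * Z ^ K)"
      by (rule exE)
    have "\<forall>\<mu>\<in>F. \<exists>B\<ge>0. \<forall>(Z::real) M c. 2 \<le> Z \<and> sparse_odd F d c \<longrightarrow>
      real (card {j\<in>big_pieces F d M c (Z ^ K). 2 ^ j \<mu> < Z ^ \<tau>}) * Z \<le> B * Z ^ K"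
    proof
      fix \<mu> assume \<mu>: "\<mu> \<in> F"
      show "\<exists>B\<ge>0. \<forall>(Z::real) M c. 2 \<le> Z \<and> sparse_odd F d c \<longrightarrow>
        real (card {j\<in>big_pieces F d M c (Z ^ K). 2 ^ j \<mu> < Z ^ \<tau>}) * Z \<le> B * Z ^ K"
        using tiny_pieces[of "F - {\<mu>}" \<mu> d K1 C1 \<tau> a] F few[OF \<mu>] K1 C1 unfolding ins[OF \<mu>] K_def a_def by simp
    qed
    from bchoice[OF this] obtain B2 where B2: "\<forall>\<mu>\<in>F. 0 \<le> B2 \<mu> \<and> (\<forall>(Z::real) M c. 2 \<le> Z \<and> sparse_odd F d c \<longrightarrow>
      real (card {j\<in>big_pieces F d M c (Z ^ K). 2 ^ j \<mu> < Z ^ \<tau>}) * Z \<le> B2 \<mu> * Z ^ K)"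
      by (rule exE)
    define B where "B = B0 + (\<Sum>\<mu>\<in>F. B1 \<mu> + B2 \<mu>)"
    have "few_big F d K B"
      unfolding few_big_def
    proof (intro allI impI, elim conjE)
      fix M c and Z :: real assume Z: "2 \<le> Z" and c: "sparse_odd F d c"
      let ?J = "big_pieces F d M c (Z ^ K)"
      define J0 where "J0 = {j\<in>?J. \<forall>\<kappa>\<in>F. (Z ^ K) ^ u \<le> 2 ^ j \<kappa>}"
      define J1 where "J1 \<mu> = {j\<in>?J. (\<forall>\<kappa>\<in>F. Z ^ t \<mu> \<le> 2 ^ j \<kappa>) \<and> 2 ^ j \<mu> < (Z ^ K) ^ u}" for \<mu>
      define J2 where "J2 \<mu> = {j\<in>?J. 2 ^ j \<mu> < Z ^ \<tau>}" for \<mu>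
      have fin: "finite ?J" using Z by (intro finite_big_pieces[OF F]) simp
      have "?J \<subseteq> J0 \<union> (\<Union>\<mu>\<in>F. J1 \<mu> \<union> J2 \<mu>)"
      proof
        fix j assume j: "j \<in> ?J"
        show "j \<in> J0 \<union> (\<Union>\<mu>\<in>F. J1 \<mu> \<union> J2 \<mu>)"
        proof (rule ccontr)
          assume no: "\<not> ?thesis"
          then obtain \<mu> where \<mu>: "\<mu> \<in> F" "2 ^ j \<mu> < (Z ^ K) ^ u" using j by (auto simp: J0_def not_le)
          have "Z ^ \<tau> \<le> 2 ^ j \<kappa>" if "\<kappa> \<in> F" for \<kappa> using no j that by (auto simp: J2_def not_less)
          moreover have "Z ^ t \<mu> \<le> Z ^ \<tau>"
            unfolding \<tau>_def using Z F \<mu> by (intro power_increasing member_le_sum) auto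
          ultimately have "j \<in> J1 \<mu>" using j \<mu> by (fastforce simp: J1_def)
          then show False using no \<mu> by blast
        qed
      qed
      then have "card ?J \<le> card (J0 \<union> (\<Union>\<mu>\<in>F. J1 \<mu> \<union> J2 \<mu>))"
        using fin F by (intro card_mono) (auto simp: J0_def J1_def J2_def)
      also have "\<dots> \<le> card J0 + (\<Sum>\<mu>\<in>F. card (J1 \<mu> \<union> J2 \<mu>))"
        by (intro order_trans[OF card_Un_le] add_left_mono card_UN_le F)
      also have "\<dots> \<le> card J0 + (\<Sum>\<mu>\<in>F. card (J1 \<mu>) + card (J2 \<mu>))"
        by (intro add_left_mono sum_mono card_Un_le)
      finally have "real (card ?J) \<le> real (card J0 + (\<Sum>\<mu>\<in>F. card (J1 \<mu>) + card (J2 \<mu>)))" by (rule of_nat_mono)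
      then have "real (card ?J) \<le> real (card J0) + (\<Sum>\<mu>\<in>F. real (card (J1 \<mu>)) + real (card (J2 \<mu>)))" by simp
      then have "real (card ?J) * Z \<le> (real (card J0) + (\<Sum>\<mu>\<in>F. real (card (J1 \<mu>)) + real (card (J2 \<mu>)))) * Z"
        using Z by (intro mult_right_mono) auto
      also have "\<dots> = real (card J0) * Z + (\<Sum>\<mu>\<in>F. real (card (J1 \<mu>)) * Z + real (card (J2 \<mu>)) * Z)"
        by (simp add: distrib_right sum_distrib_right)
      also have "\<dots> \<le> B0 * Z ^ K + (\<Sum>\<mu>\<in>F. B1 \<mu> * Z ^ K + B2 \<mu> * Z ^ K)"
        unfolding J0_def J1_def J2_def using B0 B1 B2 Z c by (intro add_mono sum_mono) auto
      also have "\<dots> = B * Z ^ K" by (simp add: B_def distrib_right sum_distrib_right)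
      finally show "real (card ?J) * Z \<le> B * Z ^ K" .
    qed
    moreover have "0 \<le> B" unfolding B_def using B0 B1 B2 by (intro add_nonneg_nonneg sum_nonneg) auto
    ultimately show ?thesis using K(1) by blast
  qed
qed

lemma dyadic_sums_bounded:
  assumes F: "finite F"
  obtains C where "\<And>M c J. sparse_odd F d c \<Longrightarrow> finite J \<Longrightarrow> (\<And>j \<kappa>. j \<in> J \<Longrightarrow> \<kappa> \<notin> F \<Longrightarrow> j \<kappa> = 0)
    \<Longrightarrow> (\<Sum>j\<in>J. norm (dyadic_sum F d M c j)) \<le> C"
proof -
  obtain K C where K: "1 \<le> K" and few: "few_big F d K C" using few_big_exists[OF F, of d] by blast
  show thesis by (rule that[of "C * 2 ^ K * 2 ^ card F"], rule total_sum[OF few F K])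
qed

subsection \<open>The uniform upper bound\<close>

lemma exp_eq_echar: "exp (2 * of_real pi * \<i> * of_real x) = echar x"
  by (simp add: echar_def cis_conv_exp mult_ac)

lemma hilbert_sum_eq_mpoly:
  fixes \<Lambda> :: "(nat ^ 'k::finite) set" and \<xi> :: "nat ^ 'k \<Rightarrow> real"
  assumes "finite \<Lambda>" "\<And>m \<nu>. m \<in> \<Lambda> \<Longrightarrow> m $ \<nu> \<le> d"
  defines "c \<equiv> \<lambda>n. if vec_lambda n \<in> \<Lambda> then \<xi> (vec_lambda n) else 0"
  shows "(\<Sum>m\<in>\<Lambda>. \<xi> m * of_int (monomial t m)) = mpoly UNIV d c (vec_nth t)"
proof -
  have "mpoly UNIV d c (vec_nth t) = (\<Sum>n\<in>vec_nth ` \<Lambda>. c n * (\<Prod>\<kappa>\<in>UNIV. of_int (t $ \<kappa>) ^ n \<kappa>))"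
    unfolding mpoly_def
  proof (rule sum.mono_neutral_right)
    show "finite (exponents (UNIV :: 'k set) d)" by (rule finite_exponents) simp
    show "vec_nth ` \<Lambda> \<subseteq> exponents UNIV d" using assms(2) by (auto simp: boxfun_def)
    show "\<forall>n\<in>exponents UNIV d - vec_nth ` \<Lambda>. c n * (\<Prod>\<kappa>\<in>UNIV. of_int (t $ \<kappa>) ^ n \<kappa>) = 0"
    proof
      fix n assume "n \<in> exponents UNIV d - vec_nth ` \<Lambda>"
      then have "vec_lambda n \<notin> \<Lambda>" by (metis Diff_iff UNIV_I image_eqI vec_lambda_inverse)
      then show "c n * (\<Prod>\<kappa>\<in>UNIV. of_int (t $ \<kappa>) ^ n \<kappa>) = 0" by (simp add: c_def)
    qed
  qed
  also have "\<dots> = (\<Sum>m\<in>\<Lambda>. c (vec_nth m) * (\<Prod>\<kappa>\<in>UNIV. of_int (t $ \<kappa>) ^ (m $ \<kappa>)))"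
    by (subst sum.reindex) (auto simp: inj_on_def vec_nth_inject)
  also have "\<dots> = (\<Sum>m\<in>\<Lambda>. \<xi> m * of_int (monomial t m))"
    by (rule sum.cong) (auto simp: c_def monomial_def)
  finally show ?thesis by simp
qed

lemma sum_summation_box:
  fixes N :: "nat ^ 'k::finite" and g :: "int ^ 'k \<Rightarrow> complex"
  shows "sum g (summation_box N) = (\<Sum>j\<in>boxfun UNIV (\<lambda>\<kappa>. {..N $ \<kappa>}).
    \<Sum>t\<in>boxfun UNIV (\<lambda>\<kappa>. dyadic (N $ \<kappa>) (j \<kappa>)). g (vec_lambda t))"
proof -
  have "\<exists>l. z \<noteq> 0 \<longrightarrow> 2 ^ l \<le> \<bar>z\<bar> \<and> \<bar>z\<bar> < 2 ^ (l + 1)" for z :: int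
  proof (cases "z = 0")
    case False
    then have "1 \<le> nat \<bar>z\<bar>" by linarith
    then obtain l where "2 ^ l \<le> nat \<bar>z\<bar>" "nat \<bar>z\<bar> < 2 ^ (l + 1)"
      using ex_power_ivl1[of 2 "nat \<bar>z\<bar>"] by blast
    then have "int (2 ^ l) \<le> \<bar>z\<bar>" "\<bar>z\<bar> < int (2 ^ (l + 1))" by linarith+
    then show ?thesis by (intro exI[of _ l]) simp
  qed simp
  \<comment> \<open>The dyadic level of an integer. Its value at 0 is arbitrary, as no point of the
    box has a zero coordinate.\<close>
  then obtain lv where lv: "\<And>z :: int. z \<noteq> 0 \<Longrightarrow> 2 ^ lv z \<le> \<bar>z\<bar> \<and> \<bar>z\<bar> < 2 ^ (lv z + 1)" by metis
  have dy: "z \<in> dyadic M j \<longleftrightarrow> z \<noteq> 0 \<and> \<bar>z\<bar> \<le> int M \<and> lv z = j" for z M j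
  proof
    assume z: "z \<in> dyadic M j"
    then have nz: "z \<noteq> 0" by (rule dyadic_ne_zero)
    have "(2::int) ^ lv z < 2 ^ (j + 1)" "(2::int) ^ j < 2 ^ (lv z + 1)"
      using lv[OF nz] z by (auto simp: dyadic_def)
    then have "lv z < j + 1" "j < lv z + 1" by (simp_all only: power_strict_increasing_iff)
    then show "z \<noteq> 0 \<and> \<bar>z\<bar> \<le> int M \<and> lv z = j" using nz z by (auto simp: dyadic_def)
  qed (use lv in \<open>auto simp: dyadic_def\<close>)
  define h where "h t = (\<lambda>\<kappa>. lv (t $ \<kappa>))" for t :: "int ^ 'k"
  let ?J = "boxfun UNIV (\<lambda>\<kappa>. {..N $ \<kappa>})"
  have box: "t \<in> summation_box N \<longleftrightarrow> (\<forall>\<kappa>. t $ \<kappa> \<noteq> 0 \<and> \<bar>t $ \<kappa>\<bar> \<le> int (N $ \<kappa>))" for t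
  proof -
    have "1 \<le> \<bar>z\<bar> \<longleftrightarrow> z \<noteq> 0" for z :: int by arith
    then show ?thesis by (simp add: summation_box_def)
  qed
  have "h ` summation_box N \<subseteq> ?J"
  proof
    fix j assume "j \<in> h ` summation_box N"
    then obtain t where t: "t \<in> summation_box N" "j = h t" by blast
    have "j \<kappa> \<le> N $ \<kappa>" for \<kappa>
    proof -
      have "2 ^ j \<kappa> \<le> \<bar>t $ \<kappa>\<bar>" "\<bar>t $ \<kappa>\<bar> \<le> int (N $ \<kappa>)" using t lv[of "t $ \<kappa>"] by (auto simp: box h_def)
      then have "int (2 ^ j \<kappa>) \<le> int (N $ \<kappa>)" unfolding of_nat_power of_nat_numeral by (rule order_trans)
      then show ?thesis using less_exp[of "j \<kappa>"] by linarith
    qed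
    then show "j \<in> ?J" by (simp add: boxfun_def)
  qed
  then have "sum g (summation_box N) = (\<Sum>j\<in>?J. sum g {t. t \<in> summation_box N \<and> h t = j})"
    by (intro sum.group[symmetric]) (auto intro: finite_summation_box finite_boxfun)
  also have "\<dots> = (\<Sum>j\<in>?J. \<Sum>t\<in>boxfun UNIV (\<lambda>\<kappa>. dyadic (N $ \<kappa>) (j \<kappa>)). g (vec_lambda t))"
  proof (rule sum.cong[OF refl])
    fix j assume "j \<in> ?J"
    show "sum g {t. t \<in> summation_box N \<and> h t = j} = (\<Sum>t\<in>boxfun UNIV (\<lambda>\<kappa>. dyadic (N $ \<kappa>) (j \<kappa>)). g (vec_lambda t))"
      by (rule sum.reindex_bij_witness[of _ vec_lambda vec_nth])
         (auto simp: boxfun_def dy box h_def fun_eq_iff vec_lambda_inverse vec_nth_inverse)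
  qed
  finally show ?thesis .
qed

lemma hilbert_sum_bounded:
  fixes \<Lambda> :: "(nat ^ 'k::finite) set"
  assumes \<Lambda>: "finite \<Lambda>" and one_odd: "\<And>m. m \<in> \<Lambda> \<Longrightarrow> card {\<nu>. odd (m $ \<nu>)} \<le> 1"
  obtains C where "\<And>N \<xi>. norm (hilbert_sum \<Lambda> N \<xi>) \<le> C"
proof -
  define d where "d = (\<Sum>m\<in>\<Lambda>. \<Sum>\<nu>\<in>UNIV. m $ \<nu>)"
  have d: "m $ \<nu> \<le> d" if "m \<in> \<Lambda>" for m \<nu>
  proof -
    have "m $ \<nu> \<le> (\<Sum>\<nu>\<in>UNIV. m $ \<nu>)" by (intro member_le_sum) auto
    also have "\<dots> \<le> d" unfolding d_def using \<Lambda> that by (intro member_le_sum[where f="\<lambda>m. \<Sum>\<nu>\<in>UNIV. m $ \<nu>"]) auto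
    finally show ?thesis .
  qed
  obtain C where C: "\<And>M c J. sparse_odd (UNIV :: 'k set) d c \<Longrightarrow> finite J \<Longrightarrow> (\<And>j \<kappa>. j \<in> J \<Longrightarrow> \<kappa> \<notin> UNIV \<Longrightarrow> j \<kappa> = 0)
    \<Longrightarrow> (\<Sum>j\<in>J. norm (dyadic_sum UNIV d M c j)) \<le> C"
    using dyadic_sums_bounded[of "UNIV :: 'k set" d] by auto
  show thesis
  proof (rule that)
    fix N :: "nat ^ 'k" and \<xi> :: "nat ^ 'k \<Rightarrow> real"
    define c where "c n = (if vec_lambda n \<in> \<Lambda> then \<xi> (vec_lambda n) else 0)" for n
    let ?J = "boxfun UNIV (\<lambda>\<kappa>. {..N $ \<kappa>})"
    have phase: "(\<Sum>m\<in>\<Lambda>. \<xi> m * of_int (monomial t m)) = mpoly UNIV d c (vec_nth t)" for t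
      using hilbert_sum_eq_mpoly[OF \<Lambda> d, of \<xi> t] unfolding c_def[abs_def] .
    have "hilbert_sum \<Lambda> N \<xi> = (\<Sum>t\<in>summation_box N. echar (mpoly UNIV d c (vec_nth t)) / of_int (\<Prod>\<nu>\<in>UNIV. t $ \<nu>))"
      unfolding hilbert_sum_def exp_eq_echar phase ..
    also have "\<dots> = (\<Sum>j\<in>?J. dyadic_sum UNIV d (vec_nth N) c j)"
      unfolding sum_summation_box dyadic_sum_def
      by (intro sum.cong refl) (simp add: vec_lambda_inverse)
    finally have "norm (hilbert_sum \<Lambda> N \<xi>) \<le> (\<Sum>j\<in>?J. norm (dyadic_sum UNIV d (vec_nth N) c j))"
      by (simp add: norm_sum)
    also have "\<dots> \<le> C"
    proof (rule C)
      show "sparse_odd UNIV d c"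
        unfolding sparse_odd_def
      proof (intro ballI impI allI, elim conjE)
        fix n \<nu> \<kappa> assume n: "c n \<noteq> 0" and o: "odd (n \<nu>)" "odd (n \<kappa>)"
        have "vec_lambda n \<in> \<Lambda>" using n by (simp add: c_def split: if_splits)
        from one_odd[OF this] have card: "card {\<nu>. odd (n \<nu>)} \<le> 1" by (simp add: vec_lambda_inverse)
        show "\<nu> = \<kappa>"
        proof (rule ccontr)
          assume "\<nu> \<noteq> \<kappa>"
          then have "card {\<nu>, \<kappa>} = 2" by simp
          moreover have "card {\<nu>, \<kappa>} \<le> card {\<nu>. odd (n \<nu>)}" using o by (intro card_mono) auto
          ultimately show False using card by simp
        qed
      qed
      show "finite ?J" by (intro finite_boxfun) auto
    qed simp
    finally show "norm (hilbert_sum \<Lambda> N \<xi>) \<le> C" .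
  qed
qed

subsection \<open>Odd subsets\<close>

definition flip :: "'k::finite \<Rightarrow> int ^ 'k \<Rightarrow> int ^ 'k" where
  "flip \<nu> t = (\<chi> \<kappa>. if \<kappa> = \<nu> then - (t $ \<kappa>) else t $ \<kappa>)"

text \<open>One term in the expansion of the product of cos + \<open>\<i>\<close> sin over
  \<open>\<Lambda>\<close>, without its power of \<open>\<i>\<close> so that it is real.\<close>

definition odd_part :: "(nat ^ 'k::finite) set \<Rightarrow> nat ^ 'k \<Rightarrow> (nat ^ 'k \<Rightarrow> real) \<Rightarrow> (nat ^ 'k) set \<Rightarrow> real" where
  "odd_part \<Lambda> N \<xi> \<Omega> = (\<Sum>t\<in>summation_box N.
    (\<Prod>m\<in>\<Omega>. sin (2 * pi * \<xi> m * of_int (monomial t m))) * (\<Prod>m\<in>\<Lambda> - \<Omega>. cos (2 * pi * \<xi> m * of_int (monomial t m)))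
      / of_int (\<Prod>\<nu>\<in>UNIV. t $ \<nu>))"

lemma hilbert_sum_expand:
  fixes \<Lambda> :: "(nat ^ 'k::finite) set"
  assumes "finite \<Lambda>"
  shows "hilbert_sum \<Lambda> N \<xi> = (\<Sum>\<Omega>\<in>Pow \<Lambda>. \<i> ^ card \<Omega> * of_real (odd_part \<Lambda> N \<xi> \<Omega>))"
proof -
  let ?\<theta> = "\<lambda>t m. 2 * pi * \<xi> m * of_int (monomial t m)"
  have e: "exp (2 * of_real pi * \<i> * of_real (\<Sum>m\<in>\<Lambda>. \<xi> m * of_int (monomial t m)))
      = (\<Sum>\<Omega>\<in>Pow \<Lambda>. \<i> ^ card \<Omega> * of_real ((\<Prod>m\<in>\<Omega>. sin (?\<theta> t m)) * (\<Prod>m\<in>\<Lambda> - \<Omega>. cos (?\<theta> t m))))" for t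
  proof -
    have "exp (2 * of_real pi * \<i> * of_real (\<Sum>m\<in>\<Lambda>. \<xi> m * of_int (monomial t m))) = exp (\<Sum>m\<in>\<Lambda>. \<i> * of_real (?\<theta> t m))"
      by (simp add: sum_distrib_left mult_ac)
    also have "\<dots> = (\<Prod>m\<in>\<Lambda>. exp (\<i> * of_real (?\<theta> t m)))" by (rule exp_sum[OF assms])
    also have "\<dots> = (\<Prod>m\<in>\<Lambda>. \<i> * of_real (sin (?\<theta> t m)) + of_real (cos (?\<theta> t m)))"
      by (simp add: exp_Euler cos_of_real sin_of_real add.commute del: of_real_mult)
    also have "\<dots> = (\<Sum>\<Omega>\<in>Pow \<Lambda>. (\<Prod>m\<in>\<Omega>. \<i> * of_real (sin (?\<theta> t m))) * (\<Prod>m\<in>\<Lambda> - \<Omega>. of_real (cos (?\<theta> t m))))"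
      by (rule prod_add[OF assms])
    finally show ?thesis by (simp add: prod.distrib mult.assoc)
  qed
  have "hilbert_sum \<Lambda> N \<xi> = (\<Sum>t\<in>summation_box N. \<Sum>\<Omega>\<in>Pow \<Lambda>. \<i> ^ card \<Omega> *
      of_real ((\<Prod>m\<in>\<Omega>. sin (?\<theta> t m)) * (\<Prod>m\<in>\<Lambda> - \<Omega>. cos (?\<theta> t m)) / of_int (\<Prod>\<nu>\<in>UNIV. t $ \<nu>)))"
    unfolding hilbert_sum_def e sum_divide_distrib by simp
  also have "\<dots> = (\<Sum>\<Omega>\<in>Pow \<Lambda>. \<Sum>t\<in>summation_box N. \<i> ^ card \<Omega> *
      of_real ((\<Prod>m\<in>\<Omega>. sin (?\<theta> t m)) * (\<Prod>m\<in>\<Lambda> - \<Omega>. cos (?\<theta> t m)) / of_int (\<Prod>\<nu>\<in>UNIV. t $ \<nu>)))"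
    by (rule sum.swap)
  finally show ?thesis unfolding odd_part_def of_real_sum sum_distrib_left .
qed

lemma monomial_flip: "monomial (flip \<nu> t) m = (- 1) ^ (m $ \<nu>) * monomial t m"
proof -
  have "monomial (flip \<nu> t) m = (\<Prod>\<kappa>\<in>UNIV. (if \<kappa> = \<nu> then (- 1) ^ (m $ \<kappa>) else 1) * (t $ \<kappa>) ^ (m $ \<kappa>))"
    unfolding monomial_def flip_def by (rule prod.cong) (auto simp: power_minus[of "t $ \<nu>"])
  also have "\<dots> = (- 1) ^ (m $ \<nu>) * monomial t m" by (simp add: prod.distrib monomial_def prod.delta)
  finally show ?thesis .
qed

lemma flip_flip [simp]: "flip \<nu> (flip \<nu> t) = t"
  by (simp add: flip_def vec_eq_iff)

lemma flip_box: "t \<in> summation_box N \<Longrightarrow> flip \<nu> t \<in> summation_box N"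
  by (auto simp: summation_box_def flip_def)

lemma prod_flip: "(\<Prod>\<kappa>\<in>UNIV. flip \<nu> t $ \<kappa>) = - (\<Prod>\<kappa>\<in>UNIV. t $ \<kappa>)"
proof -
  have "(\<Prod>\<kappa>\<in>UNIV. flip \<nu> t $ \<kappa>) = (\<Prod>\<kappa>\<in>UNIV. (if \<kappa> = \<nu> then - 1 else 1) * t $ \<kappa>)"
    unfolding flip_def by (rule prod.cong) auto
  also have "\<dots> = - (\<Prod>\<kappa>\<in>UNIV. t $ \<kappa>)" by (simp add: prod.distrib prod.delta)
  finally show ?thesis .
qed

text \<open>Flip a coordinate at which the sum of the exponents in \<open>\<Omega>\<close> is even:
  the sines change sign an even number of times, the cosines never, and the denominator
  once.\<close>

lemma odd_part_eq_zero:
  fixes \<Lambda> :: "(nat ^ 'k::finite) set"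
  assumes "finite \<Lambda>" "\<Omega> \<subseteq> \<Lambda>" "\<not> odd_set \<Omega>"
  shows "odd_part \<Lambda> N \<xi> \<Omega> = 0"
proof -
  have fin: "finite \<Omega>" using assms finite_subset by blast
  then obtain \<nu> where \<nu>: "even ((\<Sum>m\<in>\<Omega>. m) $ \<nu>)" using assms(3) by (auto simp: odd_set_def)
  define g where "g t = (\<Prod>m\<in>\<Omega>. sin (2 * pi * \<xi> m * of_int (monomial t m))) * (\<Prod>m\<in>\<Lambda> - \<Omega>. cos (2 * pi * \<xi> m * of_int (monomial t m)))
      / of_int (\<Prod>\<nu>\<in>UNIV. t $ \<nu>)" for t :: "int ^ 'k"
  have "g (flip \<nu> t) = - g t" for t
  proof -
    have s: "sin (2 * pi * \<xi> m * of_int (monomial (flip \<nu> t) m)) = (- 1) ^ (m $ \<nu>) * sin (2 * pi * \<xi> m * of_int (monomial t m))" for m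
      unfolding monomial_flip by (cases "even (m $ \<nu>)") auto
    have c: "cos (2 * pi * \<xi> m * of_int (monomial (flip \<nu> t) m)) = cos (2 * pi * \<xi> m * of_int (monomial t m))" for m
      unfolding monomial_flip by (cases "even (m $ \<nu>)") auto
    have "(\<Prod>m\<in>\<Omega>. (- 1 :: real) ^ (m $ \<nu>)) = (- 1) ^ (\<Sum>m\<in>\<Omega>. m $ \<nu>)" by (rule power_sum[symmetric])
    also have "(\<Sum>m\<in>\<Omega>. m $ \<nu>) = (\<Sum>m\<in>\<Omega>. m) $ \<nu>" by simp
    also have "(- 1 :: real) ^ \<dots> = 1" using \<nu> by simp
    finally show ?thesis unfolding g_def s c prod.distrib prod_flip by simp
  qed
  then have "sum g (summation_box N) = (\<Sum>t\<in>summation_box N. - g t)"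
    by (intro sum.reindex_bij_witness[of _ "flip \<nu>" "flip \<nu>"]) (auto simp: flip_box)
  then have "sum g (summation_box N) = 0" by (simp add: sum_negf)
  then show ?thesis unfolding odd_part_def g_def .
qed

lemma hilbert_sum_odd_expand:
  fixes \<Lambda> :: "(nat ^ 'k::finite) set"
  assumes "finite \<Lambda>"
  shows "hilbert_sum \<Lambda> N \<xi> = (\<Sum>\<Omega> | \<Omega> \<subseteq> \<Lambda> \<and> odd_set \<Omega>. \<i> ^ card \<Omega> * of_real (odd_part \<Lambda> N \<xi> \<Omega>))"
  unfolding hilbert_sum_expand[OF assms]
  by (rule sum.mono_neutral_right) (use assms odd_part_eq_zero[OF assms] in auto)

text \<open>A phase 0 outside \<open>\<Omega>\<close> kills, through its sine, every odd subset that
  leaves \<open>\<Omega>\<close>, and minimality excludes the proper subsets. A single term of the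
  expansion remains, so nothing can cancel it.\<close>

lemma hilbert_sum_minimal_odd:
  fixes \<Lambda> :: "(nat ^ 'k::finite) set"
  assumes \<Lambda>: "finite \<Lambda>" and \<Omega>: "\<Omega> \<subseteq> \<Lambda>" "odd_set \<Omega>" "\<And>\<Omega>'. \<Omega>' \<subseteq> \<Omega> \<Longrightarrow> odd_set \<Omega>' \<Longrightarrow> \<Omega>' = \<Omega>"
    and \<xi>: "\<And>m. m \<notin> \<Omega> \<Longrightarrow> \<xi> m = 0"
  shows "norm (hilbert_sum \<Lambda> N \<xi>)
    = \<bar>\<Sum>t\<in>summation_box N. (\<Prod>m\<in>\<Omega>. sin (2 * pi * \<xi> m * of_int (monomial t m))) / of_int (\<Prod>\<nu>\<in>UNIV. t $ \<nu>)\<bar>"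
proof -
  have "odd_part \<Lambda> N \<xi> \<Omega>' = 0" if o: "\<Omega>' \<subseteq> \<Lambda>" "odd_set \<Omega>'" "\<Omega>' \<noteq> \<Omega>" for \<Omega>'
  proof -
    have fin: "finite \<Omega>'" using \<Lambda> o finite_subset by blast
    have "\<not> \<Omega>' \<subseteq> \<Omega>" using \<Omega>(3) o by blast
    then obtain m where "m \<in> \<Omega>'" "m \<notin> \<Omega>" by blast
    then have "\<exists>m\<in>\<Omega>'. sin (2 * pi * \<xi> m * of_int (monomial t m)) = 0" for t using \<xi> by force
    then have "(\<Prod>m\<in>\<Omega>'. sin (2 * pi * \<xi> m * of_int (monomial t m))) = 0" for t by (rule prod_zero[OF fin])
    then show ?thesis by (simp add: odd_part_def)
  qed
  then have "hilbert_sum \<Lambda> N \<xi> = (\<Sum>\<Omega>'\<in>{\<Omega>}. \<i> ^ card \<Omega>' * of_real (odd_part \<Lambda> N \<xi> \<Omega>'))"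
    unfolding hilbert_sum_odd_expand[OF \<Lambda>] by (intro sum.mono_neutral_right) (use \<Lambda> \<Omega> in auto)
  then have "norm (hilbert_sum \<Lambda> N \<xi>) = \<bar>odd_part \<Lambda> N \<xi> \<Omega>\<bar>" by (simp add: norm_mult norm_power)
  moreover have "(\<Prod>m\<in>\<Lambda> - \<Omega>. cos (2 * pi * \<xi> m * of_int (monomial t m))) = 1" for t
    by (rule prod.neutral) (use \<xi> in auto)
  ultimately show ?thesis by (simp add: odd_part_def)
qed

lemma odd_set_iff:
  assumes "finite \<Omega>"
  shows "odd_set \<Omega> \<longleftrightarrow> (\<forall>\<nu>. odd (card {m\<in>\<Omega>. odd (m $ \<nu>)}))"
  using assms by (simp add: odd_set_def even_sum_iff)

text \<open>Each coordinate is the only odd one of some member of \<open>\<Omega>\<close>. Let m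
  take the place of the members belonging to its odd coordinates: then every coordinate is odd in
  exactly one member of the new set, so none can be omitted.\<close>

lemma exchange_odd_subset:
  fixes \<Lambda> :: "(nat ^ 'k::finite) set"
  assumes \<Lambda>: "finite \<Lambda>" and \<Omega>: "\<Omega> \<subseteq> \<Lambda>" "odd_set \<Omega>" and m: "m \<in> \<Lambda>" "1 < card {\<nu>. odd (m $ \<nu>)}"
    and single: "\<And>n. n \<in> \<Omega> \<Longrightarrow> card {\<nu>. odd (n $ \<nu>)} \<le> 1"
  obtains \<Omega>' where "\<Omega>' \<subseteq> \<Lambda>" "odd_set \<Omega>'" "m \<in> \<Omega>'" "\<And>\<Omega>''. \<Omega>'' \<subseteq> \<Omega>' \<Longrightarrow> odd_set \<Omega>'' \<Longrightarrow> \<Omega>'' = \<Omega>'"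
proof -
  have fin: "finite \<Omega>" using \<Lambda> \<Omega> finite_subset by blast
  have only: "\<kappa> = \<nu>" if "n \<in> \<Omega>" "odd (n $ \<nu>)" "odd (n $ \<kappa>)" for n \<nu> \<kappa>
  proof (rule ccontr)
    assume "\<kappa> \<noteq> \<nu>"
    then have "card {\<nu>, \<kappa>} = 2" by simp
    moreover have "card {\<nu>, \<kappa>} \<le> card {\<nu>. odd (n $ \<nu>)}" using that by (intro card_mono) auto
    ultimately show False using single[OF that(1)] by simp
  qed
  have "\<exists>n\<in>\<Omega>. odd (n $ \<nu>)" for \<nu>
  proof (rule ccontr)
    assume "\<not> ?thesis"
    then have "{m\<in>\<Omega>. odd (m $ \<nu>)} = {}" by auto
    then show False using \<Omega>(2) odd_set_iff[OF fin] by (metis card.empty even_zero)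
  qed
  then obtain n where n: "\<And>\<nu>. n \<nu> \<in> \<Omega>" "\<And>\<nu>. odd (n \<nu> $ \<nu>)" by metis
  have n_odd: "odd (n \<nu> $ \<kappa>) \<longleftrightarrow> \<kappa> = \<nu>" for \<nu> \<kappa> using only[OF n(1) n(2)] n(2) by auto
  define S where "S = {\<nu>. odd (m $ \<nu>)}"
  define \<Omega>' where "\<Omega>' = insert m (n ` (- S))"
  have m_notin: "m \<notin> n ` T" for T
  proof
    assume "m \<in> n ` T"
    then have "m \<in> \<Omega>" using n(1) by auto
    then show False using single m(2) by fastforce
  qed
  have in_S: "{x\<in>\<Omega>''. odd (x $ \<kappa>)} = \<Omega>'' \<inter> {m}" if "\<kappa> \<in> S" "\<Omega>'' \<subseteq> \<Omega>'" for \<kappa> \<Omega>''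
    using that n_odd by (auto simp: \<Omega>'_def S_def)
  have off_S: "{x\<in>\<Omega>''. odd (x $ \<kappa>)} = \<Omega>'' \<inter> {n \<kappa>}" if "\<kappa> \<notin> S" "\<Omega>'' \<subseteq> \<Omega>'" for \<kappa> \<Omega>''
    using that n_odd by (auto simp: \<Omega>'_def S_def)
  have fin': "finite \<Omega>'" by (simp add: \<Omega>'_def)
  show thesis
  proof (rule that)
    show "\<Omega>' \<subseteq> \<Lambda>" using m \<Omega> n(1) by (auto simp: \<Omega>'_def)
    show "m \<in> \<Omega>'" by (simp add: \<Omega>'_def)
    have "odd (card {x\<in>\<Omega>'. odd (x $ \<kappa>)})" for \<kappa>
    proof (cases "\<kappa> \<in> S")
      case True
      have "\<Omega>' \<inter> {m} = {m}" by (simp add: \<Omega>'_def)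
      then show ?thesis using in_S[OF True order_refl] by simp
    next
      case False
      then have "\<Omega>' \<inter> {n \<kappa>} = {n \<kappa>}" by (auto simp: \<Omega>'_def)
      then show ?thesis using off_S[OF False order_refl] by simp
    qed
    then show "odd_set \<Omega>'" by (simp add: odd_set_iff[OF fin'])
    fix \<Omega>'' assume sub: "\<Omega>'' \<subseteq> \<Omega>'" and o: "odd_set \<Omega>''"
    have fin'': "finite \<Omega>''" using sub fin' finite_subset by blast
    have o': "odd (card {x\<in>\<Omega>''. odd (x $ \<kappa>)})" for \<kappa> using o odd_set_iff[OF fin''] by blast
    obtain \<kappa>0 where "\<kappa>0 \<in> S" using m(2) by (metis S_def card.empty equals0I not_one_less_zero)
    then have "odd (card (\<Omega>'' \<inter> {m}))" using o'[of \<kappa>0] in_S[OF _ sub] by simp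
    then have "m \<in> \<Omega>''" by (metis Int_insert_right_if0 card.empty even_zero inf_bot_right)
    moreover have "n \<kappa> \<in> \<Omega>''" if "\<kappa> \<notin> S" for \<kappa>
    proof -
      have "odd (card (\<Omega>'' \<inter> {n \<kappa>}))" using o'[of \<kappa>] off_S[OF that sub] by simp
      then show ?thesis by (metis Int_insert_right_if0 card.empty even_zero inf_bot_right)
    qed
    ultimately show "\<Omega>'' = \<Omega>'" using sub by (auto simp: \<Omega>'_def)
  qed
qed

text \<open>If some odd subset consists of exponents with at most one odd component, m is exchanged
  into it. Otherwise every odd subset, in particular a minimal one, has a member as
  required.\<close>

lemma minimal_odd_subset:
  fixes \<Lambda> :: "(nat ^ 'k::finite) set"
  assumes \<Lambda>: "finite \<Lambda>" and ex: "\<exists>\<Omega>\<subseteq>\<Lambda>. odd_set \<Omega>" and m: "m \<in> \<Lambda>" "1 < card {\<nu>. odd (m $ \<nu>)}"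
  obtains \<Omega> m' where "\<Omega> \<subseteq> \<Lambda>" "odd_set \<Omega>" "\<And>\<Omega>'. \<Omega>' \<subseteq> \<Omega> \<Longrightarrow> odd_set \<Omega>' \<Longrightarrow> \<Omega>' = \<Omega>"
    "m' \<in> \<Omega>" "1 < card {\<nu>. odd (m' $ \<nu>)}"
proof (cases "\<exists>\<Omega>\<subseteq>\<Lambda>. odd_set \<Omega> \<and> (\<forall>n\<in>\<Omega>. card {\<nu>. odd (n $ \<nu>)} \<le> 1)")
  case True
  then obtain \<Omega> where \<Omega>: "\<Omega> \<subseteq> \<Lambda>" "odd_set \<Omega>" "\<And>n. n \<in> \<Omega> \<Longrightarrow> card {\<nu>. odd (n $ \<nu>)} \<le> 1" by blast
  show thesis by (rule exchange_odd_subset[OF \<Lambda> \<Omega>(1,2) m \<Omega>(3)]) (use that m in blast)+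
next
  case False
  have "finite {\<Omega>. \<Omega> \<subseteq> \<Lambda> \<and> odd_set \<Omega>}" using \<Lambda> by (rule_tac finite_subset[of _ "Pow \<Lambda>"]) auto
  moreover have "{\<Omega>. \<Omega> \<subseteq> \<Lambda> \<and> odd_set \<Omega>} \<noteq> {}" using ex by blast
  ultimately obtain \<Omega> where \<Omega>: "\<Omega> \<subseteq> \<Lambda>" "odd_set \<Omega>" and min: "\<forall>\<Omega>'\<in>{\<Omega>. \<Omega> \<subseteq> \<Lambda> \<and> odd_set \<Omega>}. \<Omega>' \<subseteq> \<Omega> \<longrightarrow> \<Omega> = \<Omega>'"
    using finite_has_minimal[of "{\<Omega>. \<Omega> \<subseteq> \<Lambda> \<and> odd_set \<Omega>}"] by auto
  obtain n where "n \<in> \<Omega>" "1 < card {\<nu>. odd (n $ \<nu>)}" using False \<Omega> by (meson not_le)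
  then show thesis using \<Omega> min by (intro that[of \<Omega> n]) auto
qed

subsection \<open>Unboundedness\<close>

text \<open>The nonprincipal Dirichlet character modulo 4; its multiplicativity separates the
  variables.\<close>

definition chi4 :: "int \<Rightarrow> real" where
  "chi4 z = (if even z then 0 else if z mod 4 = 1 then 1 else - 1)"

lemma sin_half_pi_int: "sin (pi / 2 * of_int z) = chi4 z"
proof -
  define k r where "k = z div 4" and "r = z mod 4"
  have z: "z = 4 * k + r" by (simp add: k_def r_def)
  have r: "r = 0 \<or> r = 1 \<or> r = 2 \<or> r = 3" unfolding r_def by presburger
  have "pi / 2 * of_int z = pi / 2 * of_int r + 2 * pi * of_int k" unfolding z by (simp add: algebra_simps)
  then have "sin (pi / 2 * of_int z) = sin (pi / 2 * of_int r)"
    by (simp only: sin_add sin_int_2pin cos_int_2pin mult_zero_right mult_1_right add_0_right)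
  also have "\<dots> = chi4 r"
  proof -
    have "sin (pi / 2 * 3) = - 1"
    proof -
      have "pi / 2 * 3 = pi + pi / 2" by simp
      then show ?thesis by (simp only: sin_periodic_pi2) simp
    qed
    then show ?thesis using r by (auto simp: chi4_def)
  qed
  also have "chi4 r = chi4 z" unfolding chi4_def z by (simp add: mod_simps)
  finally show ?thesis .
qed

lemma chi4_mult: "chi4 (z * w) = chi4 z * chi4 w"
proof (cases "even z \<or> even w")
  case False
  then have "z mod 4 = 1 \<or> z mod 4 = 3" "w mod 4 = 1 \<or> w mod 4 = 3" by presburger+
  moreover have "(z * w) mod 4 = ((z mod 4) * (w mod 4)) mod 4" by (simp add: mod_mult_eq)
  ultimately show ?thesis using False by (auto simp: chi4_def)
qed (auto simp: chi4_def)

lemma chi4_1 [simp]: "chi4 1 = 1" "chi4 (- 1) = - 1"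
  by (simp_all add: chi4_def)

lemma chi4_power: "chi4 (z ^ n) = chi4 z ^ n"
  by (induction n) (simp_all add: chi4_mult)

lemma chi4_prod: "chi4 (prod f A) = (\<Prod>x\<in>A. chi4 (f x))"
  by (induction A rule: infinite_finite_induct) (simp_all add: chi4_mult)

lemma chi4_sq: "odd z \<Longrightarrow> even n \<Longrightarrow> chi4 z ^ n = 1"
  by (auto simp: chi4_def)

lemma sgn_prod: "sgn (prod f A) = (\<Prod>x\<in>A. sgn (f x :: real))"
  by (induction A rule: infinite_finite_induct) (simp_all add: sgn_mult)

lemma echar_power: "echar (real l * \<theta>) = echar \<theta> ^ l"
proof (induction l)
  case (Suc l)
  have "real (Suc l) * \<theta> = \<theta> + real l * \<theta>" by (simp add: algebra_simps)
  then show ?case by (simp only: echar_add Suc power_Suc)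
qed simp

lemma sum_cos_residues:
  assumes "1 \<le> Q"
  shows "(\<Sum>l<Q. cos (2 * pi * (real l * of_int z / real Q))) = (if int Q dvd z then real Q else 0)"
proof -
  define \<theta> where "\<theta> = of_int z / real Q"
  have Re: "(\<Sum>l<Q. cos (2 * pi * (real l * of_int z / real Q))) = Re (\<Sum>l<Q. echar \<theta> ^ l)"
    unfolding echar_power[symmetric] Re_sum by (simp add: echar_def \<theta>_def)
  show ?thesis
  proof (cases "int Q dvd z")
    case True
    then obtain k where "z = int Q * k" ..
    then have "\<theta> = of_int k" using assms by (simp add: \<theta>_def)
    then show ?thesis unfolding Re using True by simp
  next
    case False
    have "echar \<theta> \<noteq> 1"
    proof
      assume "echar \<theta> = 1"
      moreover obtain k :: int where "\<bar>\<theta> - of_int k\<bar> \<le> norm (echar \<theta> - 1)" by (rule norm_echar_minus_1_ge)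
      ultimately have "\<theta> = of_int k" by simp
      then have "real_of_int z = of_int (int Q * k)" using assms by (simp add: \<theta>_def field_simps)
      then have "z = int Q * k" by (simp only: of_int_eq_iff)
      then show False using False by simp
    qed
    moreover have "echar \<theta> ^ Q = 1"
      unfolding echar_power[symmetric] using assms by (simp add: \<theta>_def)
    ultimately have "(\<Sum>l<Q. echar \<theta> ^ l) = 0" by (simp add: geometric_sum)
    then show ?thesis unfolding Re using False by simp
  qed
qed

text \<open>
  The conjugate Dirichlet kernel at the points \<open>l / (2 * Y + 1)\<close>: averaging a bound over these phases
  against it turns the oscillating factor \<open>sin\<close> into \<open>sgn\<close> and costs only a logarithm.
\<close>

definition sine_kernel :: "nat \<Rightarrow> nat \<Rightarrow> real" where
  "sine_kernel Y l = (\<Sum>y\<in>{1..Y}. sin (2 * pi * (real l * real y / real (2 * Y + 1))))"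

text \<open>Orthogonality modulo 2 * Y + 1: as |y - x| and |y + x| stay below the modulus, only y =
  |x| survives, with the sign of x.\<close>

lemma sine_kernel_reproduces_sgn:
  assumes "1 \<le> \<bar>x\<bar>" "\<bar>x\<bar> \<le> int Y"
  shows "(\<Sum>l<2 * Y + 1. sine_kernel Y l * sin (2 * pi * (real l * of_int x / real (2 * Y + 1)))) = real (2 * Y + 1) / 2 * sgn (of_int x)"
proof -
  define Q where "Q = 2 * Y + 1"
  have Q: "1 \<le> Q" by (simp add: Q_def)
  define c where "c l z = cos (2 * pi * (real l * of_int z / real Q))" for l z
  have "(\<Sum>l<Q. sine_kernel Y l * sin (2 * pi * (real l * of_int x / real Q)))
      = (\<Sum>l<Q. \<Sum>y\<in>{1..Y}. (c l (int y - x) - c l (int y + x)) / 2)"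
    unfolding sine_kernel_def Q_def[symmetric] sum_distrib_right c_def
  proof (intro sum.cong refl)
    fix l y
    have "2 * pi * (real l * of_int (int y - x) / real Q) = 2 * pi * (real l * real y / real Q) - 2 * pi * (real l * of_int x / real Q)"
      "2 * pi * (real l * of_int (int y + x) / real Q) = 2 * pi * (real l * real y / real Q) + 2 * pi * (real l * of_int x / real Q)"
      by (simp_all add: algebra_simps add_divide_distrib diff_divide_distrib)
    then show "sin (2 * pi * (real l * real y / real Q)) * sin (2 * pi * (real l * of_int x / real Q))
      = (cos (2 * pi * (real l * of_int (int y - x) / real Q)) - cos (2 * pi * (real l * of_int (int y + x) / real Q))) / 2"
      by (simp only: sin_times_sin)
  qed
  also have "\<dots> = (\<Sum>y\<in>{1..Y}. ((\<Sum>l<Q. c l (int y - x)) - (\<Sum>l<Q. c l (int y + x))) / 2)"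
    by (subst sum.swap) (simp add: sum_subtractf sum_divide_distrib[symmetric])
  also have "\<dots> = (\<Sum>y\<in>{1..Y}. real Q / 2 * ((if int y = x then 1 else 0) - (if int y = - x then 1 else 0)))"
  proof (rule sum.cong[OF refl])
    fix y assume y: "y \<in> {1..Y}"
    have small: "int Q dvd z \<longleftrightarrow> z = 0" if "\<bar>z\<bar> < int Q" for z
      using that zdvd_not_zless[of "\<bar>z\<bar>" "int Q"] by (cases "z = 0") auto
    have "\<bar>int y - x\<bar> < int Q" "\<bar>int y + x\<bar> < int Q" using y assms by (auto simp: Q_def)
    then have "int Q dvd int y - x \<longleftrightarrow> int y = x" "int Q dvd int y + x \<longleftrightarrow> int y = - x"
      using small by auto
    then show "((\<Sum>l<Q. c l (int y - x)) - (\<Sum>l<Q. c l (int y + x))) / 2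
      = real Q / 2 * ((if int y = x then 1 else 0) - (if int y = - x then 1 else 0))"
      unfolding c_def sum_cos_residues[OF Q] by simp
  qed
  also have "\<dots> = real Q / 2 * ((\<Sum>y\<in>{1..Y}. if int y = x then 1 else 0) - (\<Sum>y\<in>{1..Y}. if int y = - x then 1 else 0))"
    unfolding sum_distrib_left[symmetric] sum_subtractf ..
  also have "(\<Sum>y\<in>{1..Y}. if int y = x then 1 else 0) - (\<Sum>y\<in>{1..Y}. if int y = - x then 1 else (0::real)) = sgn (of_int x)"
  proof (cases "0 < x")
    case True
    have "(\<Sum>y\<in>{1..Y}. if int y = x then 1 else 0) = (\<Sum>y\<in>{1..Y}. if y = nat x then 1 else (0::real))"
      by (rule sum.cong) (use True in auto)
    also have "\<dots> = 1" using True assms by (subst sum.delta) auto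
    moreover have "(\<Sum>y\<in>{1..Y}. if int y = - x then 1 else (0::real)) = 0" using True by (intro sum.neutral) auto
    ultimately show ?thesis using True by simp
  next
    case False
    then have neg: "x < 0" using assms by auto
    have "(\<Sum>y\<in>{1..Y}. if int y = - x then 1 else 0) = (\<Sum>y\<in>{1..Y}. if y = nat (- x) then 1 else (0::real))"
      by (rule sum.cong) (use neg in auto)
    also have "\<dots> = 1" using neg assms by (subst sum.delta) auto
    moreover have "(\<Sum>y\<in>{1..Y}. if int y = x then 1 else (0::real)) = 0" using neg by (intro sum.neutral) auto
    ultimately show ?thesis using neg by simp
  qed
  finally show ?thesis by (simp add: Q_def)
qed

text \<open>As a geometric sum the kernel is at most a constant times the inverse distance of l / (2
  * Y + 1) to the integers, and these inverse distances add up to a harmonic sum.\<close>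

lemma sine_kernel_norm:
  "(\<Sum>l<2 * Y + 1. \<bar>sine_kernel Y l\<bar>) \<le> 4 * real (2 * Y + 1) * harm (2 * Y)"
proof -
  define Q where "Q = 2 * Y + 1"
  have pt: "\<bar>sine_kernel Y l\<bar> \<le> 2 * real Q * (1 / real l + 1 / real (Q - l))" if l: "1 \<le> l" "l < Q" for l
  proof -
    define \<theta> where "\<theta> = real l / real Q"
    define f where "f i = echar (real (Suc i) * \<theta>)" for i
    have "sine_kernel Y l = (\<Sum>i<Y. Im (f i))"
      unfolding sine_kernel_def Q_def[symmetric]
      by (rule sum.reindex_bij_witness[of _ Suc "\<lambda>y. y - 1"]) (auto simp: f_def echar_def \<theta>_def mult.commute)
    then have "sine_kernel Y l = Im (\<Sum>i<Y. f i)" by simp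
    then have le: "\<bar>sine_kernel Y l\<bar> \<le> norm (\<Sum>i<Y. f i)" using abs_Im_le_cmod by metis
    have tw: "norm (\<Sum>i<Y. f i) * norm (echar \<theta> - 1) \<le> 2 * real 1"
    proof (rule twisted_periodic_sum)
      show "f (i + 1) = f i * echar \<theta>" for i
      proof -
        have "real (Suc (i + 1)) * \<theta> = real (Suc i) * \<theta> + \<theta>" by (simp add: algebra_simps)
        then show ?thesis by (simp only: f_def echar_add)
      qed
    qed (simp add: f_def)
    obtain z :: int where z: "\<bar>\<theta> - of_int z\<bar> \<le> norm (echar \<theta> - 1)" by (rule norm_echar_minus_1_ge)
    define e where "e = real (min l (Q - l)) / real Q"
    have e0: "0 < e" using l by (simp add: e_def)
    have "e \<le> \<bar>\<theta> - of_int z\<bar>"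
    proof (cases "z \<le> 0")
      case True
      have "e \<le> \<theta>" unfolding e_def \<theta>_def by (intro divide_right_mono) auto
      also have "\<dots> \<le> \<bar>\<theta> - of_int z\<bar>" using True l by (simp add: \<theta>_def)
      finally show ?thesis .
    next
      case False
      have "e \<le> real (Q - l) / real Q" unfolding e_def by (intro divide_right_mono) auto
      also have "\<dots> = 1 - \<theta>" using l by (simp add: \<theta>_def of_nat_diff diff_divide_distrib)
      also have "\<dots> \<le> \<bar>\<theta> - of_int z\<bar>"
      proof -
        have "\<theta> \<le> 1" using l by (simp add: \<theta>_def)
        moreover have "1 \<le> real_of_int z" using False by simp
        ultimately show ?thesis by linarith
      qed
      finally show ?thesis .
    qed
    then have "norm (\<Sum>i<Y. f i) * e \<le> norm (\<Sum>i<Y. f i) * norm (echar \<theta> - 1)" using z by (intro mult_left_mono) auto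
    then have "norm (\<Sum>i<Y. f i) \<le> 2 / e" using tw e0 by (simp add: pos_le_divide_eq)
    also have "\<dots> = 2 * real Q * (1 / real (min l (Q - l)))" by (simp add: e_def)
    also have "\<dots> \<le> 2 * real Q * (1 / real l + 1 / real (Q - l))"
      by (intro mult_left_mono) (auto simp: min_def)
    finally show ?thesis using le by linarith
  qed
  have "{..<Q} = insert 0 {1..<Q}" by (auto simp: Q_def)
  then have "(\<Sum>l<Q. \<bar>sine_kernel Y l\<bar>) = (\<Sum>l\<in>{1..<Q}. \<bar>sine_kernel Y l\<bar>)" by (simp add: sine_kernel_def)
  also have "\<dots> \<le> (\<Sum>l\<in>{1..<Q}. 2 * real Q * (1 / real l + 1 / real (Q - l)))" by (intro sum_mono pt) auto
  also have "\<dots> = 2 * real Q * ((\<Sum>l\<in>{1..<Q}. 1 / real l) + (\<Sum>l\<in>{1..<Q}. 1 / real (Q - l)))"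
    unfolding sum.distrib[symmetric] sum_distrib_left ..
  also have "(\<Sum>l\<in>{1..<Q}. 1 / real (Q - l)) = (\<Sum>l\<in>{1..<Q}. 1 / real l)"
    by (rule sum.reindex_bij_witness[of _ "\<lambda>l. Q - l" "\<lambda>l. Q - l"]) auto
  also have "(\<Sum>l\<in>{1..<Q}. 1 / real l) = harm (2 * Y)"
    unfolding harm_def Q_def by (rule sum.cong) (auto simp: inverse_eq_divide)
  finally have "(\<Sum>l<Q. \<bar>sine_kernel Y l\<bar>) \<le> 2 * real Q * (harm (2 * Y) + harm (2 * Y))" .
  also have "\<dots> = 4 * real Q * harm (2 * Y)" by simp
  finally show ?thesis unfolding Q_def .
qed

lemma harm_le_ln: "1 \<le> n \<Longrightarrow> harm n \<le> 1 + ln (real n)"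
proof -
  assume "1 \<le> n"
  then obtain k where k: "n = Suc k" by (cases n) auto
  have "harm (Suc k) - ln (real (Suc k)) \<le> harm (Suc 0) - ln (real (Suc 0))"
    using decseq_harm_diff_ln by (rule decseqD) simp
  then show ?thesis by (simp add: k harm_expand)
qed

lemma odd_harm_ge: "harm (A + 1) / 2 \<le> (\<Sum>i\<le>A. 1 / (2 * real i + 1))"
proof -
  have "harm (A + 1) / 2 = (\<Sum>i\<le>A. inverse (real (Suc i)) / 2)"
    unfolding harm_altdef sum_divide_distrib by (rule sum.cong) auto
  also have "\<dots> \<le> (\<Sum>i\<le>A. 1 / (2 * real i + 1))"
    by (intro sum_mono) (auto simp: inverse_eq_divide intro!: divide_left_mono)
  finally show ?thesis .
qed

lemma minimal_odd_unbounded: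
  fixes \<Lambda> :: "(nat ^ 'k::finite) set"
  assumes \<Lambda>: "finite \<Lambda>" and \<Omega>: "\<Omega> \<subseteq> \<Lambda>" "odd_set \<Omega>" "\<And>\<Omega>'. \<Omega>' \<subseteq> \<Omega> \<Longrightarrow> odd_set \<Omega>' \<Longrightarrow> \<Omega>' = \<Omega>"
    and m: "m \<in> \<Omega>" and ab: "a \<noteq> b" "odd (m $ a)" "odd (m $ b)"
  shows "\<exists>N\<in>positive_vectors. \<exists>\<xi>. C < norm (hilbert_sum \<Lambda> N \<xi>)"
proof (rule ccontr)
  assume "\<not> ?thesis"
  then have bounded: "\<And>N \<xi>. N \<in> positive_vectors \<Longrightarrow> norm (hilbert_sum \<Lambda> N \<xi>) \<le> C" by (meson not_le)
  have fin\<Omega>: "finite \<Omega>" using \<Lambda> \<Omega> finite_subset by blast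
  define p where "p = m $ a + m $ b"
  have main: "harm (A + 1) ^ 2 \<le> 32 * C * harm (2 * (2 * A + 1) ^ p)" for A
  proof -
    \<comment> \<open>Only the directions a and b are long. In all others the coordinates are 1 or -
      1, where the character agrees with the sign.\<close>
    define N :: "nat ^ 'k" where "N = (\<chi> \<nu>. if \<nu> = a \<or> \<nu> = b then 2 * A + 1 else 1)"
    \<comment> \<open>The maximum of the monomial of m on the box, hence the range in which the
      kernel has to reproduce the sign.\<close>
    define Y where "Y = (2 * A + 1) ^ p"
    define Q where "Q = 2 * Y + 1"
    define \<xi> where "\<xi> l n = (if n = m then real l / real Q else if n \<in> \<Omega> then 1 / 4 else 0)" for l n
    define P where "P t = real_of_int (\<Prod>\<nu>\<in>UNIV. t $ \<nu>)" for t :: "int ^ 'k"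
    define x where "x t = monomial t m" for t
    define s where "s t = (\<Prod>n\<in>\<Omega> - {m}. chi4 (monomial t n))" for t
    define R where "R l = (\<Sum>t\<in>summation_box N. s t * sin (2 * pi * (real l * of_int (x t) / real Q)) / P t)" for l
    have Npos: "N \<in> positive_vectors" by (simp add: positive_vectors_def N_def)
    have RC: "\<bar>R l\<bar> \<le> C" for l
    proof -
      have "(\<Prod>n\<in>\<Omega>. sin (2 * pi * \<xi> l n * of_int (monomial t n))) = s t * sin (2 * pi * (real l * of_int (x t) / real Q))" for t
      proof -
        have "(\<Prod>n\<in>\<Omega>. sin (2 * pi * \<xi> l n * of_int (monomial t n)))
            = sin (2 * pi * \<xi> l m * of_int (x t)) * (\<Prod>n\<in>\<Omega> - {m}. sin (2 * pi * \<xi> l n * of_int (monomial t n)))"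
          unfolding x_def by (rule prod.remove[OF fin\<Omega> m])
        also have "(\<Prod>n\<in>\<Omega> - {m}. sin (2 * pi * \<xi> l n * of_int (monomial t n))) = s t"
          unfolding s_def sin_half_pi_int[symmetric] by (rule prod.cong) (auto simp: \<xi>_def)
        finally show ?thesis by (simp add: \<xi>_def mult.assoc)
      qed
      then have "norm (hilbert_sum \<Lambda> N (\<xi> l)) = \<bar>R l\<bar>"
        by (subst hilbert_sum_minimal_odd[OF \<Lambda> \<Omega>]) (use m in \<open>auto simp: \<xi>_def R_def P_def\<close>)
      then show ?thesis using bounded[OF Npos, of "\<xi> l"] by simp
    qed
    have tbox: "t $ \<nu> \<noteq> 0" "\<bar>t $ \<nu>\<bar> \<le> int (N $ \<nu>)" if "t \<in> summation_box N" for t \<nu>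
      using that by (auto simp: summation_box_def) (metis abs_zero not_one_le_zero)
    have off: "t $ \<nu> = 1 \<or> t $ \<nu> = - 1" if "t \<in> summation_box N" "\<nu> \<noteq> a" "\<nu> \<noteq> b" for t \<nu>
      using tbox[OF that(1), of \<nu>] that(2,3) by (auto simp: N_def)
    have xY: "1 \<le> \<bar>x t\<bar>" "\<bar>x t\<bar> \<le> int Y" if t: "t \<in> summation_box N" for t
    proof -
      have "x t \<noteq> 0" unfolding x_def monomial_def using tbox(1)[OF t] by simp
      then show "1 \<le> \<bar>x t\<bar>" by linarith
      have "\<bar>x t\<bar> = (\<Prod>\<nu>\<in>UNIV. \<bar>t $ \<nu>\<bar> ^ (m $ \<nu>))" by (simp add: x_def monomial_def abs_prod power_abs)
      also have "\<dots> \<le> (\<Prod>\<nu>\<in>UNIV. int (N $ \<nu>) ^ (m $ \<nu>))"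
        using tbox(2)[OF t] by (intro prod_mono conjI power_mono) auto
      also have "\<dots> = (\<Prod>\<nu>\<in>{a, b}. int (N $ \<nu>) ^ (m $ \<nu>))"
        by (rule prod.mono_neutral_right) (auto simp: N_def)
      also have "\<dots> = int Y" using ab(1) by (simp add: N_def Y_def p_def power_add)
      finally show "\<bar>x t\<bar> \<le> int Y" .
    qed
    define T where "T t = s t * sgn (of_int (x t)) / P t" for t
    have "real Q / 2 * (\<Sum>t\<in>summation_box N. T t) = (\<Sum>l<Q. sine_kernel Y l * R l)"
    proof -
      have "(\<Sum>l<Q. sine_kernel Y l * R l)
          = (\<Sum>t\<in>summation_box N. s t / P t * (\<Sum>l<Q. sine_kernel Y l * sin (2 * pi * (real l * of_int (x t) / real Q))))"
        unfolding R_def sum_distrib_left by (subst sum.swap) (simp add: mult_ac)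
      also have "\<dots> = (\<Sum>t\<in>summation_box N. s t / P t * (real Q / 2 * sgn (of_int (x t))))"
        unfolding Q_def by (intro sum.cong refl arg_cong2[where f="(*)"] sine_kernel_reproduces_sgn xY)
      finally show ?thesis by (simp add: T_def sum_distrib_left mult_ac)
    qed
    also have "\<dots> \<le> (\<Sum>l<Q. \<bar>sine_kernel Y l\<bar> * C)"
    proof (rule sum_mono)
      fix l
      have "sine_kernel Y l * R l \<le> \<bar>sine_kernel Y l\<bar> * \<bar>R l\<bar>" by (metis abs_ge_self abs_mult)
      also have "\<dots> \<le> \<bar>sine_kernel Y l\<bar> * C" using RC by (intro mult_left_mono) auto
      finally show "sine_kernel Y l * R l \<le> \<bar>sine_kernel Y l\<bar> * C" .
    qed
    also have "\<dots> = (\<Sum>l<Q. \<bar>sine_kernel Y l\<bar>) * C" by (simp add: sum_distrib_right)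
    also have "\<dots> \<le> 4 * real Q * harm (2 * Y) * C"
      using sine_kernel_norm[of Y] RC[of 0] unfolding Q_def by (intro mult_right_mono) auto
    finally have "real Q / 2 * (\<Sum>t\<in>summation_box N. T t) \<le> real Q / 2 * (8 * C * harm (2 * Y))" by (simp add: mult_ac)
    then have upper: "(\<Sum>t\<in>summation_box N. T t) \<le> 8 * C * harm (2 * Y)"
      by (rule mult_left_le_imp_le) (simp add: Q_def)
    \<comment> \<open>The power to which the character of the coordinate \<open>\<nu>\<close>
      occurs. As \<open>\<Omega>\<close> is odd, its parity is opposite to that of
      \<open>m $ \<nu>\<close>.\<close>
    define e where "e \<nu> = (\<Sum>n\<in>\<Omega> - {m}. n $ \<nu>)" for \<nu>
    have e_parity: "even (e \<nu>) \<longleftrightarrow> odd (m $ \<nu>)" for \<nu>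
    proof -
      have "(\<Sum>n\<in>\<Omega>. n) $ \<nu> = m $ \<nu> + e \<nu>" using sum.remove[OF fin\<Omega> m, of "\<lambda>n. n $ \<nu>"] by (simp add: e_def)
      moreover have "odd ((\<Sum>n\<in>\<Omega>. n) $ \<nu>)" using \<Omega>(2) unfolding odd_set_def by blast
      ultimately have "odd (m $ \<nu> + e \<nu>)" by metis
      then show ?thesis unfolding even_add by blast
    qed
    define h where "h t \<nu> = chi4 (t $ \<nu>) ^ e \<nu> * sgn (of_int (t $ \<nu>)) ^ (m $ \<nu>) * sgn (of_int (t $ \<nu>))" for t :: "int ^ 'k" and \<nu>
    have T_eq: "T t = (\<Prod>\<nu>\<in>UNIV. h t \<nu>) / \<bar>P t\<bar>" for t
    proof -
      have "s t = (\<Prod>n\<in>\<Omega> - {m}. \<Prod>\<nu>\<in>UNIV. chi4 (t $ \<nu>) ^ (n $ \<nu>))"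
        by (simp add: s_def monomial_def chi4_prod chi4_power)
      also have "\<dots> = (\<Prod>\<nu>\<in>UNIV. \<Prod>n\<in>\<Omega> - {m}. chi4 (t $ \<nu>) ^ (n $ \<nu>))" by (rule prod.swap)
      also have "\<dots> = (\<Prod>\<nu>\<in>UNIV. chi4 (t $ \<nu>) ^ e \<nu>)" by (simp add: e_def power_sum)
      finally have s: "s t = (\<Prod>\<nu>\<in>UNIV. chi4 (t $ \<nu>) ^ e \<nu>)" .
      have sx: "sgn (real_of_int (x t)) = (\<Prod>\<nu>\<in>UNIV. sgn (of_int (t $ \<nu>)) ^ (m $ \<nu>))"
        by (simp add: x_def monomial_def sgn_prod)
      have sP: "sgn (P t) = (\<Prod>\<nu>\<in>UNIV. sgn (of_int (t $ \<nu>)))" by (simp add: P_def sgn_prod)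
      have "(\<Prod>\<nu>\<in>UNIV. h t \<nu>) = s t * sgn (of_int (x t)) * sgn (P t)"
        unfolding h_def prod.distrib s sx sP ..
      then have "(\<Prod>\<nu>\<in>UNIV. h t \<nu>) / \<bar>P t\<bar> = s t * sgn (of_int (x t)) * (sgn (P t) / \<bar>P t\<bar>)" by simp
      also have "sgn (P t) / \<bar>P t\<bar> = 1 / P t" by (simp add: sgn_if)
      finally show ?thesis by (simp add: T_def)
    qed
    \<comment> \<open>Where \<open>m $ \<nu>\<close> is odd, the character occurs to an even power,
      and so does the sign, once the one from the denominator is included. Where it is even, the
      coordinate is 1 or - 1, and an odd power of the character cancels the sign.\<close>
    have T_nonneg: "0 \<le> T t" if t: "t \<in> summation_box N" for t
    proof -
      have "0 \<le> h t \<nu>" for \<nu>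
      proof (cases "odd (m $ \<nu>)")
        case True
        have "h t \<nu> = chi4 (t $ \<nu>) ^ e \<nu> * sgn (of_int (t $ \<nu>)) ^ Suc (m $ \<nu>)" by (simp add: h_def)
        also have "\<dots> \<ge> 0" using True e_parity[of \<nu>] by (intro mult_nonneg_nonneg zero_le_even_power) auto
        finally show ?thesis .
      next
        case False
        then have "\<nu> \<noteq> a" "\<nu> \<noteq> b" using ab by auto
        from off[OF t this] show ?thesis using False e_parity[of \<nu>] by (auto simp: h_def)
      qed
      then show ?thesis unfolding T_eq by (intro divide_nonneg_nonneg prod_nonneg) auto
    qed
    \<comment> \<open>Points with odd positive coordinates at a and b: the character does not vanish
      there, all factors are 1, and these points alone give the square of a harmonic sum.\<close>
    define G :: "nat \<times> nat \<Rightarrow> int ^ 'k" where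
      "G = (\<lambda>(i, i'). \<chi> \<nu>. if \<nu> = a then 2 * int i + 1 else if \<nu> = b then 2 * int i' + 1 else 1)"
    have G_box: "G ` ({..A} \<times> {..A}) \<subseteq> summation_box N"
      by (auto simp: G_def summation_box_def N_def)
    have injG: "inj_on G ({..A} \<times> {..A})"
    proof (rule inj_onI, clarify)
      fix i i' j j' assume "G (i, i') = G (j, j')"
      then have "G (i, i') $ a = G (j, j') $ a" "G (i, i') $ b = G (j, j') $ b" by simp_all
      then show "i = j \<and> i' = j'" using ab(1) by (simp add: G_def)
    qed
    have TG: "T (G (i, i')) = 1 / (2 * real i + 1) * (1 / (2 * real i' + 1))" for i i'
    proof -
      have "h (G (i, i')) \<nu> = 1" for \<nu>
      proof (cases "odd (m $ \<nu>)")
        case True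
        have "odd (G (i, i') $ \<nu>)" "0 < G (i, i') $ \<nu>" by (auto simp: G_def)
        then show ?thesis using True e_parity[of \<nu>] by (simp add: h_def chi4_sq)
      next
        case False
        then have "\<nu> \<noteq> a" "\<nu> \<noteq> b" using ab by auto
        then show ?thesis by (simp add: h_def G_def)
      qed
      moreover have "P (G (i, i')) = (2 * real i + 1) * (2 * real i' + 1)"
      proof -
        have "(\<Prod>\<nu>\<in>UNIV. G (i, i') $ \<nu>) = (\<Prod>\<nu>\<in>{a, b}. G (i, i') $ \<nu>)"
          by (rule prod.mono_neutral_right) (auto simp: G_def)
        also have "\<dots> = (2 * int i + 1) * (2 * int i' + 1)" using ab(1) by (simp add: G_def)
        finally show ?thesis by (simp add: P_def)
      qed
      ultimately show ?thesis unfolding T_eq by simp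
    qed
    have "(harm (A + 1) / 2) ^ 2 \<le> (\<Sum>i\<le>A. 1 / (2 * real i + 1)) ^ 2"
      by (intro power_mono odd_harm_ge) (simp add: harm_nonneg)
    also have "\<dots> = (\<Sum>(i, i')\<in>{..A} \<times> {..A}. 1 / (2 * real i + 1) * (1 / (2 * real i' + 1)))"
      unfolding power2_eq_square sum_product by (simp add: sum.cartesian_product)
    also have "\<dots> = (\<Sum>q\<in>{..A} \<times> {..A}. T (G q))" by (rule sum.cong) (auto simp: TG)
    also have "\<dots> = (\<Sum>t\<in>G ` ({..A} \<times> {..A}). T t)" using injG by (simp add: sum.reindex)
    also have "\<dots> \<le> (\<Sum>t\<in>summation_box N. T t)"
      using G_box T_nonneg finite_summation_box[of N] by (intro sum_mono2) auto
    finally show ?thesis using upper by (simp add: power_divide Y_def)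
  qed
  have C0: "0 \<le> C"
  proof -
    have "(1::nat ^ 'k) \<in> positive_vectors" by (simp add: positive_vectors_def)
    from bounded[OF this, of "\<lambda>_. 0"] show ?thesis using norm_ge_zero order_trans by blast
  qed
  \<comment> \<open>Since Y is polynomial in A, the right-hand side of \<open>main\<close> is of
    first order in the logarithm of A while the left-hand side is its square; dividing bounds the
    harmonic numbers, which is absurd.\<close>
  have H_le: "harm (A + 1) \<le> 64 * C * (1 + real p)" for A
  proof -
    define H where "H = (harm (A + 1) :: real)"
    have H1: "1 \<le> H" unfolding H_def using harm_mono[of 1 "A + 1", where 'a=real] by (simp add: harm_expand)
    have "ln (real (A + 1) + 1) \<le> H" unfolding H_def by (rule ln_le_harm)
    moreover have "ln (real (A + 1)) \<le> ln (real (A + 1) + 1)" by simp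
    ultimately have lnA: "ln (real (A + 1)) \<le> H" by linarith
    have "harm (2 * (2 * A + 1) ^ p) \<le> 1 + ln (real (2 * (2 * A + 1) ^ p))" by (rule harm_le_ln) simp
    also have "ln (real (2 * (2 * A + 1) ^ p)) = ln 2 + real p * ln (real (2 * A + 1))"
      by (simp add: ln_mult ln_realpow add_pos_nonneg)
    also have "ln (real (2 * A + 1)) \<le> ln (2 * real (A + 1))" by simp
    also have "ln (2 * real (A + 1)) = ln 2 + ln (real (A + 1))" by (rule ln_mult_pos) auto
    finally have "harm (2 * (2 * A + 1) ^ p) \<le> 1 + (ln 2 + real p * (ln 2 + ln (real (A + 1))))"
      by (simp add: mult_left_mono)
    also have "\<dots> \<le> 1 + (1 + real p * (1 + H))"
      using ln_2_less_1 lnA by (intro add_mono mult_left_mono) auto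
    also have "\<dots> \<le> 2 * H + real p * (H + H)" using H1 by (intro order_trans[OF _ add_mono[OF _ mult_left_mono[of "1 + H" "H + H"]]]) auto
    finally have "harm (2 * (2 * A + 1) ^ p) \<le> 2 * (1 + real p) * H" by (simp add: algebra_simps)
    then have "32 * C * harm (2 * (2 * A + 1) ^ p) \<le> 32 * C * (2 * (1 + real p) * H)" using C0 by (intro mult_left_mono) auto
    with main[of A] have "H ^ 2 \<le> 32 * C * (2 * (1 + real p) * H)" unfolding H_def by (rule order_trans)
    then have "H * H \<le> (64 * C * (1 + real p)) * H" by (simp add: power2_eq_square mult_ac)
    then show ?thesis unfolding H_def[symmetric] by (rule mult_right_le_imp_le) (use H1 in simp)
  qed
  have "eventually (\<lambda>n. 64 * C * (1 + real p) + 1 \<le> (harm n :: real)) sequentially"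
    using harm_at_top by (simp add: filterlim_at_top)
  then obtain n where n: "64 * C * (1 + real p) + 1 \<le> (harm n :: real)" by (meson eventually_sequentially order_refl)
  have "harm n \<le> (harm (n + 1) :: real)" by (rule harm_mono) simp
  then show False using n H_le[of n] by linarith
qed

lemma hilbert_sum_unbounded:
  fixes \<Lambda> :: "(nat ^ 'k::finite) set"
  assumes \<Lambda>: "finite \<Lambda>" and ex: "\<exists>\<Omega>\<subseteq>\<Lambda>. odd_set \<Omega>" and m: "m \<in> \<Lambda>" "1 < card {\<nu>. odd (m $ \<nu>)}"
  shows "\<exists>N\<in>positive_vectors. \<exists>\<xi>. C < norm (hilbert_sum \<Lambda> N \<xi>)"
proof -
  obtain \<Omega> m' where \<Omega>: "\<Omega> \<subseteq> \<Lambda>" "odd_set \<Omega>" "\<And>\<Omega>'. \<Omega>' \<subseteq> \<Omega> \<Longrightarrow> odd_set \<Omega>' \<Longrightarrow> \<Omega>' = \<Omega>"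
    and m': "m' \<in> \<Omega>" "1 < card {\<nu>. odd (m' $ \<nu>)}"
    by (rule minimal_odd_subset[OF \<Lambda> ex m]) blast
  have "\<exists>a b. a \<noteq> b \<and> odd (m' $ a) \<and> odd (m' $ b)"
    using m'(2) card_le_Suc0_iff_eq[of "{\<nu>. odd (m' $ \<nu>)}"] by auto
  then obtain a b where ab: "a \<noteq> b" "odd (m' $ a)" "odd (m' $ b)" by blast
  show ?thesis by (rule minimal_odd_unbounded[OF \<Lambda> \<Omega> m'(1) ab])
qed

subsection \<open>The characterisation\<close>

lemma residue2_eq_axis:
  fixes m :: "nat ^ 'k::finite"
  shows "residue2 m = axis \<nu> 1 \<longleftrightarrow> {\<kappa>. odd (m $ \<kappa>)} = {\<nu>}"
proof -
  have "residue2 m = axis \<nu> 1 \<longleftrightarrow> (\<forall>\<kappa>. m $ \<kappa> mod 2 = (if \<kappa> = \<nu> then 1 else 0))"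
    by (simp add: residue2_def vec_eq_iff axis_def)
  also have "\<dots> \<longleftrightarrow> (\<forall>\<kappa>. odd (m $ \<kappa>) \<longleftrightarrow> \<kappa> = \<nu>)"
    by (rule arg_cong[where f=All], rule ext) (simp add: odd_iff_mod_2_eq_one)
  also have "\<dots> \<longleftrightarrow> {\<kappa>. odd (m $ \<kappa>)} = {\<nu>}" by auto
  finally show ?thesis .
qed

lemma residue2_eq_0:
  fixes m :: "nat ^ 'k::finite"
  shows "residue2 m = 0 \<longleftrightarrow> {\<kappa>. odd (m $ \<kappa>)} = {}"
  by (simp add: residue2_def vec_eq_iff even_iff_mod_2_eq_zero)

text \<open>An odd subset has, for every coordinate, a member that is odd there, so all unit vectors
  occur once every residue is 0 or a unit vector. Conversely, an exponent with two odd components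
  need not lie in a given odd subset, but \<open>minimal_odd_subset\<close> provides an odd subset
  with such a member.\<close>

lemma residue_condition:
  fixes \<Lambda> :: "(nat ^ 'k::finite) set"
  assumes \<Lambda>: "finite \<Lambda>" and ex: "\<exists>\<Omega>\<subseteq>\<Lambda>. odd_set \<Omega>"
  shows "(\<forall>m\<in>\<Lambda>. card {\<nu>. odd (m $ \<nu>)} \<le> 1) \<longleftrightarrow>
    (\<forall>\<Omega>\<subseteq>\<Lambda>. odd_set \<Omega> \<longrightarrow> residue2 ` \<Omega> = unit_vectors \<or> residue2 ` \<Omega> = insert 0 unit_vectors)"
proof
  assume one: "\<forall>m\<in>\<Lambda>. card {\<nu>. odd (m $ \<nu>)} \<le> 1"
  show "\<forall>\<Omega>\<subseteq>\<Lambda>. odd_set \<Omega> \<longrightarrow> residue2 ` \<Omega> = unit_vectors \<or> residue2 ` \<Omega> = insert 0 unit_vectors"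
  proof (intro allI impI)
    fix \<Omega> assume \<Omega>: "\<Omega> \<subseteq> \<Lambda>" "odd_set \<Omega>"
    have fin: "finite \<Omega>" using \<Omega> \<Lambda> finite_subset by blast
    have cases: "{\<nu>. odd (m $ \<nu>)} = {} \<or> (\<exists>\<nu>. {\<nu>. odd (m $ \<nu>)} = {\<nu>})" if "m \<in> \<Omega>" for m
    proof -
      have "card {\<nu>. odd (m $ \<nu>)} = 0 \<or> card {\<nu>. odd (m $ \<nu>)} = 1" using one \<Omega>(1) that by (metis One_nat_def le_Suc_eq le_zero_eq subsetD)
      then show ?thesis by (auto simp: card_1_singleton_iff)
    qed
    then have sub: "residue2 ` \<Omega> \<subseteq> insert 0 unit_vectors"
      unfolding residue2_eq_axis[symmetric] residue2_eq_0[symmetric] unit_vectors_def by blast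
    have sup: "unit_vectors \<subseteq> residue2 ` \<Omega>"
    proof
      fix v :: "nat ^ 'k" assume "v \<in> unit_vectors"
      then obtain \<nu> where \<nu>: "v = axis \<nu> 1" by (auto simp: unit_vectors_def)
      have "{m\<in>\<Omega>. odd (m $ \<nu>)} \<noteq> {}" using \<Omega>(2) odd_set_iff[OF fin] by (metis card.empty even_zero)
      then obtain m where m: "m \<in> \<Omega>" "odd (m $ \<nu>)" by blast
      then have mem: "\<nu> \<in> {\<kappa>. odd (m $ \<kappa>)}" by simp
      then obtain \<nu>' where \<nu>': "{\<kappa>. odd (m $ \<kappa>)} = {\<nu>'}" using cases[OF m(1)] by blast
      have "{\<kappa>. odd (m $ \<kappa>)} = {\<nu>}" using mem unfolding \<nu>' by simp
      then have "residue2 m = v" unfolding \<nu> residue2_eq_axis .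
      then show "v \<in> residue2 ` \<Omega>" using m(1) by blast
    qed
    show "residue2 ` \<Omega> = unit_vectors \<or> residue2 ` \<Omega> = insert 0 unit_vectors"
    proof (cases "0 \<in> residue2 ` \<Omega>")
      case True
      then have "residue2 ` \<Omega> = insert 0 unit_vectors" by (intro equalityI insert_subsetI sub sup)
      then show ?thesis ..
    next
      case False
      then have "residue2 ` \<Omega> = unit_vectors" using sub by (intro equalityI sup) (simp add: subset_insert)
      then show ?thesis ..
    qed
  qed
next
  assume res: "\<forall>\<Omega>\<subseteq>\<Lambda>. odd_set \<Omega> \<longrightarrow> residue2 ` \<Omega> = unit_vectors \<or> residue2 ` \<Omega> = insert 0 unit_vectors"
  show "\<forall>m\<in>\<Lambda>. card {\<nu>. odd (m $ \<nu>)} \<le> 1"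
  proof (rule ballI, rule ccontr)
    fix m assume "m \<in> \<Lambda>" "\<not> card {\<nu>. odd (m $ \<nu>)} \<le> 1"
    then have m: "m \<in> \<Lambda>" "1 < card {\<nu>. odd (m $ \<nu>)}" by simp_all
    obtain \<Omega> m' where \<Omega>: "\<Omega> \<subseteq> \<Lambda>" "odd_set \<Omega>" and m': "m' \<in> \<Omega>" "1 < card {\<nu>. odd (m' $ \<nu>)}"
      by (rule minimal_odd_subset[OF \<Lambda> ex m], rule that)
    have "residue2 m' \<in> residue2 ` \<Omega>" using m'(1) by (rule imageI)
    moreover have "residue2 ` \<Omega> \<subseteq> insert 0 unit_vectors" using res[rule_format, OF \<Omega>] by blast
    ultimately have "residue2 m' \<in> insert 0 unit_vectors" by blast
    then have "residue2 m' = 0 \<or> (\<exists>\<nu>. residue2 m' = axis \<nu> 1)" unfolding unit_vectors_def by blast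
    then have "card {\<nu>. odd (m' $ \<nu>)} \<le> 1"
      unfolding residue2_eq_axis residue2_eq_0
    proof
      assume "\<exists>\<nu>. {\<kappa>. odd (m' $ \<kappa>)} = {\<nu>}"
      then obtain \<nu> where \<nu>: "{\<kappa>. odd (m' $ \<kappa>)} = {\<nu>}" ..
      show ?thesis unfolding \<nu> by simp
    next
      assume none: "{\<kappa>. odd (m' $ \<kappa>)} = {}"
      show ?thesis unfolding none by simp
    qed
    then show False using m'(2) by simp
  qed
qed

theorem theorem1:
  fixes \<Lambda> :: "(nat ^ 'k::finite) set"
  assumes "finite \<Lambda>"
  shows "(\<not> (\<exists>\<Omega>\<subseteq>\<Lambda>. odd_set \<Omega>) \<longrightarrow> hilbert_sup \<Lambda> = 0)
    \<and> ((\<exists>\<Omega>\<subseteq>\<Lambda>. odd_set \<Omega>) \<longrightarrow>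
        ((\<exists>C::real. C > 0 \<and> hilbert_sup \<Lambda> \<le> ereal C)
          \<longleftrightarrow> (\<forall>m\<in>\<Lambda>. card {\<nu>. odd (m $ \<nu>)} \<le> 1)))
    \<and> (bounded {hilbert_sum \<Lambda> N \<xi> |N \<xi>. N \<in> positive_vectors}
        \<longleftrightarrow> (\<not> (\<exists>\<Omega>\<subseteq>\<Lambda>. odd_set \<Omega>)
          \<or> (\<forall>\<Omega>\<subseteq>\<Lambda>. odd_set \<Omega> \<longrightarrow>
                residue2 ` \<Omega> = unit_vectors \<or> residue2 ` \<Omega> = insert 0 unit_vectors)))"
proof -
  let ?odd = "\<exists>\<Omega>\<subseteq>\<Lambda>. odd_set \<Omega>"
  let ?one = "\<forall>m\<in>\<Lambda>. card {\<nu>. odd (m $ \<nu>)} \<le> 1"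
  have one_pos: "(1 :: nat ^ 'k) \<in> positive_vectors" by (simp add: positive_vectors_def)
  have zero: "hilbert_sum \<Lambda> N \<xi> = 0" if "\<not> ?odd" for N \<xi>
  proof -
    have none: "{\<Omega>. \<Omega> \<subseteq> \<Lambda> \<and> odd_set \<Omega>} = {}" using that by blast
    show ?thesis unfolding hilbert_sum_odd_expand[OF assms] none by simp
  qed
  have sup_le: "hilbert_sup \<Lambda> \<le> ereal C \<longleftrightarrow> (\<forall>N\<in>positive_vectors. \<forall>\<xi>. norm (hilbert_sum \<Lambda> N \<xi>) \<le> C)" for C
    unfolding hilbert_sup_def SUP_le_iff by auto
  have bdd: "bounded {hilbert_sum \<Lambda> N \<xi> |N \<xi>. N \<in> positive_vectors}
      \<longleftrightarrow> (\<exists>C. \<forall>N\<in>positive_vectors. \<forall>\<xi>. norm (hilbert_sum \<Lambda> N \<xi>) \<le> C)"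
    unfolding bounded_iff by blast
  have one_iff: "(\<exists>C. \<forall>N\<in>positive_vectors. \<forall>\<xi>. norm (hilbert_sum \<Lambda> N \<xi>) \<le> C) \<longleftrightarrow> ?one" if ?odd
  proof
    assume "\<exists>C. \<forall>N\<in>positive_vectors. \<forall>\<xi>. norm (hilbert_sum \<Lambda> N \<xi>) \<le> C"
    then show ?one using hilbert_sum_unbounded[OF assms that] by (meson not_le)
  next
    assume ?one
    then obtain C where "\<And>N \<xi>. norm (hilbert_sum \<Lambda> N \<xi>) \<le> C" using hilbert_sum_bounded[OF assms] by metis
    then show "\<exists>C. \<forall>N\<in>positive_vectors. \<forall>\<xi>. norm (hilbert_sum \<Lambda> N \<xi>) \<le> C" by blast
  qed
  have pos: "(\<exists>C::real. C > 0 \<and> hilbert_sup \<Lambda> \<le> ereal C) \<longleftrightarrow> (\<exists>C. \<forall>N\<in>positive_vectors. \<forall>\<xi>. norm (hilbert_sum \<Lambda> N \<xi>) \<le> C)"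
    unfolding sup_le
  proof
    assume "\<exists>C. \<forall>N\<in>positive_vectors. \<forall>\<xi>. norm (hilbert_sum \<Lambda> N \<xi>) \<le> C"
    then obtain C where "\<forall>N\<in>positive_vectors. \<forall>\<xi>. norm (hilbert_sum \<Lambda> N \<xi>) \<le> C" ..
    then show "\<exists>C>0. \<forall>N\<in>positive_vectors. \<forall>\<xi>. norm (hilbert_sum \<Lambda> N \<xi>) \<le> C"
      by (intro exI[of _ "max C 1"]) (auto intro: max.coboundedI1)
  qed blast
  show ?thesis
  proof (intro conjI impI)
    assume "\<not> ?odd"
    then have eq: "(\<lambda>(N, \<xi>). ereal (norm (hilbert_sum \<Lambda> N \<xi>))) = (\<lambda>_. 0)" by (auto simp: zero zero_ereal_def)
    show "hilbert_sup \<Lambda> = 0" unfolding hilbert_sup_def eq using one_pos by (intro SUP_const) auto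
  next
    assume ?odd
    then show "(\<exists>C::real. C > 0 \<and> hilbert_sup \<Lambda> \<le> ereal C) \<longleftrightarrow> ?one" unfolding pos by (rule one_iff)
  next
    show "bounded {hilbert_sum \<Lambda> N \<xi> |N \<xi>. N \<in> positive_vectors} \<longleftrightarrow> (\<not> ?odd
      \<or> (\<forall>\<Omega>\<subseteq>\<Lambda>. odd_set \<Omega> \<longrightarrow> residue2 ` \<Omega> = unit_vectors \<or> residue2 ` \<Omega> = insert 0 unit_vectors))"
    proof (cases ?odd)
      case True
      then show ?thesis unfolding bdd one_iff[OF True] residue_condition[OF assms True] by blast
    next
      case False
      then have "\<exists>C. \<forall>N\<in>positive_vectors. \<forall>\<xi>. norm (hilbert_sum \<Lambda> N \<xi>) \<le> C"
        by (intro exI[of _ 0]) (simp add: zero)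
      then show ?thesis using False bdd by blast
    qed
  qed
qed

end
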